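(* Let $n\ge3$ and let $L=L_0\oplus L_1$ be a non-nilpotent solvable Leibniz superalgebra whose nilradical is isomorphic to a non-split superalgebra $N$ from the class $G(\beta_4,\beta_5,\dots,\beta_n,\gamma)$ defined in the context. Then $L$ is isomorphic to one of the following pairwise non-isomorphic superalgebras $SG_1(t)$ $(4\le t\le n)$, $SG_2(\gamma)$ ($n$ odd, $\gamma\in\mathbb C$, $\gamma\ne0$), $SG_3$. Each of them has even basis $e_1,\dots,e_n,x$, odd basis $y_1,\dots,y_{n-1}$, and has the products $$\begin{aligned} &[e_1,e_1]=e_3,\quad [e_i,e_1]=e_{i+1}\ (3\le i\le n-1),\quad [y_j,e_1]=y_{j+1}\ (1\le j\le n-2),\\ &[y_1,y_1]=e_1,\quad [y_j,y_1]=e_{j+1}\ (2\le j\le n-1),\quad [e_1,y_1]=\tfrac12y_2,\quad [e_i,y_1]=\tfrac12y_i\ (3\le i\le n-1),\\ &[y_i,x]=(2i-1)y_i\ (1\le i\le n-1),\quad [x,y_1]=-y_1,\quad [e_1,x]=2e_1,\quad [x,e_1]=-2e_1,\quad [e_i,x]=2(i-1)e_i\ (3\le i\le n), \end{aligned}$$ together with the following ones (omitted products of basis elements are zero, $e_k=0$ for $k>n$ and $y_k=0$ for $k>n-1$): $SG_1(t)$, $4\le t\le n$: $[e_1,e_2]=e_t$, $[e_j,e_2]=e_{j+t-2}$ $(3\le j\le n-2)$, $[y_j,e_2]=y_{j+t-2}$ $(1\le j\le n-3)$, $[e_2,x]=2(t-2)e_2$, $[x,e_2]=-2(t-2)e_2-2e_{t-1}$.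 $SG_2(\gamma)$, $n$ odd, $\gamma\neq0$: $[e_1,e_2]=e_{\frac{n+3}2}$, $[e_j,e_2]=e_{j+\frac{n-1}2}$ $(3\le j\le n-2)$, $[y_j,e_2]=y_{j+\frac{n-1}2}$ $(1\le j\le n-3)$, $[e_2,e_2]=\gamma e_n$, $[e_2,x]=(n-1)e_2$, $[x,e_2]=-(n-1)e_2-2e_{\frac{n+1}2}$. $SG_3$: $[e_2,e_2]=e_n$, $[e_2,x]=(n-1)e_2$, $[x,e_2]=-(n-1)e_2$.
   Context: All vector spaces are finite-dimensional over $\mathbb C$; isomorphisms preserve the $\mathbb Z_2$-grading. A Leibniz superalgebra is a $\mathbb Z_2$-graded vector space $L=L_0\oplus L_1$ with an even (grading-compatible) bilinear product $[-,-]$ such that $[x,[y,z]]=[[x,y],z]-(-1)^{\alpha\beta}[[x,z],y]$ for all $x\in L$, $y\in L_\alpha$, $z\in L_\beta$. Nilpotency and solvability are defined as for Leibniz algebras, via $L^1=L,\ L^{k+1}=[L^k,L]$ and $L^{[1]}=L,\ L^{[k+1]}=[L^{[k]},L^{[k]}]$ respectively. The nilradical of $L$ is the maximal nilpotent ideal $N$ of $L$ such that $[L,L]\subset N$. Class $G(\beta_4,\dots,\beta_n,\gamma)$: nilpotent Leibniz superalgebras with even basis $e_1,\dots,e_n$, odd basis $y_1,\dots,y_{n-1}$ and the following products (omitted products of basis elements are zero, empty sums are zero; the parameters are complex numbers): $$\begin{aligned} &[e_1,e_1]=e_3,\quad [e_i,e_1]=e_{i+1}\ (3\le i\le n-1),\quad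 [y_j,e_1]=y_{j+1}\ (1\le j\le n-2),\\ &[e_1,y_1]=\tfrac12y_2,\quad [e_i,y_1]=\tfrac12y_i\ (3\le i\le n-1),\\ &[y_1,y_1]=e_1,\quad [y_j,y_1]=e_{j+1}\ (2\le j\le n-1),\\ &[e_1,e_2]=\sum_{k=4}^{n}\beta_ke_k,\quad [e_2,e_2]=\gamma e_n,\quad [e_j,e_2]=\sum_{k=4}^{n+2-j}\beta_ke_{k+j-2}\ (3\le j\le n-2),\\ &[y_j,e_2]=\sum_{k=4}^{n+1-j}\beta_ky_{k+j-2}\ (1\le j\le n-3). \end{aligned}$$ A superalgebra of this class is called non-split if at least one of its parameters $\beta_4,\dots,\beta_n,\gamma$ is nonzero. *)

theory Defs
  imports Complex_Main "HOL-Library.Z2" "HOL-Library.Function_Algebras"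
begin

section \<open>Leibniz superalgebras\<close>

text \<open>The space underlying a superalgebra is a finite-dimensional subspace of an ambient complex
  vector space (the type of the vectors with the scalar multiplication \<open>smult\<close>), so that ideals and
  the concrete algebras below are superalgebras in the same sense. The degree is an element of the
  two-element field \<open>bit\<close>, and \<open>part L \<alpha>\<close> is the homogeneous component of degree \<open>\<alpha>\<close>.\<close>

record 'a superalg =
  smult :: "complex \<Rightarrow> 'a \<Rightarrow> 'a"
  part :: "bit \<Rightarrow> 'a set"
  bracket :: "'a \<Rightarrow> 'a \<Rightarrow> 'a"

definition carrier :: "'a::ab_group_add superalg \<Rightarrow> 'a set" where
  "carrier L = {u + v |u v. u \<in> part L 0 \<and> v \<in> part L 1}"

definition superalgebra :: "'a::ab_group_add superalg \<Rightarrow> bool" where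
  "superalgebra L \<longleftrightarrow>
     vector_space (smult L) \<and>
     (\<forall>\<alpha>. module.subspace (smult L) (part L \<alpha>)) \<and>
     part L 0 \<inter> part L 1 = {0} \<and>
     (\<exists>B. finite B \<and> carrier L \<subseteq> module.span (smult L) B) \<and>
     (\<forall>u\<in>carrier L. \<forall>v\<in>carrier L. \<forall>w\<in>carrier L.
        bracket L (u + v) w = bracket L u w + bracket L v w \<and>
        bracket L u (v + w) = bracket L u v + bracket L u w) \<and>
     (\<forall>c. \<forall>u\<in>carrier L. \<forall>v\<in>carrier L.
        bracket L (smult L c u) v = smult L c (bracket L u v) \<and>
        bracket L u (smult L c v) = smult L c (bracket L u v)) \<and>
     (\<forall>\<alpha> \<beta>. \<forall>u\<in>part L \<alpha>. \<forall>v\<in>part L \<beta>. bracket L u v \<in> part L (\<alpha> + \<beta>))"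

text \<open>The sign \<open>(-1)\<^sup>\<alpha>\<^sup>\<beta>\<close>.\<close>

definition koszul_sign :: "bit \<Rightarrow> bit \<Rightarrow> complex" where
  "koszul_sign \<alpha> \<beta> = (if \<alpha> = 1 \<and> \<beta> = 1 then - 1 else 1)"

definition leibniz_superalgebra :: "'a::ab_group_add superalg \<Rightarrow> bool" where
  "leibniz_superalgebra L \<longleftrightarrow>
     superalgebra L \<and>
     (\<forall>\<alpha> \<beta>. \<forall>u\<in>carrier L. \<forall>v\<in>part L \<alpha>. \<forall>w\<in>part L \<beta>.
        bracket L u (bracket L v w) =
          bracket L (bracket L u v) w
          - smult L (koszul_sign \<alpha> \<beta>) (bracket L (bracket L u w) v))"

definition bracket_span :: "'a::ab_group_add superalg \<Rightarrow> 'a set \<Rightarrow> 'a set \<Rightarrow> 'a set" where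
  "bracket_span L A B = module.span (smult L) {bracket L u v |u v. u \<in> A \<and> v \<in> B}"

text \<open>Both series are indexed from 0 here: \<open>lower_series L k\<close> is the term usually written
  \<open>L\<close> with upper index \<open>k + 1\<close>, and likewise for the derived series.\<close>

primrec lower_series :: "'a::ab_group_add superalg \<Rightarrow> nat \<Rightarrow> 'a set" where
  "lower_series L 0 = carrier L"
| "lower_series L (Suc k) = bracket_span L (lower_series L k) (carrier L)"

primrec derived_series :: "'a::ab_group_add superalg \<Rightarrow> nat \<Rightarrow> 'a set" where
  "derived_series L 0 = carrier L"
| "derived_series L (Suc k) = bracket_span L (derived_series L k) (derived_series L k)"

definition nilpotent :: "'a::ab_group_add superalg \<Rightarrow> bool" where
  "nilpotent L \<longleftrightarrow> (\<exists>k. lower_series L k = {0})"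

definition solvable :: "'a::ab_group_add superalg \<Rightarrow> bool" where
  "solvable L \<longleftrightarrow> (\<exists>k. derived_series L k = {0})"

text \<open>Ideals of a superalgebra are two-sided and graded.\<close>

definition ideal :: "'a::ab_group_add superalg \<Rightarrow> 'a set \<Rightarrow> bool" where
  "ideal L I \<longleftrightarrow>
     module.subspace (smult L) I \<and>
     I = {u + v |u v. u \<in> I \<inter> part L 0 \<and> v \<in> I \<inter> part L 1} \<and>
     (\<forall>u\<in>I. \<forall>v\<in>carrier L. bracket L u v \<in> I \<and> bracket L v u \<in> I)"

definition restrict_to :: "'a superalg \<Rightarrow> 'a set \<Rightarrow> 'a superalg" where
  "restrict_to L I = L\<lparr>part := (\<lambda>\<alpha>. part L \<alpha> \<inter> I)\<rparr>"

definition nilpotent_ideal_above_derived :: "'a::ab_group_add superalg \<Rightarrow> 'a set \<Rightarrow> bool" where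
  "nilpotent_ideal_above_derived L I \<longleftrightarrow>
     ideal L I \<and> nilpotent (restrict_to L I) \<and> bracket_span L (carrier L) (carrier L) \<subseteq> I"

definition is_nilradical :: "'a::ab_group_add superalg \<Rightarrow> 'a set \<Rightarrow> bool" where
  "is_nilradical L N \<longleftrightarrow>
     nilpotent_ideal_above_derived L N \<and>
     (\<forall>M. nilpotent_ideal_above_derived L M \<and> N \<subseteq> M \<longrightarrow> M = N)"

definition isomorphic :: "'a::ab_group_add superalg \<Rightarrow> 'b::ab_group_add superalg \<Rightarrow> bool" where
  "isomorphic L M \<longleftrightarrow> (\<exists>f.
     bij_betw f (carrier L) (carrier M) \<and>
     (\<forall>u\<in>carrier L. \<forall>v\<in>carrier L. f (u + v) = f u + f v) \<and>
     (\<forall>c. \<forall>u\<in>carrier L. f (smult L c u) = smult M c (f u)) \<and>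
     (\<forall>\<alpha>. f ` part L \<alpha> = part M \<alpha>) \<and>
     (\<forall>u\<in>carrier L. \<forall>v\<in>carrier L. f (bracket L u v) = bracket M (f u) (f v)))"


section \<open>Superalgebras given by a multiplication table\<close>

text \<open>The basis elements \<open>e\<^sub>i\<close>, \<open>y\<^sub>j\<close> and \<open>x\<close> are indexed by \<open>E i\<close>, \<open>Y j\<close> and \<open>X\<close>; a vector is
  its coordinate function.\<close>

datatype gen = E nat | Y nat | X

type_synonym vec = "gen \<Rightarrow> complex"

primrec gen_degree :: "gen \<Rightarrow> bit" where
  "gen_degree (E i) = 0"
| "gen_degree (Y j) = 1"
| "gen_degree X = 0"

definition vscale :: "complex \<Rightarrow> vec \<Rightarrow> vec"  (infixr "\<odot>" 75) where
  "c \<odot> v = (\<lambda>g. c * v g)"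

definition unit_vec :: "gen \<Rightarrow> vec" where
  "unit_vec g = (\<lambda>h. if h = g then 1 else 0)"

definition table_algebra :: "gen set \<Rightarrow> (gen \<Rightarrow> gen \<Rightarrow> vec) \<Rightarrow> vec superalg" where
  "table_algebra S m =
     \<lparr>smult = vscale,
      part = (\<lambda>\<alpha>. {v. \<forall>g. v g \<noteq> 0 \<longrightarrow> g \<in> S \<and> gen_degree g = \<alpha>}),
      bracket = (\<lambda>u v. \<Sum>g\<in>S. \<Sum>h\<in>S. (u g * v h) \<odot> m g h)\<rparr>"

text \<open>The vectors \<open>e\<^sub>k\<close> and \<open>y\<^sub>k\<close>, which are zero outside the ranges \<open>1 \<le> k \<le> n\<close> and
  \<open>1 \<le> k \<le> n - 1\<close>.\<close>

definition e_vec :: "nat \<Rightarrow> nat \<Rightarrow> vec" where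
  "e_vec n k = (if 1 \<le> k \<and> k \<le> n then unit_vec (E k) else 0)"

definition y_vec :: "nat \<Rightarrow> nat \<Rightarrow> vec" where
  "y_vec n k = (if 1 \<le> k \<and> k \<le> n - 1 then unit_vec (Y k) else 0)"

definition nil_basis :: "nat \<Rightarrow> gen set" where
  "nil_basis n = E ` {1..n} \<union> Y ` {1..n - 1}"

text \<open>Each table below is a sum of partial tables with disjoint supports. The first one contains the
  products common to all algebras that involve neither \<open>e\<^sub>2\<close> nor \<open>x\<close>.\<close>

fun base_table :: "nat \<Rightarrow> gen \<Rightarrow> gen \<Rightarrow> vec" where
  "base_table n (E i) (E j) =
     (if i = 1 \<and> j = 1 then e_vec n 3
      else if 3 \<le> i \<and> i \<le> n - 1 \<and> j = 1 then e_vec n (i + 1)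
      else 0)"
| "base_table n (Y i) (E j) =
     (if 1 \<le> i \<and> i \<le> n - 2 \<and> j = 1 then y_vec n (i + 1) else 0)"
| "base_table n (E i) (Y j) =
     (if i = 1 \<and> j = 1 then (1/2) \<odot> y_vec n 2
      else if 3 \<le> i \<and> i \<le> n - 1 \<and> j = 1 then (1/2) \<odot> y_vec n i
      else 0)"
| "base_table n (Y i) (Y j) =
     (if i = 1 \<and> j = 1 then e_vec n 1
      else if 2 \<le> i \<and> i \<le> n - 1 \<and> j = 1 then e_vec n (i + 1)
      else 0)"
| "base_table n _ _ = 0"


section \<open>The nilpotent class\<close>

fun G_table :: "nat \<Rightarrow> (nat \<Rightarrow> complex) \<Rightarrow> complex \<Rightarrow> gen \<Rightarrow> gen \<Rightarrow> vec" where
  "G_table n \<beta> \<gamma> (E i) (E j) =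
     (if i = 1 \<and> j = 2 then (\<Sum>k = 4..n. \<beta> k \<odot> e_vec n k)
      else if i = 2 \<and> j = 2 then \<gamma> \<odot> e_vec n n
      else if 3 \<le> i \<and> i \<le> n - 2 \<and> j = 2 then (\<Sum>k = 4..n + 2 - i. \<beta> k \<odot> e_vec n (k + i - 2))
      else 0)"
| "G_table n \<beta> \<gamma> (Y i) (E j) =
     (if 1 \<le> i \<and> i \<le> n - 3 \<and> j = 2 then (\<Sum>k = 4..n + 1 - i. \<beta> k \<odot> y_vec n (k + i - 2)) else 0)"
| "G_table n \<beta> \<gamma> _ _ = 0"

text \<open>Only the values \<open>\<beta> 4, \<dots>, \<beta> n\<close> matter.\<close>

definition G :: "nat \<Rightarrow> (nat \<Rightarrow> complex) \<Rightarrow> complex \<Rightarrow> vec superalg" where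
  "G n \<beta> \<gamma> = table_algebra (nil_basis n) (\<lambda>g h. base_table n g h + G_table n \<beta> \<gamma> g h)"

definition non_split :: "nat \<Rightarrow> (nat \<Rightarrow> complex) \<Rightarrow> complex \<Rightarrow> bool" where
  "non_split n \<beta> \<gamma> \<longleftrightarrow> (\<exists>k\<in>{4..n}. \<beta> k \<noteq> 0) \<or> \<gamma> \<noteq> 0"


section \<open>The solvable extensions\<close>

fun x_table :: "nat \<Rightarrow> gen \<Rightarrow> gen \<Rightarrow> vec" where
  "x_table n (Y i) X = (if 1 \<le> i \<and> i \<le> n - 1 then (2 * of_nat i - 1) \<odot> y_vec n i else 0)"
| "x_table n X (Y j) = (if j = 1 then (- 1) \<odot> y_vec n 1 else 0)"
| "x_table n (E i) X =
     (if i = 1 then 2 \<odot> e_vec n 1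
      else if 3 \<le> i \<and> i \<le> n then (2 * (of_nat i - 1)) \<odot> e_vec n i
      else 0)"
| "x_table n X (E j) = (if j = 1 then (- 2) \<odot> e_vec n 1 else 0)"
| "x_table n _ _ = 0"

fun SG1_table :: "nat \<Rightarrow> nat \<Rightarrow> gen \<Rightarrow> gen \<Rightarrow> vec" where
  "SG1_table n t (E i) (E j) =
     (if i = 1 \<and> j = 2 then e_vec n t
      else if 3 \<le> i \<and> i \<le> n - 2 \<and> j = 2 then e_vec n (i + t - 2)
      else 0)"
| "SG1_table n t (Y i) (E j) =
     (if 1 \<le> i \<and> i \<le> n - 3 \<and> j = 2 then y_vec n (i + t - 2) else 0)"
| "SG1_table n t (E i) X = (if i = 2 then (2 * (of_nat t - 2)) \<odot> e_vec n 2 else 0)"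
| "SG1_table n t X (E j) =
     (if j = 2 then (- 2 * (of_nat t - 2)) \<odot> e_vec n 2 + (- 2) \<odot> e_vec n (t - 1) else 0)"
| "SG1_table n t _ _ = 0"

text \<open>The following table is used for odd \<open>n\<close> only, so all divisions by 2 are exact. For
  \<open>n = 3\<close> it says \<open>[x, e\<^sub>2] = - 4 e\<^sub>2\<close>, and the Leibniz identity fails.\<close>

fun SG2_table :: "nat \<Rightarrow> complex \<Rightarrow> gen \<Rightarrow> gen \<Rightarrow> vec" where
  "SG2_table n \<gamma> (E i) (E j) =
     (if i = 1 \<and> j = 2 then e_vec n ((n + 3) div 2)
      else if 3 \<le> i \<and> i \<le> n - 2 \<and> j = 2 then e_vec n (i + (n - 1) div 2)
      else if i = 2 \<and> j = 2 then \<gamma> \<odot> e_vec n n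
      else 0)"
| "SG2_table n \<gamma> (Y i) (E j) =
     (if 1 \<le> i \<and> i \<le> n - 3 \<and> j = 2 then y_vec n (i + (n - 1) div 2) else 0)"
| "SG2_table n \<gamma> (E i) X = (if i = 2 then (of_nat n - 1) \<odot> e_vec n 2 else 0)"
| "SG2_table n \<gamma> X (E j) =
     (if j = 2 then (- (of_nat n - 1)) \<odot> e_vec n 2 + (- 2) \<odot> e_vec n ((n + 1) div 2) else 0)"
| "SG2_table n \<gamma> _ _ = 0"

fun SG3_table :: "nat \<Rightarrow> gen \<Rightarrow> gen \<Rightarrow> vec" where
  "SG3_table n (E i) (E j) = (if i = 2 \<and> j = 2 then e_vec n n else 0)"
| "SG3_table n (E i) X = (if i = 2 then (of_nat n - 1) \<odot> e_vec n 2 else 0)"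
| "SG3_table n X (E j) = (if j = 2 then (- (of_nat n - 1)) \<odot> e_vec n 2 else 0)"
| "SG3_table n _ _ = 0"

datatype label = SG1 nat | SG2 complex | SG3

primrec label_table :: "nat \<Rightarrow> label \<Rightarrow> gen \<Rightarrow> gen \<Rightarrow> vec" where
  "label_table n (SG1 t) = SG1_table n t"
| "label_table n (SG2 \<gamma>) = SG2_table n \<gamma>"
| "label_table n SG3 = SG3_table n"

definition labels :: "nat \<Rightarrow> label set" where
  "labels n = {SG1 t |t. 4 \<le> t \<and> t \<le> n} \<union> {SG2 \<gamma> |\<gamma>. odd n \<and> \<gamma> \<noteq> 0} \<union> {SG3}"

definition SG :: "nat \<Rightarrow> label \<Rightarrow> vec superalg" where
  "SG n l = table_algebra (insert X (nil_basis n))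
     (\<lambda>g h. base_table n g h + x_table n g h + label_table n l g h)"

end

theory Submission
  imports Defs
begin

text \<open>The nilpotent algebra is little more than a single Jordan block. Write \<open>R\<close> for the right
  multiplication by \<open>y\<^sub>1\<close> and put \<open>c\<^sub>0 = y\<^sub>1\<close>, \<open>c\<^sub>k\<^sub>+\<^sub>1 = R c\<^sub>k\<close>. Up to powers of 2 the vectors
  \<open>c\<^sub>0, c\<^sub>1, c\<^sub>2, c\<^sub>3, c\<^sub>4, \<dots>\<close> are \<open>y\<^sub>1, e\<^sub>1, y\<^sub>2, e\<^sub>3, y\<^sub>3, \<dots>, y\<^sub>n\<^sub>-\<^sub>1, e\<^sub>n\<close>; there are \<open>2n - 2\<close> of them,
  and only \<open>f = e\<^sub>2\<close> lies outside the chain. The Leibniz identity gives everything else: \<open>c\<^sub>1\<close> acts from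
  the right as \<open>2R\<^sup>2\<close>, the later \<open>c\<^sub>k\<close> act as 0, and the action of \<open>f\<close> on the chain commutes with \<open>R\<close>.
  So \<open>N\<close> is described by the two products \<open>[c\<^sub>0, f]\<close>, which lies in the span of \<open>c\<^sub>4, c\<^sub>6, \<dots>\<close>, and
  \<open>[f, f]\<close>, a multiple of the last \<open>c\<^sub>k\<close>. The predicate \<open>chain_basis\<close> records this description. It
  survives adding higher terms to \<open>c\<^sub>0\<close> (\<open>change_chain\<close>) and replacing \<open>f\<close> by a nonzero multiple plus
  a multiple of the last \<open>c\<^sub>k\<close> (\<open>change_f\<close>), and the basis of \<open>N\<close> is normalised by changes of these two kinds.

  An even \<open>x\<close> acts from the right on \<open>N\<close> as a derivation. If \<open>a\<close> is its eigenvalue on \<open>c\<^sub>0\<close> modulo higher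
  terms, then its eigenvalue on \<open>c\<^sub>k\<close> is \<open>(k + 1) a\<close>, and since \<open>[c\<^sub>0, f]\<close> or \<open>[f, f]\<close> is nonzero,
  \<open>a = 0\<close> forces the eigenvalue on \<open>f\<close> to be 0 as well. An element that acts nilpotently on the
  nilradical belongs to it (\<open>nilradical_contains_nilpotently_acting\<close>); this covers \<open>a = 0\<close>, and also all
  odd elements, because the square of their action is half the action of an element of \<open>N\<close>. Hence
  \<open>L\<close> is \<open>N\<close> plus one line, spanned by an even \<open>x\<close> with \<open>a = 1\<close>.

  The eigenvalues \<open>1, 2, \<dots>, 2n - 2\<close> on the chain are distinct, so \<open>c\<^sub>0\<close> and \<open>f\<close> can be made
  eigenvectors, and \<open>x\<close> can be changed so that \<open>[x, x] = 0\<close> (\<open>exists_adapted\<close>). Now \<open>[c\<^sub>0, f]\<close> is an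
  eigenvector inside the chain, that is, a multiple \<open>\<beta> c\<^sub>2\<^sub>j\<close> of a single \<open>c\<^sub>2\<^sub>j\<close>; if \<open>\<beta> \<noteq> 0\<close>, the
  eigenvalue of \<open>f\<close> is \<open>2j\<close>. If \<open>[f, f] \<noteq> 0\<close>, this eigenvalue is \<open>n - 1\<close>. The three possibilities for
  which of the two products vanish are the three families, with \<open>t = j + 2\<close>; when both are nonzero,
  \<open>2j = n - 1\<close>, so that \<open>n\<close> is odd. The left action of \<open>x\<close> is then forced, since the right annihilator
  is small (\<open>left_action_of_x\<close>), and a rescaling of \<open>f\<close> brings the constants into the required form.

  Conversely, an isomorphism between two of the listed algebras sends \<open>y\<^sub>1\<close> to \<open>a y\<^sub>1\<close> plus higher terms,
  hence \<open>e\<^sub>1\<close> to \<open>a\<^sup>2 e\<^sub>1\<close> and \<open>e\<^sub>k\<close> for \<open>k \<ge> 3\<close> to \<open>a\<^sup>2\<^sup>k\<^sup>-\<^sup>2 e\<^sub>k\<close>, each plus higher terms, and \<open>e\<^sub>2\<close> to a combination \<open>b e\<^sub>2 + s e\<^sub>n\<close>. Comparing the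
  leading coefficients of \<open>[e\<^sub>1, e\<^sub>2]\<close> and \<open>[e\<^sub>2, e\<^sub>2]\<close> recovers the family, \<open>t\<close> and \<open>\<gamma>\<close>
  (\<open>SG_isomorphic_parameters\<close>).\<close>

section \<open>Elements acting nilpotently on the nilradical\<close>

lemma bit_cases: "(\<alpha>::bit) = 0 \<or> \<alpha> = 1"
  by (cases \<alpha>) auto

locale leibniz_superalg =
  fixes L :: "'a::ab_group_add superalg"
  assumes leibniz_superalgebra: "leibniz_superalgebra L"
begin

abbreviation scale (infixr "*s" 75) where "scale \<equiv> smult L"
abbreviation mult (infixl "\<cdot>" 70) where "mult \<equiv> bracket L"

lemma superalgebra: "superalgebra L"
  using leibniz_superalgebra by (simp add: leibniz_superalgebra_def)

sublocale vs: vector_space "smult L"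
  using superalgebra by (simp add: superalgebra_def)

lemma subspace_part: "vs.subspace (part L \<alpha>)"
  using superalgebra by (simp add: superalgebra_def)

lemma part_carrier: "u \<in> part L \<alpha> \<Longrightarrow> u \<in> carrier L"
proof -
  assume u: "u \<in> part L \<alpha>"
  have "u = u + 0" "u = 0 + u" by auto
  then show ?thesis
    using u bit_cases[of \<alpha>] vs.subspace_0[OF subspace_part] unfolding carrier_def by blast
qed

lemma carrier_cases:
  assumes "u \<in> carrier L"
  obtains u0 u1 where "u = u0 + u1" "u0 \<in> part L 0" "u1 \<in> part L 1"
  using assms unfolding carrier_def by blast

lemma subspace_carrier: "vs.subspace (carrier L)"
  unfolding carrier_def using vs.subspace_sums[OF subspace_part subspace_part] by simp

lemma carrier_closed [simp]:
  "0 \<in> carrier L"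
  "u \<in> carrier L \<Longrightarrow> v \<in> carrier L \<Longrightarrow> u + v \<in> carrier L"
  "u \<in> carrier L \<Longrightarrow> v \<in> carrier L \<Longrightarrow> u - v \<in> carrier L"
  "u \<in> carrier L \<Longrightarrow> - u \<in> carrier L"
  "u \<in> carrier L \<Longrightarrow> a *s u \<in> carrier L"
  by (rule vs.subspace_0[OF subspace_carrier] vs.subspace_add[OF subspace_carrier]
      vs.subspace_diff[OF subspace_carrier] vs.subspace_neg[OF subspace_carrier]
      vs.subspace_scale[OF subspace_carrier]; assumption)+

lemma mult_part: "u \<in> part L \<alpha> \<Longrightarrow> v \<in> part L \<beta> \<Longrightarrow> u \<cdot> v \<in> part L (\<alpha> + \<beta>)"
  using superalgebra by (simp add: superalgebra_def)

lemma mult_add: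
  assumes "u \<in> carrier L" "v \<in> carrier L" "w \<in> carrier L"
  shows "(u + v) \<cdot> w = u \<cdot> w + v \<cdot> w" "u \<cdot> (v + w) = u \<cdot> v + u \<cdot> w"
  using superalgebra assms by (simp_all add: superalgebra_def)

lemma mult_scale:
  assumes "u \<in> carrier L" "v \<in> carrier L"
  shows "(a *s u) \<cdot> v = a *s (u \<cdot> v)" "u \<cdot> (a *s v) = a *s (u \<cdot> v)"
  using superalgebra assms by (simp_all add: superalgebra_def)

lemma mult_zero:
  assumes "u \<in> carrier L"
  shows "0 \<cdot> u = 0" "u \<cdot> 0 = 0"
  using mult_scale[of 0 u 0] mult_scale[of u 0 0] assms by auto

lemma mult_minus:
  assumes "u \<in> carrier L" "v \<in> carrier L"
  shows "(- u) \<cdot> v = - (u \<cdot> v)" "u \<cdot> (- v) = - (u \<cdot> v)"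
  using mult_scale[OF assms, of "-1"] by simp_all

lemma mult_diff:
  assumes "u \<in> carrier L" "v \<in> carrier L" "w \<in> carrier L"
  shows "(u - v) \<cdot> w = u \<cdot> w - v \<cdot> w" "u \<cdot> (v - w) = u \<cdot> v - u \<cdot> w"
  using mult_add[of u "- v" w] mult_add[of u v "- w"] assms by (simp_all add: mult_minus)

lemmas mult_bilinear = mult_add mult_diff mult_scale mult_minus mult_zero

lemma mult_carrier [simp]:
  assumes "u \<in> carrier L" "v \<in> carrier L"
  shows "u \<cdot> v \<in> carrier L"
proof -
  obtain u0 u1 where u: "u = u0 + u1" "u0 \<in> part L 0" "u1 \<in> part L 1"
    using assms(1) by (rule carrier_cases)
  obtain v0 v1 where v: "v = v0 + v1" "v0 \<in> part L 0" "v1 \<in> part L 1"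
    using assms(2) by (rule carrier_cases)
  have "u \<cdot> v = u0 \<cdot> v0 + u0 \<cdot> v1 + (u1 \<cdot> v0 + u1 \<cdot> v1)"
    using u(2,3) v(2,3) by (simp add: u(1) v(1) mult_add part_carrier)
  then show ?thesis
    using part_carrier[OF mult_part[OF u(2) v(2)]] part_carrier[OF mult_part[OF u(2) v(3)]]
      part_carrier[OF mult_part[OF u(3) v(2)]] part_carrier[OF mult_part[OF u(3) v(3)]] by simp
qed

lemma leibniz_homogeneous:
  assumes "u \<in> carrier L" "v \<in> part L \<alpha>" "w \<in> part L \<beta>"
  shows "u \<cdot> (v \<cdot> w) = u \<cdot> v \<cdot> w - koszul_sign \<alpha> \<beta> *s (u \<cdot> w \<cdot> v)"
  using leibniz_superalgebra assms by (simp add: leibniz_superalgebra_def)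

text \<open>When one of the two last arguments is even, the sign in the Leibniz identity does not depend on the
  degree of the other, which may then be an arbitrary element.\<close>

lemma leibniz_even_right:
  assumes "u \<in> carrier L" "v \<in> carrier L" "w \<in> part L 0"
  shows "u \<cdot> (v \<cdot> w) = u \<cdot> v \<cdot> w - u \<cdot> w \<cdot> v"
proof -
  obtain v0 v1 where v: "v = v0 + v1" "v0 \<in> part L 0" "v1 \<in> part L 1"
    using assms(2) by (rule carrier_cases)
  show ?thesis
    using v assms leibniz_homogeneous[OF assms(1) v(2) assms(3)]
      leibniz_homogeneous[OF assms(1) v(3) assms(3)]
    by (simp add: mult_bilinear part_carrier koszul_sign_def)
qed

lemma leibniz_even_left:
  assumes "u \<in> carrier L" "v \<in> part L 0" "w \<in> carrier L"
  shows "u \<cdot> (v \<cdot> w) = u \<cdot> v \<cdot> w - u \<cdot> w \<cdot> v"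
proof -
  obtain w0 w1 where w: "w = w0 + w1" "w0 \<in> part L 0" "w1 \<in> part L 1"
    using assms(3) by (rule carrier_cases)
  show ?thesis
    using w assms leibniz_homogeneous[OF assms(1,2) w(2)]
      leibniz_homogeneous[OF assms(1,2) w(3)]
    by (simp add: mult_bilinear part_carrier koszul_sign_def)
qed

lemma leibniz_odd:
  assumes "u \<in> carrier L" "v \<in> part L 1" "w \<in> part L 1"
  shows "u \<cdot> (v \<cdot> w) = u \<cdot> v \<cdot> w + u \<cdot> w \<cdot> v"
  using leibniz_homogeneous[OF assms] by (simp add: koszul_sign_def)

lemma mult_in_bracket_span:
  "u \<in> A \<Longrightarrow> v \<in> B \<Longrightarrow> u \<cdot> v \<in> bracket_span L A B"
  unfolding bracket_span_def by (rule vs.span_base) blast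

lemma bracket_span_least:
  assumes "vs.subspace W" "\<And>u v. u \<in> A \<Longrightarrow> v \<in> B \<Longrightarrow> u \<cdot> v \<in> W"
  shows "bracket_span L A B \<subseteq> W"
  unfolding bracket_span_def using assms by (intro vs.span_minimal) auto

lemma subspace_bracket_span: "vs.subspace (bracket_span L A B)"
  unfolding bracket_span_def by (rule vs.subspace_span)

lemma funpow_mult_right_linear:
  assumes "a \<in> carrier L" "u \<in> carrier L" "v \<in> carrier L"
  shows "((\<lambda>w. w \<cdot> a) ^^ d) u \<in> carrier L"
    and "((\<lambda>w. w \<cdot> a) ^^ d) (u + v) = ((\<lambda>w. w \<cdot> a) ^^ d) u + ((\<lambda>w. w \<cdot> a) ^^ d) v"
    and "((\<lambda>w. w \<cdot> a) ^^ d) (s *s u) = s *s ((\<lambda>w. w \<cdot> a) ^^ d) u"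
proof -
  have *: "((\<lambda>w. w \<cdot> a) ^^ d) u \<in> carrier L" if "u \<in> carrier L" for u d
    using that by (induction d) (simp_all add: assms(1))
  show "((\<lambda>w. w \<cdot> a) ^^ d) u \<in> carrier L" using * assms(2) .
  show "((\<lambda>w. w \<cdot> a) ^^ d) (u + v) = ((\<lambda>w. w \<cdot> a) ^^ d) u + ((\<lambda>w. w \<cdot> a) ^^ d) v"
    by (induction d) (simp_all add: mult_add assms *)
  show "((\<lambda>w. w \<cdot> a) ^^ d) (s *s u) = s *s ((\<lambda>w. w \<cdot> a) ^^ d) u"
    by (induction d) (simp_all add: mult_scale assms *)
qed

lemma subspace_ideal: "ideal L I \<Longrightarrow> vs.subspace I"
  unfolding ideal_def by blast

lemma ideal_mult:
  "ideal L I \<Longrightarrow> u \<in> I \<Longrightarrow> v \<in> carrier L \<Longrightarrow> u \<cdot> v \<in> I"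
  "ideal L I \<Longrightarrow> u \<in> I \<Longrightarrow> v \<in> carrier L \<Longrightarrow> v \<cdot> u \<in> I"
  unfolding ideal_def by blast+

lemma ideal_subset: "ideal L I \<Longrightarrow> I \<subseteq> carrier L"
  unfolding ideal_def carrier_def by blast

lemma carrier_restrict: "ideal L I \<Longrightarrow> carrier (restrict_to L I) = I"
proof -
  assume "ideal L I"
  then have "I = {u + v |u v. u \<in> I \<inter> part L 0 \<and> v \<in> I \<inter> part L 1}"
    unfolding ideal_def by blast
  then show ?thesis
    unfolding carrier_def restrict_to_def by (simp add: Int_commute)
qed

lemma bracket_span_restrict: "bracket_span (restrict_to L I) A B = bracket_span L A B"
  by (simp add: bracket_span_def restrict_to_def)

lemma ideal_cases:
  assumes "ideal L I" "u \<in> I"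
  obtains u0 u1 where "u = u0 + u1" "u0 \<in> I" "u0 \<in> part L 0" "u1 \<in> I" "u1 \<in> part L 1"
  using assms unfolding ideal_def by blast

context
  fixes N
  assumes N: "ideal L N"
begin

text \<open>The lower central series of the ideal \<open>N\<close>, as subsets of \<open>L\<close>.\<close>

definition lower where "lower i = lower_series (restrict_to L N) i"

lemma lower_0: "lower 0 = N"
  by (simp add: lower_def carrier_restrict N)

lemma lower_Suc: "lower (Suc i) = bracket_span L (lower i) N"
  by (simp add: lower_def bracket_span_restrict carrier_restrict N)

lemma subspace_lower: "vs.subspace (lower i)"
  by (cases i) (simp_all add: lower_0 lower_Suc subspace_bracket_span subspace_ideal[OF N])

lemma lower_decreasing: "lower (Suc i) \<subseteq> lower i"
proof (induction i)
  case 0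
  show ?case unfolding lower_Suc lower_0
  proof (rule bracket_span_least[OF subspace_ideal[OF N]])
    fix u v assume "u \<in> N" "v \<in> N"
    then show "u \<cdot> v \<in> N" by (intro ideal_mult(1)[OF N] subsetD[OF ideal_subset[OF N]])
  qed
next
  case (Suc i)
  show ?case
    unfolding lower_Suc[of "Suc i"]
  proof (rule bracket_span_least[OF subspace_lower])
    fix u v assume "u \<in> lower (Suc i)" "v \<in> N"
    then show "u \<cdot> v \<in> lower (Suc i)"
      unfolding lower_Suc[of i] by (intro mult_in_bracket_span) (use Suc in \<open>auto simp: lower_Suc\<close>)
  qed
qed

lemma lower_subset: "lower i \<subseteq> N"
proof (induction i)
  case (Suc i)
  then show ?case using lower_decreasing[of i] by blast
qed (simp add: lower_0)

lemma lower_carrier: "u \<in> lower i \<Longrightarrow> u \<in> carrier L"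
  using lower_subset ideal_subset[OF N] by blast

text \<open>Right multiplication by \<open>a\<close> is a superderivation, so it respects products of elements of \<open>N\<close>, and
  hence every term of the series.\<close>

lemma lower_mult_homogeneous:
  assumes a: "a \<in> part L \<alpha>" and "u \<in> lower i"
  shows "u \<cdot> a \<in> lower i"
  using assms(2)
proof (induction i arbitrary: u)
  case 0
  then show ?case using ideal_mult(1)[OF N] a part_carrier unfolding lower_0 by blast
next
  case (Suc i)
  let ?W = "{u \<in> carrier L. u \<cdot> a \<in> lower (Suc i)}"
  have aC: "a \<in> carrier L" using a by (rule part_carrier)
  have W: "vs.subspace ?W"
    by (rule vs.subspaceI)
      (simp_all add: aC mult_bilinear vs.subspace_0[OF subspace_lower] vs.subspace_add[OF subspace_lower]
        vs.subspace_scale[OF subspace_lower])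
  have hom: "u \<cdot> v \<in> ?W" if u: "u \<in> lower i" and v: "v \<in> N" "v \<in> part L \<beta>" for u v \<beta>
  proof -
    have c: "u \<in> carrier L" "v \<in> carrier L" using u lower_carrier v part_carrier by auto
    have "u \<cdot> (v \<cdot> a) \<in> lower (Suc i)" "u \<cdot> a \<cdot> v \<in> lower (Suc i)"
      using mult_in_bracket_span[OF u ideal_mult(1)[OF N v(1) aC]]
        mult_in_bracket_span[OF Suc.IH[OF u] v(1)] by (simp_all add: lower_Suc)
    then have "u \<cdot> (v \<cdot> a) + koszul_sign \<beta> \<alpha> *s (u \<cdot> a \<cdot> v) \<in> lower (Suc i)"
      by (intro vs.subspace_add[OF subspace_lower] vs.subspace_scale[OF subspace_lower])
    then show ?thesis
      using leibniz_homogeneous[OF c(1) v(2) a] c by simp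
  qed
  have "lower (Suc i) \<subseteq> ?W"
    unfolding lower_Suc[of i]
  proof (rule bracket_span_least)
    show "vs.subspace {u \<in> carrier L. u \<cdot> a \<in> bracket_span L (lower i) N}"
      using W unfolding lower_Suc .
    fix u v assume u: "u \<in> lower i" and v: "v \<in> N"
    obtain v0 v1 where v': "v = v0 + v1" "v0 \<in> N" "v0 \<in> part L 0" "v1 \<in> N" "v1 \<in> part L 1"
      using ideal_cases[OF N v] by blast
    have "u \<cdot> v = u \<cdot> v0 + u \<cdot> v1"
      using v' u lower_carrier part_carrier by (simp add: mult_bilinear)
    then have "u \<cdot> v \<in> ?W"
      using hom[OF u v'(2,3)] hom[OF u v'(4,5)] vs.subspace_add[OF W] by auto
    then show "u \<cdot> v \<in> {u \<in> carrier L. u \<cdot> a \<in> bracket_span L (lower i) N}"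
      unfolding lower_Suc .
  qed
  then show ?case using Suc.prems by blast
qed

end

text \<open>All products lie in \<open>N\<close>, so only the grading needs an argument: \<open>a\<close> is added to the homogeneous part
  of its own degree.\<close>

lemma extension_of_ideal_is_ideal:
  assumes N: "ideal L N" "bracket_span L (carrier L) (carrier L) \<subseteq> N" and a: "a \<in> part L \<alpha>"
  shows "ideal L {v + s *s a |v s. v \<in> N}" (is "ideal L ?M")
proof -
  have subN: "vs.subspace N" using N(1) by (rule subspace_ideal)
  have aC: "a \<in> carrier L" using a by (rule part_carrier)
  have NM: "N \<subseteq> ?M"
  proof
    fix v assume "v \<in> N"
    moreover have "v = v + 0 *s a" by simp
    ultimately show "v \<in> ?M" by blast
  qed
  have "?M = {v + w |v w. v \<in> N \<and> w \<in> vs.span {a}}"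
    by (auto simp: vs.span_singleton)
  then have M: "vs.subspace ?M" using vs.subspace_sums[OF subN vs.subspace_span] by simp
  have MC: "?M \<subseteq> carrier L" using ideal_subset[OF N(1)] aC by auto
  have "\<exists>u v. w = u + v \<and> u \<in> ?M \<inter> part L 0 \<and> v \<in> ?M \<inter> part L 1" if w: "w \<in> ?M" for w
  proof -
    obtain v s where w: "w = v + s *s a" "v \<in> N" using w by blast
    obtain v0 v1 where v: "v = v0 + v1" "v0 \<in> N" "v0 \<in> part L 0" "v1 \<in> N" "v1 \<in> part L 1"
      using ideal_cases[OF N(1) w(2)] by blast
    have *: "v0 \<in> ?M" "v1 \<in> ?M" "v0 + s *s a \<in> ?M" "v1 + s *s a \<in> ?M" using v NM by auto
    show ?thesis
    proof (cases "\<alpha> = 0")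
      case True
      then have "w = (v0 + s *s a) + v1" "v0 + s *s a \<in> part L 0"
        using w v a vs.subspace_add[OF subspace_part] vs.subspace_scale[OF subspace_part] by auto
      then show ?thesis using * v by blast
    next
      case False
      then have "\<alpha> = 1" using bit_cases by blast
      then have "w = v0 + (v1 + s *s a)" "v1 + s *s a \<in> part L 1"
        using w v a vs.subspace_add[OF subspace_part] vs.subspace_scale[OF subspace_part] by auto
      then show ?thesis using * v by blast
    qed
  qed
  moreover have "u + v \<in> ?M" if "u \<in> ?M \<inter> part L 0" "v \<in> ?M \<inter> part L 1" for u v
    using that vs.subspace_add[OF M] by blast
  ultimately have "?M = {u + v |u v. u \<in> ?M \<inter> part L 0 \<and> v \<in> ?M \<inter> part L 1}"
    by blast
  moreover have "u \<cdot> v \<in> ?M \<and> v \<cdot> u \<in> ?M" if "u \<in> ?M" "v \<in> carrier L" for u v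
    using that MC NM N(2) mult_in_bracket_span[of _ "carrier L" _ "carrier L"] by blast
  ultimately show ?thesis unfolding ideal_def using M by blast
qed

text \<open>Engel's argument in the only case needed here. If a product lies in the \<open>i\<close>-th term \<open>K\<^sub>i\<close> of the lower
  series of \<open>N\<close>, each further factor either comes from \<open>N\<close>, which moves the product to \<open>K\<^sub>i\<^sub>+\<^sub>1\<close>, or is \<open>a\<close>,
  which keeps it in \<open>K\<^sub>i\<close>; and \<open>d\<close> consecutive factors \<open>a\<close> give 0. So \<open>d\<close> factors lead from \<open>K\<^sub>i\<close> to
  \<open>K\<^sub>i\<^sub>+\<^sub>1\<close>. The sets \<open>Z j\<close> in the proof interpolate between the two.\<close>

lemma extension_of_ideal_nilpotent:
  assumes N: "ideal L N" "bracket_span L (carrier L) (carrier L) \<subseteq> N"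
    and nilp: "nilpotent (restrict_to L N)" and a: "a \<in> part L \<alpha>"
    and d: "\<And>v. v \<in> N \<Longrightarrow> ((\<lambda>w. w \<cdot> a) ^^ d) v = 0"
  shows "nilpotent (restrict_to L {v + s *s a |v s. v \<in> N})" (is "nilpotent (restrict_to L ?M)")
proof -
  have aC: "a \<in> carrier L" using a by (rule part_carrier)
  have M: "ideal L ?M" using extension_of_ideal_is_ideal[OF N a] .
  have MC: "?M \<subseteq> carrier L" using ideal_subset[OF M] .
  let ?K = "lower N" and ?P = "lower ?M"
  note subK = subspace_lower[OF N(1)]
  have step: "\<exists>k'. ?P k' \<subseteq> ?K (Suc i)" if k: "?P k \<subseteq> ?K i" for i k
  proof -
    define R where "R = (\<lambda>w. w \<cdot> a)"
    define Z where "Z j = {p + q |p q. p \<in> ?K (Suc i) \<and> q \<in> (R ^^ j) ` ?K i}" for j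
    note lin = funpow_mult_right_linear[OF aC, folded R_def]
    have KC: "u \<in> carrier L" if "u \<in> ?K i'" for u i' using lower_carrier[OF N(1) that] .
    have RK: "(R ^^ j) q \<in> ?K i" if "q \<in> ?K i" for j q
      using that by (induction j) (auto simp: R_def lower_mult_homogeneous[OF N(1) a])
    have subR: "vs.subspace ((R ^^ j) ` ?K i)" for j
    proof (rule vs.subspaceI)
      show "0 \<in> (R ^^ j) ` ?K i"
        using lin(3)[of 0 0 j 0] vs.subspace_0[OF subK, of i] by (auto intro!: image_eqI[of _ _ 0])
    next
      fix x y assume "x \<in> (R ^^ j) ` ?K i" "y \<in> (R ^^ j) ` ?K i"
      then obtain u v where uv: "u \<in> ?K i" "v \<in> ?K i" "x = (R ^^ j) u" "y = (R ^^ j) v" by blast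
      then have "x + y = (R ^^ j) (u + v)" using lin(2) KC by metis
      then show "x + y \<in> (R ^^ j) ` ?K i" using vs.subspace_add[OF subK uv(1,2)] by blast
    next
      fix s x assume "x \<in> (R ^^ j) ` ?K i"
      then obtain u where u: "u \<in> ?K i" "x = (R ^^ j) u" by blast
      then have "s *s x = (R ^^ j) (s *s u)" using lin(3) KC by metis
      then show "s *s x \<in> (R ^^ j) ` ?K i" using vs.subspace_scale[OF subK u(1)] by blast
    qed
    have subZ: "vs.subspace (Z j)" for j
      unfolding Z_def by (rule vs.subspace_sums[OF subK subR])
    have "?P (k + j) \<subseteq> Z j" for j
    proof (induction j)
      case 0
      have "u \<in> Z 0" if "u \<in> ?K i" for u
      proof -
        have "u = 0 + (R ^^ 0) u" by simp
        then show ?thesis unfolding Z_def using that vs.subspace_0[OF subK, of "Suc i"] by blast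
      qed
      then show ?case using k by (simp add: subset_iff)
    next
      case (Suc j)
      have "u \<cdot> w \<in> Z (Suc j)" if u: "u \<in> Z j" and w: "w \<in> ?M" for u w
      proof -
        obtain p q where u': "u = p + (R ^^ j) q" "p \<in> ?K (Suc i)" "q \<in> ?K i"
          using u unfolding Z_def by blast
        obtain v s where w': "w = v + s *s a" "v \<in> N" using w by blast
        have C: "p \<in> carrier L" "(R ^^ j) q \<in> carrier L" "v \<in> carrier L"
          using KC u' RK ideal_subset[OF N(1)] w' by auto
        have "u \<cdot> w = (p \<cdot> v + s *s (p \<cdot> a) + (R ^^ j) q \<cdot> v) + s *s R ((R ^^ j) q)"
          using C aC by (simp add: u' w' mult_bilinear R_def algebra_simps)
        also have "s *s R ((R ^^ j) q) = (R ^^ Suc j) (s *s q)"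
          using lin(3) KC[OF u'(3)] by (metis comp_apply funpow.simps(2))
        finally have eq: "u \<cdot> w = (p \<cdot> v + s *s (p \<cdot> a) + (R ^^ j) q \<cdot> v) + (R ^^ Suc j) (s *s q)" .
        have "p \<cdot> v \<in> ?K (Suc i)" "(R ^^ j) q \<cdot> v \<in> ?K (Suc i)"
          using mult_in_bracket_span[OF _ w'(2)] subsetD[OF lower_decreasing[OF N(1)] u'(2)]
            RK[OF u'(3)] by (simp_all add: lower_Suc[OF N(1), of i])
        moreover have "s *s (p \<cdot> a) \<in> ?K (Suc i)"
          by (intro vs.subspace_scale[OF subK] lower_mult_homogeneous[OF N(1) a u'(2)])
        ultimately have "p \<cdot> v + s *s (p \<cdot> a) + (R ^^ j) q \<cdot> v \<in> ?K (Suc i)"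
          by (intro vs.subspace_add[OF subK])
        moreover have "s *s q \<in> ?K i" using vs.subspace_scale[OF subK u'(3)] .
        ultimately show ?thesis unfolding eq Z_def by blast
      qed
      then have "bracket_span L (?P (k + j)) ?M \<subseteq> Z (Suc j)"
        using Suc by (intro bracket_span_least[OF subZ]) (meson subsetD)
      then show ?case using lower_Suc[OF M, of "k + j"] by simp
    qed
    moreover have "Z d \<subseteq> ?K (Suc i)"
    proof
      fix u assume "u \<in> Z d"
      then obtain p q where "u = p + (R ^^ d) q" "p \<in> ?K (Suc i)" "q \<in> ?K i"
        unfolding Z_def by blast
      moreover from this have "(R ^^ d) q = 0"
        unfolding R_def by (intro d subsetD[OF lower_subset[OF N(1)]])
      ultimately show "u \<in> ?K (Suc i)" by simp
    qed
    ultimately show ?thesis by blast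
  qed
  have "\<exists>k. ?P k \<subseteq> ?K i" for i
  proof (induction i)
    case 0
    have "?P (Suc 0) \<subseteq> N"
      unfolding lower_Suc[OF M] lower_0[OF M]
    proof (rule bracket_span_least)
      show "vs.subspace N" using N(1) by (rule subspace_ideal)
      fix u v assume uv: "u \<in> ?M" "v \<in> ?M"
      show "u \<cdot> v \<in> N"
        by (rule subsetD[OF N(2) mult_in_bracket_span[OF subsetD[OF MC uv(1)] subsetD[OF MC uv(2)]]])
    qed
    then show ?case unfolding lower_0[OF N(1)] by (rule exI)
  next
    case (Suc i)
    then show ?case using step by (elim exE)
  qed
  moreover obtain m where "?K m = {0}"
    using nilp unfolding nilpotent_def lower_def[OF N(1)] by (elim exE)
  ultimately obtain k where "?P k \<subseteq> {0}" by (metis (lifting))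
  moreover have "{0} \<subseteq> ?P k" using vs.subspace_0[OF subspace_lower[OF M], of k] by blast
  ultimately have "?P k = {0}" by (rule subset_antisym)
  then show ?thesis unfolding nilpotent_def lower_def[OF M] by (rule exI)
qed

lemma nilradicalD:
  assumes "is_nilradical L N"
  shows "ideal L N" "nilpotent (restrict_to L N)" "bracket_span L (carrier L) (carrier L) \<subseteq> N"
proof -
  have N: "nilpotent_ideal_above_derived L N"
    using assms unfolding is_nilradical_def by (rule conjunct1)
  show "ideal L N"
    using N unfolding nilpotent_ideal_above_derived_def by (rule conjunct1)
  show "nilpotent (restrict_to L N)"
    using N unfolding nilpotent_ideal_above_derived_def by (rule conjunct1[OF conjunct2])
  show "bracket_span L (carrier L) (carrier L) \<subseteq> N"
    using N unfolding nilpotent_ideal_above_derived_def by (rule conjunct2[OF conjunct2])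
qed

text \<open>Otherwise adding \<open>a\<close> would give a larger nilpotent ideal.\<close>

lemma nilradical_contains_nilpotently_acting:
  assumes N: "is_nilradical L N" and a: "a \<in> part L \<alpha>"
    and d: "\<And>v. v \<in> N \<Longrightarrow> ((\<lambda>w. w \<cdot> a) ^^ d) v = 0"
  shows "a \<in> N"
proof -
  have N': "ideal L N" "nilpotent (restrict_to L N)" "bracket_span L (carrier L) (carrier L) \<subseteq> N"
    by (fact nilradicalD[OF N])+
  define M where "M = {v + s *s a |v s. v \<in> N}"
  have NM: "N \<subseteq> M"
  proof
    fix v assume "v \<in> N"
    moreover have "v = v + 0 *s a" by simp
    ultimately show "v \<in> M" unfolding M_def by blast
  qed
  have "nilpotent_ideal_above_derived L M"
    unfolding nilpotent_ideal_above_derived_def M_def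
    using extension_of_ideal_is_ideal[OF N'(1,3) a] extension_of_ideal_nilpotent[OF N'(1,3,2) a d]
      subset_trans[OF N'(3) NM, unfolded M_def] by (intro conjI)
  then have "M = N" using N NM unfolding is_nilradical_def by (elim conjE allE[of _ M]) simp
  moreover have "0 + 1 *s a \<in> M"
    unfolding M_def using vs.subspace_0[OF subspace_ideal[OF N'(1)]] by blast
  ultimately show ?thesis by simp
qed

lemma mult_right_nilpotent:
  assumes N: "ideal L N" "nilpotent (restrict_to L N)" and b: "b \<in> N"
  shows "\<exists>d. \<forall>v\<in>N. ((\<lambda>w. w \<cdot> b) ^^ d) v = 0"
proof -
  have "((\<lambda>w. w \<cdot> b) ^^ d) v \<in> lower N d" if "v \<in> N" for v d
    using that b
    by (induction d) (simp_all add: lower_0[OF N(1)] lower_Suc[OF N(1)] mult_in_bracket_span)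
  then show ?thesis using N(2) unfolding nilpotent_def lower_def[OF N(1), symmetric] by blast
qed

text \<open>For odd \<open>a\<close> the Leibniz identity says that acting twice by \<open>a\<close> is acting by \<open>[a, a]/2\<close>, which is in
  \<open>N\<close> and therefore acts nilpotently.\<close>

lemma odd_in_nilradical:
  assumes N: "is_nilradical L N"
    and a: "a \<in> part L 1"
  shows "a \<in> N"
proof -
  have N': "ideal L N" "nilpotent (restrict_to L N)" "bracket_span L (carrier L) (carrier L) \<subseteq> N"
    by (fact nilradicalD[OF N])+
  have aC: "a \<in> carrier L" using a by (rule part_carrier)
  define b where "b = (1/2) *s (a \<cdot> a)"
  have aa: "a \<cdot> a \<in> N" using subsetD[OF N'(3) mult_in_bracket_span[OF aC aC]] .
  have b: "b \<in> N" unfolding b_def by (rule vs.subspace_scale[OF subspace_ideal[OF N'(1)] aa])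
  obtain d where d: "\<forall>v\<in>N. ((\<lambda>w. w \<cdot> b) ^^ d) v = 0"
    using mult_right_nilpotent[OF N'(1,2) b] by blast
  have sq: "v \<cdot> a \<cdot> a = v \<cdot> b" if "v \<in> carrier L" for v
  proof -
    have "v \<cdot> b = (1/2) *s (v \<cdot> (a \<cdot> a))"
      unfolding b_def using that aC by (simp add: mult_scale)
    also have "v \<cdot> (a \<cdot> a) = 2 *s (v \<cdot> a \<cdot> a)"
      using leibniz_odd[OF that a a] vs.scale_left_distrib[of 1 1 "v \<cdot> a \<cdot> a"] by simp
    finally show ?thesis by simp
  qed
  have bC: "b \<in> carrier L" using b ideal_subset[OF N'(1)] by blast
  have "((\<lambda>w. w \<cdot> a) ^^ (2 * k)) v = ((\<lambda>w. w \<cdot> b) ^^ k) v" if v: "v \<in> carrier L" for v k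
  proof (induction k)
    case (Suc k)
    show ?case using sq[OF funpow_mult_right_linear(1)[OF bC v v, of k]] Suc by simp
  qed simp
  then have "((\<lambda>w. w \<cdot> a) ^^ (2 * d)) v = 0" if "v \<in> N" for v
    using bspec[OF d that] subsetD[OF ideal_subset[OF N'(1)] that] by simp
  then show ?thesis by (rule nilradical_contains_nilpotently_acting[OF N a])
qed

end

section \<open>Chain description of the nilpotent class\<close>

text \<open>The elements \<open>c\<^sub>k\<close> have alternating degree, so the tails are taken in steps of two: \<open>chain_tail A c k\<close>
  consists of homogeneous elements.\<close>

definition chain_tail :: "'a::ab_group_add superalg \<Rightarrow> (nat \<Rightarrow> 'a) \<Rightarrow> nat \<Rightarrow> 'a set" where
  "chain_tail A c k = module.span (smult A) {c (k + 2 * j) |j. True}"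

text \<open>Linear independence of the \<open>c\<^sub>k\<close> is not part of the description: it follows from the nonvanishing of the
  last one by repeated multiplication with \<open>c\<^sub>0\<close>. The last clause says that the algebra is non-split.\<close>

definition chain_basis :: "'a::ab_group_add superalg \<Rightarrow> nat \<Rightarrow> (nat \<Rightarrow> 'a) \<Rightarrow> 'a \<Rightarrow> bool" where
  "chain_basis A n c f \<longleftrightarrow>
     (\<forall>k. c (Suc k) = bracket A (c k) (c 0)) \<and>
     c (2 * n - 3) \<noteq> 0 \<and> c (2 * n - 2) = 0 \<and>
     part A 1 = chain_tail A c 0 \<and>
     part A 0 = {smult A s f + v |s v. v \<in> chain_tail A c 1} \<and>
     f \<notin> chain_tail A c 1 \<and>
     bracket A f (c 0) = 0 \<and>
     bracket A (c 0) f \<in> chain_tail A c 4 \<and>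
     (\<exists>\<gamma>. bracket A f f = smult A \<gamma> (c (2 * n - 3))) \<and>
     (bracket A (c 0) f \<noteq> 0 \<or> bracket A f f \<noteq> 0)"

lemma chain_tail_restrict: "chain_tail (restrict_to L N) c k = chain_tail L c k"
  by (simp add: chain_tail_def restrict_to_def)

text \<open>Every change of basis below produces another interpretation of this locale, so that the facts proved
  once are available again for the new basis.\<close>

locale leibniz_chain = leibniz_superalg L
  for L :: "'a::ab_group_add superalg" +
  fixes N :: "'a set" and n :: nat and c :: "nat \<Rightarrow> 'a" and f :: 'a
  assumes n_ge_3: "n \<ge> 3"
    and ideal: "ideal L N"
    and derived: "bracket_span L (carrier L) (carrier L) \<subseteq> N"
    and odd_subset: "part L 1 \<subseteq> N"
    and chain: "chain_basis (restrict_to L N) n c f"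
begin

abbreviation "T \<equiv> chain_tail L c"

lemma T_def: "T k = vs.span {c (k + 2 * j) |j. True}"
  by (simp add: chain_tail_def)

lemma chain_facts:
  "\<forall>k. c (Suc k) = c k \<cdot> c 0"
  "c (2 * n - 3) \<noteq> 0" "c (2 * n - 2) = 0"
  "part L 1 \<inter> N = T 0"
  "part L 0 \<inter> N = {s *s f + v |s v. v \<in> T 1}"
  "f \<notin> T 1" "f \<cdot> c 0 = 0" "c 0 \<cdot> f \<in> T 4" "\<exists>\<gamma>. f \<cdot> f = \<gamma> *s c (2 * n - 3)"
  "c 0 \<cdot> f \<noteq> 0 \<or> f \<cdot> f \<noteq> 0"
  using chain unfolding chain_basis_def chain_tail_restrict
  by (simp_all add: restrict_to_def)

lemmas c_last = chain_facts(2)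
lemmas even_part = chain_facts(5)
lemmas f_not_in_tail = chain_facts(6)
lemmas f_mult_c0 = chain_facts(7)
lemmas c0_mult_f = chain_facts(8)
lemmas f_mult_f = chain_facts(9)
lemmas nonsplit = chain_facts(10)

lemma c_Suc: "c (Suc k) = c k \<cdot> c 0"
  using chain_facts(1) by simp

lemma odd_part: "part L 1 = T 0"
  using chain_facts(4) odd_subset by blast

lemma mult_in_N: "u \<in> carrier L \<Longrightarrow> v \<in> carrier L \<Longrightarrow> u \<cdot> v \<in> N"
  by (rule subsetD[OF derived mult_in_bracket_span])

lemma subspace_T: "vs.subspace (T k)"
  unfolding T_def by (rule vs.subspace_span)

lemmas T_zero_mem = vs.subspace_0[OF subspace_T]
lemmas T_add = vs.subspace_add[OF subspace_T]
lemmas T_diff = vs.subspace_diff[OF subspace_T]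
lemmas T_neg = vs.subspace_neg[OF subspace_T]
lemmas T_scale = vs.subspace_scale[OF subspace_T]

lemma c_in_T: "c (k + 2 * j) \<in> T k"
  unfolding T_def by (rule vs.span_base) blast

lemma c_in_T_self: "c k \<in> T k"
  using c_in_T[of k 0] by simp

lemma T_mono: "T (k + 2 * j) \<subseteq> T k"
  unfolding T_def
proof (rule vs.span_mono)
  have "c (k + 2 * j + 2 * i) \<in> {c (k + 2 * j) |j. True}" for i
    by (rule CollectI, rule exI[of _ "j + i"]) (simp add: algebra_simps)
  then show "{c (k + 2 * j + 2 * i) |i. True} \<subseteq> {c (k + 2 * j) |j. True}" by blast
qed

lemma T_mono2: "v \<in> T (k + 2) \<Longrightarrow> v \<in> T k"
  using T_mono[of k 1] by auto

lemma T_le: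
  assumes "v \<in> T k" "k = m + 2 * j"
  shows "v \<in> T m"
  using assms T_mono[of m j] by auto

lemma T_induct [consumes 1, case_names zero step]:
  assumes "v \<in> T k" and "P 0"
    and step: "\<And>s j w. w \<in> T k \<Longrightarrow> P w \<Longrightarrow> P (s *s c (k + 2 * j) + w)"
  shows "P v"
proof -
  have "v \<in> T k \<and> P v"
    using assms(1) unfolding T_def
  proof (induction rule: vs.span_induct_alt)
    case base
    show ?case using assms(2) vs.span_zero by blast
  next
    case (step s x y)
    then obtain j where x: "x = c (k + 2 * j)" by blast
    have y: "y \<in> T k" "P y" using step unfolding T_def by blast+
    have "s *s x + y \<in> T k" unfolding x by (intro T_add T_scale c_in_T y)
    then show ?case using assms(3)[OF y] unfolding x T_def by blast
  qed
  then show ?thesis by blast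
qed

lemma T_cases:
  assumes "v \<in> T k"
  obtains s w where "v = s *s c k + w" "w \<in> T (k + 2)"
proof -
  have "\<exists>s w. v = s *s c k + w \<and> w \<in> T (k + 2)"
    using assms
  proof (induction rule: T_induct)
    case zero
    show ?case by (rule exI[of _ 0], rule exI[of _ 0]) (simp add: T_zero_mem)
  next
    case (step s j w)
    then obtain t u where w: "w = t *s c k + u" "u \<in> T (k + 2)" by blast
    show ?case
    proof (cases j)
      case 0
      then have "s *s c (k + 2 * j) + w = (s + t) *s c k + u"
        using w by (simp add: vs.scale_left_distrib add.assoc)
      then show ?thesis using w by blast
    next
      case (Suc i)
      have "s *s c (k + 2 * j) + w = t *s c k + (s *s c (k + 2 + 2 * i) + u)"
        using w Suc by (simp add: algebra_simps)
      moreover have "s *s c (k + 2 + 2 * i) + u \<in> T (k + 2)"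
        by (intro T_add T_scale c_in_T w)
      ultimately show ?thesis by blast
    qed
  qed
  then show ?thesis using that by blast
qed

lemma odd_tail_part: "v \<in> T (2 * j) \<Longrightarrow> v \<in> part L 1"
  using T_mono[of 0 j] odd_part by auto

lemma even_tail_part: "v \<in> T (2 * j + 1) \<Longrightarrow> v \<in> part L 0 \<inter> N"
proof -
  assume "v \<in> T (2 * j + 1)"
  then have "v \<in> T 1" using T_mono[of 1 j] by auto
  moreover have "v = 0 *s f + v" by simp
  ultimately show ?thesis unfolding even_part by blast
qed

lemma f_part: "f \<in> part L 0" and f_N: "f \<in> N"
proof -
  have "f = 1 *s f + 0" by simp
  then have "f \<in> part L 0 \<inter> N" unfolding even_part using T_zero_mem by blast
  then show "f \<in> part L 0" "f \<in> N" by auto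
qed

lemma c_part: "\<exists>\<alpha>. c k \<in> part L \<alpha>"
proof (cases "even k")
  case True
  then obtain j where "k = 2 * j" by blast
  then show ?thesis using odd_tail_part c_in_T_self by blast
next
  case False
  then obtain j where "k = 2 * j + 1" by (rule oddE)
  then show ?thesis using even_tail_part c_in_T_self by blast
qed

lemma c0_part: "c 0 \<in> part L 1"
  using odd_tail_part[of "c 0" 0] c_in_T_self by simp

lemma c1_part: "c 1 \<in> part L 0"
  using even_tail_part[of "c 1" 0] c_in_T_self by simp

lemma c_carrier [simp]: "c k \<in> carrier L"
  using c_part part_carrier by blast

lemma f_carrier [simp]: "f \<in> carrier L"
  using f_part by (rule part_carrier)

lemma T_carrier: "v \<in> T k \<Longrightarrow> v \<in> carrier L"
  by (induction rule: T_induct) simp_all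

lemma T_N: "v \<in> T k \<Longrightarrow> v \<in> N"
proof (cases "even k")
  case True
  assume "v \<in> T k"
  then show ?thesis using True odd_tail_part odd_subset by (auto elim!: evenE)
next
  case False
  assume "v \<in> T k"
  then show ?thesis using False even_tail_part by (auto elim!: oddE)
qed

lemma c_zero: "2 * n - 2 \<le> k \<Longrightarrow> c k = 0"
proof (induction k rule: dec_induct)
  case base
  show ?case using chain_facts(3) .
next
  case (step k)
  then show ?case by (simp add: c_Suc mult_zero)
qed

lemma T_zero: "2 * n - 2 \<le> k \<Longrightarrow> v \<in> T k \<Longrightarrow> v = 0"
  by (rotate_tac, induction rule: T_induct) (simp_all add: c_zero)

lemma mult_c0_T: "v \<in> T k \<Longrightarrow> v \<cdot> c 0 \<in> T (Suc k)"
proof (induction rule: T_induct)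
  case zero
  show ?case by (simp add: mult_zero T_zero_mem)
next
  case (step s j w)
  have "(s *s c (k + 2 * j) + w) \<cdot> c 0 = s *s c (Suc k + 2 * j) + w \<cdot> c 0"
    using T_carrier[OF step(1)] by (simp add: mult_bilinear c_Suc)
  then show ?case using step(2) T_add T_scale c_in_T by metis
qed

text \<open>Multiplying by \<open>c\<^sub>0\<close> until \<open>c\<^sub>k\<close> has become the last element of the chain kills the whole tail
  \<open>T (k + 2)\<close>.\<close>

lemma c_independent:
  assumes "k < 2 * n - 2" "s *s c k \<in> T (k + 2)"
  shows "s = 0"
proof -
  have "k \<le> 2 * n - 3" using assms(1) by simp
  then show ?thesis
    using assms(2)
  proof (induction k rule: inc_induct)
    case base
    then have "s *s c (2 * n - 3) = 0" by (rule T_zero[rotated]) simp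
    then show ?case using c_last by simp
  next
    case (step k)
    have "(s *s c k) \<cdot> c 0 \<in> T (Suc (k + 2))" using step.prems by (rule mult_c0_T)
    then show ?case using step.IH by (simp add: mult_scale c_Suc)
  qed
qed

lemma c_nonzero: "k < 2 * n - 2 \<Longrightarrow> c k \<noteq> 0"
  using c_independent[of k 1] T_zero_mem by auto

lemma mult_c1: "v \<in> carrier L \<Longrightarrow> v \<cdot> c 1 = 2 *s (v \<cdot> c 0 \<cdot> c 0)"
  using leibniz_odd[OF _ c0_part c0_part, of v] vs.scale_left_distrib[of 1 1 "v \<cdot> c 0 \<cdot> c 0"]
  by (simp add: c_Suc)

text \<open>Elements of the form \<open>[u, c\<^sub>0]\<close> with \<open>u\<close> in the right annihilator are again in the right annihilator.
  The induction starts at \<open>c\<^sub>2 = [c\<^sub>1, c\<^sub>0]\<close>, because \<open>c\<^sub>1\<close> acts as twice the square of \<open>c\<^sub>0\<close> and so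
  commutes with \<open>c\<^sub>0\<close>.\<close>

lemma mult_c_ge_2: "v \<in> carrier L \<Longrightarrow> v \<cdot> c (k + 2) = 0"
proof (induction k arbitrary: v)
  case 0
  have "v \<cdot> c 2 = v \<cdot> (c 1 \<cdot> c 0)" by (simp add: numeral_2_eq_2 c_Suc)
  also have "\<dots> = v \<cdot> c 1 \<cdot> c 0 - v \<cdot> c 0 \<cdot> c 1"
    using 0 by (intro leibniz_even_left c1_part) simp_all
  also have "\<dots> = 0" using 0 mult_c1[of v] mult_c1[of "v \<cdot> c 0"] by (simp add: mult_scale)
  finally show ?case by (simp add: numeral_2_eq_2)
next
  case (Suc k)
  obtain \<alpha> where "c (k + 2) \<in> part L \<alpha>" using c_part by blast
  from leibniz_homogeneous[OF Suc.prems this c0_part] show ?case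
    using Suc by (simp add: c_Suc mult_zero)
qed

lemma mult_T_ge_2:
  assumes "v \<in> carrier L" "w \<in> T k" "k \<ge> 2"
  shows "v \<cdot> w = 0"
  using assms(2)
proof (induction rule: T_induct)
  case zero
  show ?case using assms by (simp add: mult_zero)
next
  case (step s j w)
  have "k + 2 * j = (k - 2 + 2 * j) + 2" using assms(3) by linarith
  then have "v \<cdot> c (k + 2 * j) = 0" using mult_c_ge_2[OF assms(1)] by metis
  then show ?case using step assms T_carrier[OF step(1)] by (simp add: mult_bilinear)
qed

lemma f_mult_T: "w \<in> T k \<Longrightarrow> f \<cdot> w = 0"
proof (induction rule: T_induct)
  case zero
  show ?case by (simp add: mult_zero)
next
  case (step s j w)
  consider "k + 2 * j = 0" | "k + 2 * j = 1" | m where "k + 2 * j = m + 2"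
    by (metis One_nat_def Suc_1 add.commute add_Suc_right not0_implies_Suc plus_1_eq_Suc)
  then have "f \<cdot> c (k + 2 * j) = 0"
    by cases (simp_all only: f_mult_c0 mult_c1 mult_c_ge_2 f_carrier, simp add: mult_zero)
  then show ?case using step T_carrier[OF step(1)] by (simp add: mult_bilinear)
qed

text \<open>The actions of \<open>f\<close> and \<open>c\<^sub>0\<close> on the chain commute because \<open>[c\<^sub>0, f]\<close> annihilates from the right.\<close>

lemma c_Suc_mult_f: "c (Suc k) \<cdot> f = c k \<cdot> f \<cdot> c 0"
proof -
  have "c k \<cdot> (c 0 \<cdot> f) = 0" by (rule mult_T_ge_2[OF c_carrier c0_mult_f]) simp
  then show ?thesis
    using leibniz_even_right[OF c_carrier[of k] c_carrier[of 0] f_part] by (simp add: c_Suc)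
qed

lemma c_mult_f: "c 0 \<cdot> f \<in> T m \<Longrightarrow> c k \<cdot> f \<in> T (m + k)"
  by (induction k) (simp_all add: c_Suc_mult_f mult_c0_T)

lemma T_mult_f:
  assumes "c 0 \<cdot> f \<in> T m" "v \<in> T k"
  shows "v \<cdot> f \<in> T (m + k)"
  using assms(2)
proof (induction rule: T_induct)
  case zero
  show ?case by (simp add: mult_zero T_zero_mem)
next
  case (step s j w)
  have "c (k + 2 * j) \<cdot> f \<in> T (m + k)"
    using c_mult_f[OF assms(1), of "k + 2 * j"] by (rule T_le) simp
  then show ?case
    using step T_carrier[OF step(1)] by (simp add: mult_bilinear T_add T_scale)
qed

lemma kernel_c0_tail:
  assumes "w \<in> T 1" "w \<cdot> c 0 = 0"
  shows "\<exists>t. w = t *s c (2 * n - 3)"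
proof -
  have "w \<in> T (1 + 2 * j)" if "j \<le> n - 2" for j
    using that
  proof (induction j)
    case 0
    show ?case using assms by simp
  next
    case (Suc j)
    then obtain s u where w: "w = s *s c (1 + 2 * j) + u" "u \<in> T (1 + 2 * j + 2)"
      by (auto elim: T_cases)
    have "s *s c (2 + 2 * j) = - (u \<cdot> c 0)"
      using assms(2) T_carrier[OF w(2)] by (simp add: w mult_bilinear c_Suc eq_neg_iff_add_eq_0)
    also have "\<dots> \<in> T (2 + 2 * j + 2)" using T_neg[OF mult_c0_T[OF w(2)]] by simp
    finally have "s = 0" using Suc.prems n_ge_3 by (intro c_independent[of "2 + 2 * j"]) simp_all
    then show ?case using w by simp
  qed
  moreover have "1 + 2 * (n - 2) = 2 * n - 3" using n_ge_3 by simp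
  ultimately have "w \<in> T (2 * n - 3)" by (metis order_refl)
  then obtain s u where "w = s *s c (2 * n - 3) + u" "u \<in> T (2 * n - 3 + 2)"
    by (rule T_cases)
  then show ?thesis using T_zero[of "2 * n - 3 + 2" u] by auto
qed

text \<open>This confines the images of \<open>f\<close> under derivations.\<close>

lemma kernel_c0:
  assumes "v \<in> part L 0 \<inter> N" "v \<cdot> c 0 = 0"
  obtains s t where "v = s *s f + t *s c (2 * n - 3)"
proof -
  obtain s w where v: "v = s *s f + w" "w \<in> T 1" using assms(1) unfolding even_part by blast
  then have "w \<cdot> c 0 = 0"
    using assms(2) T_carrier[OF v(2)] by (simp add: mult_bilinear f_mult_c0)
  then show ?thesis using kernel_c0_tail[OF v(2)] v that by blast
qed

section \<open>Derivations of the chain\<close>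

text \<open>A derivation that multiplies \<open>c\<^sub>0\<close> by \<open>a\<close> multiplies a product of \<open>k + 1\<close> factors \<open>c\<^sub>0\<close> by \<open>(k + 1) a\<close>,
  up to higher terms.\<close>

lemma mult_even_c:
  assumes x: "x \<in> part L 0" and a: "c 0 \<cdot> x - a *s c 0 \<in> T 2"
  shows "c k \<cdot> x - (of_nat (Suc k) * a) *s c k \<in> T (k + 2)"
proof (induction k)
  case 0
  then show ?case using a by (simp add: numeral_2_eq_2)
next
  case (Suc k)
  have xC: "x \<in> carrier L" using x by (rule part_carrier)
  define z where "z = c 0 \<cdot> x - a *s c 0"
  have z: "z \<in> T 2" "c 0 \<cdot> x = a *s c 0 + z" using a by (simp_all add: z_def)
  have "c k \<cdot> (c 0 \<cdot> x) = c k \<cdot> c 0 \<cdot> x - c k \<cdot> x \<cdot> c 0"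
    using x by (intro leibniz_even_right) simp_all
  moreover have "c k \<cdot> (c 0 \<cdot> x) = a *s c (Suc k)"
    using z T_carrier[OF z(1)] mult_T_ge_2[OF _ z(1), of "c k"] by (simp add: mult_bilinear c_Suc)
  ultimately have "c (Suc k) \<cdot> x = c k \<cdot> x \<cdot> c 0 + a *s c (Suc k)"
    by (simp add: c_Suc)
  moreover have "of_nat (Suc (Suc k)) * a = of_nat (Suc k) * a + a" by (simp add: algebra_simps)
  ultimately have "c (Suc k) \<cdot> x - (of_nat (Suc (Suc k)) * a) *s c (Suc k)
      = c k \<cdot> x \<cdot> c 0 - (of_nat (Suc k) * a) *s c (Suc k)"
    by (simp only: vs.scale_left_distrib) (simp add: algebra_simps)
  also have "\<dots> = (c k \<cdot> x - (of_nat (Suc k) * a) *s c k) \<cdot> c 0"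
    using xC by (simp add: mult_diff mult_scale c_Suc)
  finally have "c (Suc k) \<cdot> x - (of_nat (Suc (Suc k)) * a) *s c (Suc k)
      = (c k \<cdot> x - (of_nat (Suc k) * a) *s c k) \<cdot> c 0" .
  then show ?case using mult_c0_T[OF Suc] by simp
qed

text \<open>Applying the derivation to \<open>[f, c\<^sub>0] = 0\<close> shows that the image of \<open>f\<close> is killed by \<open>c\<^sub>0\<close>.\<close>

lemma mult_even_f:
  assumes x: "x \<in> part L 0" and a: "c 0 \<cdot> x - a *s c 0 \<in> T 2"
  obtains \<delta> b where "f \<cdot> x = \<delta> *s f + b *s c (2 * n - 3)"
proof -
  have xC: "x \<in> carrier L" using x by (rule part_carrier)
  have "f \<cdot> (c 0 \<cdot> x) = 0" using f_mult_T[of "c 0 \<cdot> x" 0] odd_part mult_part[OF c0_part x] by simp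
  then have "f \<cdot> x \<cdot> c 0 = 0"
    using leibniz_even_right[OF f_carrier c_carrier[of 0] x] xC by (simp add: f_mult_c0 mult_zero)
  moreover have "f \<cdot> x \<in> part L 0 \<inter> N"
    using mult_part[OF f_part x] mult_in_N[OF f_carrier xC] by simp
  ultimately show ?thesis using kernel_c0 that by metis
qed

end

context leibniz_chain begin

lemma T_0_cases:
  assumes "v \<in> T 0"
  obtains s w where "v = s *s c 0 + w" "w \<in> T 2"
  using T_cases[OF assms] by (metis add_0)

lemma c_last_in_T1: "c (2 * n - 3) \<in> T 1"
proof -
  have "2 * n - 3 = 1 + 2 * (n - 2)" using n_ge_3 by simp
  then show ?thesis using c_in_T by metis
qed

lemma mult_c_last: "v \<in> carrier L \<Longrightarrow> v \<cdot> c (2 * n - 3) = 0"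
  using n_ge_3 by (intro mult_T_ge_2[OF _ c_in_T_self]) simp_all

lemma c_last_mult_c0: "c (2 * n - 3) \<cdot> c 0 = 0"
  using c_zero[of "Suc (2 * n - 3)"] by (simp add: c_Suc)

lemma c_last_mult_f: "c (2 * n - 3) \<cdot> f = 0"
  using c_mult_f[OF c0_mult_f, of "2 * n - 3"] by (intro T_zero[of "4 + (2 * n - 3)"]) simp_all

lemma f_mult_f_nonzero:
  assumes "c 0 \<cdot> f = 0"
  obtains \<gamma> where "f \<cdot> f = \<gamma> *s c (2 * n - 3)" "\<gamma> \<noteq> 0"
  using nonsplit assms f_mult_f by (metis vs.scale_zero_left)

lemma leading_term:
  assumes "v \<in> T k" "v \<noteq> 0"
  obtains j s u where "v = s *s c (k + 2 * j) + u" "s \<noteq> 0" "u \<in> T (k + 2 * j + 2)"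
    "k + 2 * j < 2 * n - 2"
proof -
  have "\<exists>j s u. v = s *s c (k + 2 * j) + u \<and> s \<noteq> 0 \<and> u \<in> T (k + 2 * j + 2) \<and> k + 2 * j < 2 * n - 2"
    using assms(1)
  proof (induction "2 * n - 2 - k" arbitrary: k rule: less_induct)
    case less
    have k: "k < 2 * n - 2" using T_zero[OF _ less.prems] assms(2) by (meson not_le)
    obtain s u where v: "v = s *s c k + u" "u \<in> T (k + 2)"
      using less.prems by (rule T_cases)
    show ?case
    proof (cases "s = 0")
      case True
      then have "v \<in> T (k + 2)" using v by simp
      moreover have "2 * n - 2 - (k + 2) < 2 * n - 2 - k" using k by simp
      ultimately obtain j s u where "v = s *s c (k + 2 + 2 * j) + u \<and> s \<noteq> 0
          \<and> u \<in> T (k + 2 + 2 * j + 2) \<and> k + 2 + 2 * j < 2 * n - 2"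
        using less.hyps by blast
      moreover have "k + 2 + 2 * j = k + 2 * Suc j" by simp
      ultimately show ?thesis by metis
    next
      case False
      have "k + 2 * 0 = k" by simp
      then show ?thesis using False v k by metis
    qed
  qed
  then show ?thesis using that by blast
qed

lemma N_cases:
  assumes "v \<in> N"
  obtains p q s where "v = p + q + s *s f" "p \<in> T 0" "q \<in> T 1"
proof -
  obtain v0 v1 where v: "v = v0 + v1" "v0 \<in> N" "v0 \<in> part L 0" "v1 \<in> N" "v1 \<in> part L 1"
    using ideal_cases[OF ideal assms] by blast
  have "v0 \<in> part L 0 \<inter> N" using v by simp
  then obtain s q where "v0 = s *s f + q" "q \<in> T 1" unfolding even_part by blast
  moreover have "v1 \<in> T 0" using v odd_part by simp
  ultimately show ?thesis using v that[of v1 q s] by (simp add: algebra_simps)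
qed

lemma T_mult_even:
  assumes x: "x \<in> part L 0" and a: "c 0 \<cdot> x - a *s c 0 \<in> T 2" and v: "v \<in> T k"
  shows "v \<cdot> x \<in> T k"
  using v
proof (induction rule: T_induct)
  case zero
  show ?case using x by (simp add: mult_zero T_zero_mem part_carrier)
next
  case (step s j w)
  let ?m = "k + 2 * j"
  have "c ?m \<cdot> x - (of_nat (Suc ?m) * a) *s c ?m \<in> T (?m + 2)" by (rule mult_even_c[OF x a])
  then have "c ?m \<cdot> x - (of_nat (Suc ?m) * a) *s c ?m \<in> T k" by (rule T_le[of _ _ _ "Suc j"]) simp
  then have "c ?m \<cdot> x - (of_nat (Suc ?m) * a) *s c ?m + (of_nat (Suc ?m) * a) *s c ?m \<in> T k"
    by (intro T_add T_scale c_in_T)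
  then have "c ?m \<cdot> x \<in> T k" by simp
  then show ?case
    using step T_carrier[OF step(1)] x by (simp add: mult_bilinear T_add T_scale part_carrier)
qed

lemma T_mult_even_shift:
  assumes x: "x \<in> part L 0" and a: "c 0 \<cdot> x \<in> T 2" and v: "v \<in> T k"
  shows "v \<cdot> x \<in> T (k + 2)"
  using v
proof (induction rule: T_induct)
  case zero
  show ?case using x by (simp add: mult_zero T_zero_mem part_carrier)
next
  case (step s j w)
  have "c (k + 2 * j) \<cdot> x \<in> T (k + 2 * j + 2)"
    using mult_even_c[OF x, of 0 "k + 2 * j"] a by simp
  then have "c (k + 2 * j) \<cdot> x \<in> T (k + 2)" by (rule T_le[of _ _ _ j]) simp
  then show ?case
    using step T_carrier[OF step(1)] x by (simp add: mult_bilinear T_add T_scale part_carrier)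
qed

text \<open>It enters here that the algebra is non-split. The derivation of the product \<open>[c\<^sub>0, f]\<close> (or \<open>[f, f]\<close>, if
  the former vanishes) compares the eigenvalue \<open>\<delta>\<close> of \<open>f\<close> with eigenvalues on the chain, which are all 0.\<close>

lemma shifting_even_f:
  assumes x: "x \<in> part L 0" and a: "c 0 \<cdot> x \<in> T 2"
  obtains b where "f \<cdot> x = b *s c (2 * n - 3)"
proof -
  have xC: "x \<in> carrier L" using x by (rule part_carrier)
  have a': "c 0 \<cdot> x - 0 *s c 0 \<in> T 2" using a by simp
  obtain \<delta> b where fx: "f \<cdot> x = \<delta> *s f + b *s c (2 * n - 3)"
    by (rule mult_even_f[OF x a'])
  have "\<delta> = 0"
  proof (cases "c 0 \<cdot> f = 0")
    case False
    obtain j s u where lead: "c 0 \<cdot> f = s *s c (4 + 2 * j) + u" "s \<noteq> 0" "u \<in> T (4 + 2 * j + 2)"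
      "4 + 2 * j < 2 * n - 2"
      using leading_term[OF c0_mult_f False] by blast
    define m where "m = 4 + 2 * j"
    have m: "c 0 \<cdot> f = s *s c m + u" "u \<in> T (m + 2)" "m < 2 * n - 2"
      unfolding m_def by (fact lead)+
    have cfm: "c 0 \<cdot> f \<in> T m" 
      unfolding m(1) by (intro T_add T_scale c_in_T_self T_mono2[OF m(2)])
    have "c 0 \<cdot> (f \<cdot> x) = c 0 \<cdot> f \<cdot> x - c 0 \<cdot> x \<cdot> f"
      using x by (intro leibniz_even_right) simp_all
    moreover have "c 0 \<cdot> (f \<cdot> x) = \<delta> *s (c 0 \<cdot> f)"
      by (simp add: fx mult_bilinear mult_c_last)
    moreover have "c 0 \<cdot> f \<cdot> x - c 0 \<cdot> x \<cdot> f \<in> T (m + 2)"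
      by (intro T_diff T_mult_even_shift[OF x a cfm] T_mult_f[OF cfm a])
    ultimately have "\<delta> *s (c 0 \<cdot> f) \<in> T (m + 2)" by simp
    then have "\<delta> *s (c 0 \<cdot> f) - \<delta> *s u \<in> T (m + 2)" by (rule T_diff[OF _ T_scale[OF m(2)]])
    then have "(\<delta> * s) *s c m \<in> T (m + 2)" by (simp add: m(1) vs.scale_right_distrib)
    then have "\<delta> * s = 0" using m(3) c_independent by blast
    then show ?thesis using lead(2) by simp
  next
    case True
    obtain \<gamma> where \<gamma>: "f \<cdot> f = \<gamma> *s c (2 * n - 3)" "\<gamma> \<noteq> 0"
      by (rule f_mult_f_nonzero[OF True])
    have "c (2 * n - 3) \<cdot> x = 0"
      by (rule T_zero[OF _ T_mult_even_shift[OF x a c_in_T_self]]) simp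
    then have "f \<cdot> f \<cdot> x = 0" using xC by (simp add: \<gamma> mult_bilinear)
    moreover have "f \<cdot> (f \<cdot> x) = f \<cdot> f \<cdot> x - f \<cdot> x \<cdot> f"
      using x by (intro leibniz_even_right) simp_all
    moreover have "f \<cdot> (f \<cdot> x) = \<delta> *s (f \<cdot> f)" "f \<cdot> x \<cdot> f = \<delta> *s (f \<cdot> f)"
      by (simp_all add: fx mult_bilinear mult_c_last c_last_mult_f)
    ultimately have "\<delta> *s (f \<cdot> f) + \<delta> *s (f \<cdot> f) = 0"
      by (metis diff_0 eq_neg_iff_add_eq_0)
    then have "(\<delta> + \<delta>) *s (f \<cdot> f) = 0" by (simp only: vs.scale_left_distrib)
    then show ?thesis using \<gamma> c_last by simp
  qed
  then have "f \<cdot> x = b *s c (2 * n - 3)" using fx by simp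
  then show ?thesis by (rule that)
qed

lemma shifting_even_nilpotent:
  assumes x: "x \<in> part L 0" and a: "c 0 \<cdot> x \<in> T 2" and v: "v \<in> N"
  shows "((\<lambda>w. w \<cdot> x) ^^ n) v = 0"
proof -
  have xC: "x \<in> carrier L" using x by (rule part_carrier)
  define R where "R = (\<lambda>w. w \<cdot> x)"
  note lin = funpow_mult_right_linear[OF xC, folded R_def]
  have RT: "(R ^^ j) v \<in> T (k + 2 * j)" if "v \<in> T k" for j k v
    using that
  proof (induction j)
    case (Suc j)
    then show ?case using T_mult_even_shift[OF x a, of "(R ^^ j) v" "k + 2 * j"] by (simp add: R_def)
  qed simp
  have RT0: "(R ^^ n) v = 0" if "v \<in> T k" for k v
    using T_zero[OF _ RT[OF that, of n]] by simp
  obtain p q s where v: "v = p + q + s *s f" "p \<in> T 0" "q \<in> T 1"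
    using v by (rule N_cases)
  obtain b where fx: "f \<cdot> x = b *s c (2 * n - 3)" by (rule shifting_even_f[OF x a])
  have "n = Suc (n - 1)" using n_ge_3 by simp
  then have "(R ^^ n) f = (R ^^ (n - 1)) (R f)" by (metis comp_apply funpow_Suc_right)
  also have "R f \<in> T (2 * n - 3)" unfolding R_def fx by (intro T_scale c_in_T_self)
  then have "(R ^^ (n - 1)) (R f) = 0" using n_ge_3 by (intro T_zero[OF _ RT]) simp_all
  finally have "(R ^^ n) f = 0" .
  then have "(R ^^ n) v = 0"
    using lin(2)[of "p + q" "s *s f"] lin(2)[of p q] lin(3)[of f f] RT0 v T_carrier by simp
  then show ?thesis unfolding R_def .
qed

lemma shifting_even_in_nilradical:
  assumes "is_nilradical L N" "x \<in> part L 0" "c 0 \<cdot> x \<in> T 2"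
  shows "x \<in> N"
  using nilradical_contains_nilpotently_acting[OF assms(1,2)] shifting_even_nilpotent[OF assms(2,3)]
  by blast

text \<open>If every even element shifted the chain, all of \<open>L\<close> would be in the nilradical.\<close>

lemma exists_unit_action:
  assumes N: "is_nilradical L N" and "\<not> nilpotent L"
  obtains x where "x \<in> part L 0" "c 0 \<cdot> x - c 0 \<in> T 2"
proof -
  have "\<exists>x\<in>part L 0. x \<notin> N"
  proof (rule ccontr)
    assume "\<not> (\<exists>x\<in>part L 0. x \<notin> N)"
    then have "part L \<alpha> \<inter> N = part L \<alpha>" for \<alpha>
      using bit_cases[of \<alpha>] odd_subset by blast
    then have "restrict_to L N = L" by (simp add: restrict_to_def)
    then show False using nilradicalD(2)[OF N] assms(2) by simp
  qed
  then obtain y where y: "y \<in> part L 0" "y \<notin> N" by blast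
  have "c 0 \<cdot> y \<in> T 0" using mult_part[OF c0_part y(1)] odd_part by simp
  then obtain s w where sw: "c 0 \<cdot> y = s *s c 0 + w" "w \<in> T 2" by (rule T_0_cases)
  have s: "s \<noteq> 0" using shifting_even_in_nilradical[OF N y(1)] y(2) sw by auto
  show ?thesis
  proof (rule that[of "(1/s) *s y"])
    show "(1/s) *s y \<in> part L 0" by (rule vs.subspace_scale[OF subspace_part y(1)])
    have "c 0 \<cdot> ((1/s) *s y) - c 0 = (1/s) *s w"
      using y s by (simp add: mult_bilinear part_carrier sw vs.scale_right_distrib)
    then show "c 0 \<cdot> ((1/s) *s y) - c 0 \<in> T 2" using T_scale sw(2) by simp
  qed
qed

text \<open>The element subtracted is chosen so that the difference shifts the chain.\<close>

lemma even_decomposition: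
  assumes N: "is_nilradical L N" and x: "x \<in> part L 0" "c 0 \<cdot> x - c 0 \<in> T 2" and v: "v \<in> part L 0"
  obtains s where "v - s *s x \<in> N"
proof -
  have "c 0 \<cdot> v \<in> T 0" using mult_part[OF c0_part v] odd_part by simp
  then obtain s w where sw: "c 0 \<cdot> v = s *s c 0 + w" "w \<in> T 2" by (rule T_0_cases)
  have "c 0 \<cdot> (v - s *s x) = w - s *s (c 0 \<cdot> x - c 0)"
    using x v by (simp add: mult_bilinear part_carrier sw vs.scale_right_diff_distrib)
  then have "c 0 \<cdot> (v - s *s x) \<in> T 2" using x sw(2) by (simp add: T_diff T_scale)
  then have "v - s *s x \<in> N"
    using x v by (intro shifting_even_in_nilradical[OF N])
      (simp_all add: vs.subspace_diff[OF subspace_part] vs.subspace_scale[OF subspace_part])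
  then show ?thesis by (rule that)
qed

lemma unit_action_not_in_N:
  assumes x: "x \<in> part L 0" "c 0 \<cdot> x - c 0 \<in> T 2"
  shows "x \<notin> N"
proof
  assume "x \<in> N"
  then have "x \<in> part L 0 \<inter> N" using x by simp
  then obtain s v where v: "x = s *s f + v" "v \<in> T 1" unfolding even_part by blast
  obtain t u where u: "v = t *s c 1 + u" "u \<in> T (1 + 2)" using v(2) by (rule T_cases)
  have C: "u \<in> carrier L" "v \<in> carrier L" using T_carrier u v by auto
  have "c 0 \<cdot> x = s *s (c 0 \<cdot> f) + t *s 2 *s c 2"
    using mult_T_ge_2[OF c_carrier[of 0] u(2)] C mult_c1[OF c_carrier[of 0]]
    by (simp add: v(1) u(1) mult_bilinear c_Suc[symmetric] numeral_2_eq_2)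
  moreover have "c 0 \<cdot> f \<in> T 2" using c0_mult_f by (rule T_le[of _ _ _ 1]) simp
  ultimately have "c 0 \<cdot> x \<in> T 2" using c_in_T_self by (simp add: T_add T_scale)
  then have "c 0 \<cdot> x - (c 0 \<cdot> x - c 0) \<in> T 2" by (rule T_diff[OF _ x(2)])
  then have "1 *s c 0 \<in> T 2" by simp
  then have "(1::complex) = 0"
    using n_ge_3 by (intro c_independent[of 0]) (simp_all add: numeral_2_eq_2)
  then show False by simp
qed

text \<open>On a tail the action of \<open>x\<close> is triangular with the diagonal entries \<open>k + 2j + 1\<close>, so \<open>x - \<mu>\<close> is
  onto if \<open>\<mu>\<close> is none of them.\<close>

lemma solve_tail:
  assumes x: "x \<in> part L 0" "c 0 \<cdot> x - c 0 \<in> T 2"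
    and \<mu>: "\<And>j. \<mu> \<noteq> of_nat (k + 2 * j + 1)" and w: "w \<in> T k"
  obtains z where "z \<in> T k" "z \<cdot> x - \<mu> *s z = w"
proof -
  have xC: "x \<in> carrier L" using x(1) by (rule part_carrier)
  have "\<exists>z\<in>T k. z \<cdot> x - \<mu> *s z = w"
    using \<mu> w
  proof (induction "2 * n - 2 - k" arbitrary: k w rule: less_induct)
    case less
    show ?case
    proof (cases "2 * n - 2 \<le> k")
      case True
      then have "w = 0" using T_zero less.prems(2) by blast
      then show ?thesis using T_zero_mem xC by (intro bexI[of _ 0]) (simp_all add: mult_zero)
    next
      case False
      obtain s w' where w: "w = s *s c k + w'" "w' \<in> T (k + 2)"
        using less.prems(2) by (rule T_cases)
      define u where "u = c k \<cdot> x - of_nat (Suc k) *s c k"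
      have u: "u \<in> T (k + 2)" "c k \<cdot> x = of_nat (Suc k) *s c k + u"
        using mult_even_c[OF x(1), of 1 k] x(2) by (simp_all add: u_def)
      \<comment> \<open>This coefficient settles the leading term; the rest is solved in the next tail.\<close>
      define t where "t = s / (of_nat (Suc k) - \<mu>)"
      have t: "t * of_nat (Suc k) - \<mu> * t = s"
      proof -
        have "of_nat (Suc k) - \<mu> \<noteq> 0" using less.prems(1)[of 0] by simp
        moreover have "t * of_nat (Suc k) - \<mu> * t = t * (of_nat (Suc k) - \<mu>)"
          by (simp add: algebra_simps)
        ultimately show ?thesis by (simp add: t_def del: of_nat_Suc)
      qed
      have "w' - t *s u \<in> T (k + 2)" by (intro T_diff T_scale w u)
      moreover have "2 * n - 2 - (k + 2) < 2 * n - 2 - k" using False by simp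
      moreover have "\<mu> \<noteq> of_nat (k + 2 + 2 * j + 1)" for j
        using less.prems(1)[of "Suc j"] by simp
      ultimately obtain z where z: "z \<in> T (k + 2)" "z \<cdot> x - \<mu> *s z = w' - t *s u"
        using less.hyps by blast
      have zC: "z \<in> carrier L" using z(1) by (rule T_carrier)
      have "(t *s c k + z) \<cdot> x - \<mu> *s (t *s c k + z)
          = (t * of_nat (Suc k) - \<mu> * t) *s c k + t *s u + (z \<cdot> x - \<mu> *s z)"
        using xC zC
        by (simp add: mult_add mult_scale u(2) vs.scale_right_distrib vs.scale_left_diff_distrib
            del: of_nat_Suc)
      also have "\<dots> = w" by (simp only: t z(2) w(1)) simp
      finally have "(t *s c k + z) \<cdot> x - \<mu> *s (t *s c k + z) = w" .
      moreover have "t *s c k + z \<in> T k" by (intro T_add T_scale c_in_T_self T_mono2[OF z(1)])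
      ultimately show ?thesis by blast
    qed
  qed
  then show ?thesis using that by blast
qed

section \<open>Changes of basis\<close>

text \<open>The summand \<open>z\<close> annihilates from the right, so the new \<open>c\<^sub>0\<close> acts as the old one and the whole chain
  changes by higher terms only: the change of basis is unitriangular and the tails stay the same.\<close>

lemma change_chain:
  assumes z: "z \<in> T 2"
  shows "\<exists>c'. leibniz_chain L N n c' f \<and> c' 0 = c 0 + z"
proof -
  have zC: "z \<in> carrier L" using z by (rule T_carrier)
  define c' where "c' k = ((\<lambda>w. w \<cdot> c 0) ^^ k) (c 0 + z)" for k
  have c'C: "c' k \<in> carrier L" for k
    unfolding c'_def
    by (rule funpow_mult_right_linear(1)[OF c_carrier _ carrier_closed(1)]) (simp add: zC)
  have c'0: "c' 0 = c 0 + z" by (simp add: c'_def)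
  have right: "v \<cdot> c' 0 = v \<cdot> c 0" if "v \<in> carrier L" for v
    using that mult_T_ge_2[OF that z] zC by (simp add: c'0 mult_bilinear)
  have c'Suc: "c' (Suc k) = c' k \<cdot> c 0" for k by (simp add: c'_def)
  have diff: "c' k - c k \<in> T (k + 2)" for k
  proof (induction k)
    case 0
    show ?case using z by (simp add: c'0 numeral_2_eq_2)
  next
    case (Suc k)
    have "c' (Suc k) - c (Suc k) = (c' k - c k) \<cdot> c 0"
      using c'C by (simp add: c'Suc c_Suc mult_diff)
    then show ?case using mult_c0_T[OF Suc] by simp
  qed
  have last: "c' k = c k" if "2 * n - 4 \<le> k" for k
  proof -
    have "c' k - c k = 0" using that by (intro T_zero[OF _ diff]) simp
    then show ?thesis by simp
  qed
  have T': "chain_tail L c' k = vs.span {c' (k + 2 * j) |j. True}" for k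
    by (simp add: chain_tail_def)
  have c'T: "c' (k + 2 * j) \<in> T k" for k j
  proof -
    have "c' (k + 2 * j) - c (k + 2 * j) \<in> T k"
      using diff[of "k + 2 * j"] by (rule T_le[of _ _ _ "Suc j"]) simp
    then have "c' (k + 2 * j) - c (k + 2 * j) + c (k + 2 * j) \<in> T k" by (intro T_add c_in_T)
    then show ?thesis by simp
  qed
  have sub1: "chain_tail L c' k \<subseteq> T k" for k
    unfolding T' using c'T by (intro vs.span_minimal subspace_T) auto
  have T'_sub: "vs.subspace (chain_tail L c' k)" for k unfolding T' by (rule vs.subspace_span)
  have mono': "chain_tail L c' (k + 2) \<subseteq> chain_tail L c' k" for k
    unfolding T'
  proof (rule vs.span_mono)
    have "c' (k + 2 + 2 * i) \<in> {c' (k + 2 * j) |j. True}" for i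
      by (rule CollectI, rule exI[of _ "Suc i"]) simp
    then show "{c' (k + 2 + 2 * i) |i. True} \<subseteq> {c' (k + 2 * j) |j. True}" by blast
  qed
  have sub2: "v \<in> chain_tail L c' k" if "v \<in> T k" for v k
    using that
  proof (induction "2 * n - 2 - k" arbitrary: k v rule: less_induct)
    case less
    show ?case
    proof (cases "2 * n - 2 \<le> k")
      case True
      then have "v = 0" using T_zero less.prems by blast
      then show ?thesis using vs.subspace_0[OF T'_sub] by simp
    next
      case False
      then have IH: "T (k + 2) \<subseteq> chain_tail L c' (k + 2)" using less.hyps[of "k + 2"] by auto
      obtain s w where v: "v = s *s c k + w" "w \<in> T (k + 2)" using less.prems by (rule T_cases)
      have 1: "c' k \<in> chain_tail L c' k"
        unfolding T' by (rule vs.span_base, rule CollectI, rule exI[of _ 0]) simp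
      have 2: "w - s *s (c' k - c k) \<in> chain_tail L c' k"
        using T_diff[OF v(2) T_scale[OF diff]] IH mono' by blast
      have "v = s *s c' k + (w - s *s (c' k - c k))"
        by (simp add: v(1) vs.scale_right_diff_distrib)
      then show ?thesis using 1 2 vs.subspace_add[OF T'_sub] vs.subspace_scale[OF T'_sub] by simp
    qed
  qed
  have tails: "chain_tail L c' k = T k" for k using sub1 sub2 by blast
  have zf: "z \<cdot> f \<in> T (m + 2)" if "c 0 \<cdot> f \<in> T m" for m
    using T_mult_f[OF that z] .
  have c'f: "c' 0 \<cdot> f = c 0 \<cdot> f + z \<cdot> f" using zC by (simp add: c'0 mult_bilinear)
  \<comment> \<open>The correction \<open>z \<cdot> f\<close> lies beyond the leading term of \<open>c 0 \<cdot> f\<close> and cannot cancel it.\<close>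
  have ns: "c 0 \<cdot> f = 0" if c'f0: "c' 0 \<cdot> f = 0"
  proof (rule ccontr)
    assume "c 0 \<cdot> f \<noteq> 0"
    from leading_term[OF c0_mult_f this] obtain j s u
      where lead: "c 0 \<cdot> f = s *s c (4 + 2 * j) + u" "s \<noteq> 0" "u \<in> T (4 + 2 * j + 2)"
        "4 + 2 * j < 2 * n - 2" by blast
    have "c 0 \<cdot> f \<in> T (4 + 2 * j)" 
      unfolding lead(1) by (intro T_add T_scale c_in_T_self T_mono2[OF lead(3)])
    then have "z \<cdot> f \<in> T (4 + 2 * j + 2)" by (rule zf)
    then have "- (z \<cdot> f) - u \<in> T (4 + 2 * j + 2)" by (intro T_diff T_neg lead(3))
    moreover have "- (z \<cdot> f) - u = s *s c (4 + 2 * j)"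
    proof -
      have "- (z \<cdot> f) = s *s c (4 + 2 * j) + u"
        using c'f0 unfolding c'f lead(1) eq_neg_iff_add_eq_0[symmetric] by simp
      then show ?thesis by simp
    qed
    ultimately show False using c_independent lead(2,4) by metis
  qed
  have zf4: "c 0 \<cdot> f + z \<cdot> f \<in> T 4"
    by (intro T_add c0_mult_f T_mono2[OF zf[OF c0_mult_f]])
  have "chain_basis (restrict_to L N) n c' f"
    unfolding chain_basis_def chain_tail_restrict tails
  proof (intro conjI)
    show "\<forall>k. c' (Suc k) = bracket (restrict_to L N) (c' k) (c' 0)"
      using right[OF c'C] by (simp add: restrict_to_def c'Suc)
    show "c' (2 * n - 3) \<noteq> 0" "c' (2 * n - 2) = 0" using last c_last c_zero by auto
    show "part (restrict_to L N) 1 = T 0" using chain_facts(4) by (simp add: restrict_to_def)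
    show "part (restrict_to L N) 0 = {smult (restrict_to L N) s f + v |s v. v \<in> T 1}"
      using even_part by (simp add: restrict_to_def)
    show "f \<notin> T 1" by (rule f_not_in_tail)
    show "bracket (restrict_to L N) f (c' 0) = 0"
      using right f_mult_c0 by (simp add: restrict_to_def)
    show "bracket (restrict_to L N) (c' 0) f \<in> T 4"
      using zf4 c'f by (simp add: restrict_to_def)
    show "\<exists>\<gamma>. bracket (restrict_to L N) f f = smult (restrict_to L N) \<gamma> (c' (2 * n - 3))"
      using f_mult_f last by (simp add: restrict_to_def)
    show "bracket (restrict_to L N) (c' 0) f \<noteq> 0 \<or> bracket (restrict_to L N) f f \<noteq> 0"
      using nonsplit ns by (auto simp: restrict_to_def)
  qed
  then have "leibniz_chain L N n c' f"
    using n_ge_3 ideal derived odd_subset by unfold_locales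
  then show ?thesis using c'0 by blast
qed

text \<open>The last element of the chain annihilates from the right and is itself killed by \<open>c\<^sub>0\<close> and \<open>f\<close>, so
  adding multiples of it to \<open>f\<close> affects none of the products.\<close>

lemma change_f:
  assumes a: "a \<noteq> 0"
  shows "leibniz_chain L N n c (a *s f + b *s c (2 * n - 3))" (is "leibniz_chain L N n c ?f")
proof -
  have fC: "?f \<in> carrier L" by simp
  have right: "v \<cdot> ?f = a *s (v \<cdot> f)" if "v \<in> carrier L" for v
    using that by (simp add: mult_bilinear mult_c_last)
  have bT: "t *s b *s c (2 * n - 3) \<in> T 1" for t by (intro T_scale c_last_in_T1)
  have ff: "?f \<cdot> ?f = (a * a) *s (f \<cdot> f)"
    unfolding right[OF fC] by (simp add: mult_bilinear c_last_mult_f)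
  have even: "{s *s f + v |s v. v \<in> T 1} = {s *s ?f + v |s v. v \<in> T 1}"
  proof (intro set_eqI iffI)
    fix w assume "w \<in> {s *s f + v |s v. v \<in> T 1}"
    then obtain s v where w: "w = s *s f + v" "v \<in> T 1" by blast
    then have "w = (s / a) *s ?f + (v - (s / a) *s b *s c (2 * n - 3))"
      using a by (simp add: vs.scale_right_distrib)
    then show "w \<in> {s *s ?f + v |s v. v \<in> T 1}" using T_diff[OF w(2) bT] by blast
  next
    fix w assume "w \<in> {s *s ?f + v |s v. v \<in> T 1}"
    then obtain s v where w: "w = s *s ?f + v" "v \<in> T 1" by blast
    then have "w = (s * a) *s f + (s *s b *s c (2 * n - 3) + v)"
      by (simp add: vs.scale_right_distrib)
    then show "w \<in> {s *s f + v |s v. v \<in> T 1}" using T_add[OF bT w(2)] by blast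
  qed
  have notin: "?f \<notin> T 1"
  proof
    assume "?f \<in> T 1"
    then have "(1/a) *s (?f - 1 *s b *s c (2 * n - 3)) \<in> T 1" by (intro T_scale T_diff bT)
    then show False using a f_not_in_tail by simp
  qed
  have "chain_basis (restrict_to L N) n c ?f"
    unfolding chain_basis_def chain_tail_restrict
  proof (intro conjI)
    show "\<forall>k. c (Suc k) = bracket (restrict_to L N) (c k) (c 0)"
      by (simp add: restrict_to_def c_Suc)
    show "c (2 * n - 3) \<noteq> 0" "c (2 * n - 2) = 0" using c_last c_zero by auto
    show "part (restrict_to L N) 1 = T 0" using chain_facts(4) by (simp add: restrict_to_def)
    show "part (restrict_to L N) 0 = {smult (restrict_to L N) s ?f + v |s v. v \<in> T 1}"
      using even_part even by (simp add: restrict_to_def)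
    show "?f \<notin> T 1" by (rule notin)
    show "bracket (restrict_to L N) ?f (c 0) = 0"
      by (simp add: restrict_to_def mult_bilinear f_mult_c0 c_last_mult_c0)
    show "bracket (restrict_to L N) (c 0) ?f \<in> T 4"
      using T_scale[OF c0_mult_f] by (simp add: restrict_to_def right)
    have "\<exists>\<gamma>. ?f \<cdot> ?f = \<gamma> *s c (2 * n - 3)" using f_mult_f ff by (metis vs.scale_scale)
    then show "\<exists>\<gamma>. bracket (restrict_to L N) ?f ?f = smult (restrict_to L N) \<gamma> (c (2 * n - 3))"
      by (simp add: restrict_to_def)
    have "c 0 \<cdot> ?f \<noteq> 0 \<or> ?f \<cdot> ?f \<noteq> 0"
      using nonsplit a unfolding ff right[OF c_carrier] by simp
    then show "bracket (restrict_to L N) (c 0) ?f \<noteq> 0 \<or> bracket (restrict_to L N) ?f ?f \<noteq> 0"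
      by (simp add: restrict_to_def)
  qed
  then show ?thesis
    using n_ge_3 ideal derived odd_subset by unfold_locales
qed

end

context leibniz_chain begin

section \<open>Diagonalisation\<close>

lemma eigen_c:
  assumes x: "x \<in> part L 0" and c0: "c 0 \<cdot> x = c 0"
  shows "c k \<cdot> x = of_nat (Suc k) *s c k"
proof (induction k)
  case (Suc k)
  have "c k \<cdot> (c 0 \<cdot> x) = c k \<cdot> c 0 \<cdot> x - c k \<cdot> x \<cdot> c 0"
    using x by (intro leibniz_even_right) simp_all
  then have "c k \<cdot> c 0 \<cdot> x = c k \<cdot> (c 0 \<cdot> x) + c k \<cdot> x \<cdot> c 0" by simp
  then have "c (Suc k) \<cdot> x = c (Suc k) + (of_nat (Suc k) *s c k) \<cdot> c 0"
    by (simp only: c0 Suc c_Suc)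
  also have "\<dots> = 1 *s c (Suc k) + of_nat (Suc k) *s c (Suc k)"
    by (simp add: mult_scale c_Suc del: of_nat_Suc)
  also have "\<dots> = of_nat (Suc (Suc k)) *s c (Suc k)"
    by (simp only: vs.scale_left_distrib[symmetric] of_nat_Suc)
  finally show ?case .
qed (simp add: c0)

text \<open>The eigenvalues on the chain are distinct, so eigenvectors of \<open>x\<close> in a tail are multiples of single
  chain elements. For the proof, the leading term determines \<open>\<mu>\<close>, and the remainder, an eigenvector for the
  same \<open>\<mu>\<close>, would have a leading term with another eigenvalue.\<close>

lemma eigenvector:
  assumes x: "x \<in> part L 0" and c0: "c 0 \<cdot> x = c 0"
    and v: "v \<in> T k" "v \<cdot> x = \<mu> *s v" "v \<noteq> 0"
  obtains j s where "v = s *s c (k + 2 * j)" "s \<noteq> 0" "\<mu> = of_nat (Suc (k + 2 * j))"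
    "k + 2 * j < 2 * n - 2"
proof -
  have xC: "x \<in> carrier L" using x by (rule part_carrier)
  have x1: "c 0 \<cdot> x - 1 *s c 0 \<in> T 2" using c0 T_zero_mem by simp
  have key: "\<exists>j s u. v = s *s c (k + 2 * j) + u \<and> s \<noteq> 0 \<and> u \<in> T (k + 2 * j + 2)
      \<and> k + 2 * j < 2 * n - 2 \<and> \<mu> = of_nat (Suc (k + 2 * j)) \<and> u \<cdot> x = \<mu> *s u"
    if v: "v \<in> T k" "v \<cdot> x = \<mu> *s v" "v \<noteq> 0" for v k
  proof -
    obtain j s u where lead: "v = s *s c (k + 2 * j) + u" "s \<noteq> 0" "u \<in> T (k + 2 * j + 2)"
      "k + 2 * j < 2 * n - 2"
      by (rule leading_term[OF v(1,3)])
    define m where "m = k + 2 * j"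
    have uC: "u \<in> carrier L" using lead(3) by (rule T_carrier)
    have "(s * of_nat (Suc m)) *s c m + u \<cdot> x = (\<mu> * s) *s c m + \<mu> *s u"
      using v(2) xC uC
      by (simp add: lead(1) m_def[symmetric] mult_add mult_scale eigen_c[OF x c0]
          vs.scale_right_distrib del: of_nat_Suc)
    then have eq: "(s * of_nat (Suc m) - \<mu> * s) *s c m = \<mu> *s u - u \<cdot> x"
      by (simp add: vs.scale_left_diff_distrib algebra_simps del: of_nat_Suc)
    have "\<mu> *s u - u \<cdot> x \<in> T (m + 2)"
      unfolding m_def by (intro T_diff[OF T_scale[OF lead(3)]] T_mult_even[OF x x1 lead(3)])
    then have 0: "s * of_nat (Suc m) - \<mu> * s = 0"
      using c_independent[of m] lead(4) eq unfolding m_def by metis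
    then have "\<mu> = of_nat (Suc m)" using lead(2) by (simp add: mult.commute del: of_nat_Suc)
    moreover have "u \<cdot> x = \<mu> *s u" using eq unfolding 0 by simp
    ultimately show ?thesis using lead unfolding m_def by metis
  qed
  obtain j s u where 1: "v = s *s c (k + 2 * j) + u" "s \<noteq> 0" "u \<in> T (k + 2 * j + 2)"
      "k + 2 * j < 2 * n - 2" "\<mu> = of_nat (Suc (k + 2 * j))" "u \<cdot> x = \<mu> *s u"
    using key[OF v] by (elim exE conjE)
  have "u = 0"
  proof (rule ccontr)
    assume "u \<noteq> 0"
    from key[OF 1(3,6) this] obtain i where "\<mu> = of_nat (Suc (k + 2 * j + 2 + 2 * i))"
      by (elim exE conjE)
    then show False using 1(5) by (simp only: of_nat_eq_iff)
  qed
  then show ?thesis using 1 that[of s j] by simp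
qed

text \<open>By the derivation rule \<open>[c\<^sub>0, f]\<close> is an eigenvector with eigenvalue \<open>\<delta> + 1\<close> and \<open>[f, f]\<close> one with
  eigenvalue \<open>2 \<delta>\<close>; the latter is a multiple of the last chain element, whose eigenvalue is \<open>2n - 2\<close>. The
  summand with \<open>b\<close> does not contribute to either product.\<close>

lemma eigenvalue_f:
  assumes x: "x \<in> part L 0" and c0: "c 0 \<cdot> x = c 0"
    and fx: "f \<cdot> x = \<delta> *s f + b *s c (2 * n - 3)"
  shows "c 0 \<cdot> f \<noteq> 0 \<Longrightarrow>
      \<exists>j \<beta>. c 0 \<cdot> f = \<beta> *s c (2 * j) \<and> \<beta> \<noteq> 0 \<and> 2 \<le> j \<and> j < n - 1 \<and> \<delta> = of_nat (2 * j)"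
    and "f \<cdot> f \<noteq> 0 \<Longrightarrow> \<delta> = of_nat (n - 1)"
proof -
  have xC: "x \<in> carrier L" using x by (rule part_carrier)
  assume nz: "c 0 \<cdot> f \<noteq> 0"
  have "c 0 \<cdot> (f \<cdot> x) = c 0 \<cdot> f \<cdot> x - c 0 \<cdot> x \<cdot> f"
    using x by (intro leibniz_even_right) simp_all
  then have "c 0 \<cdot> f \<cdot> x = \<delta> *s (c 0 \<cdot> f) + 1 *s (c 0 \<cdot> f)"
    by (simp add: fx c0 mult_bilinear mult_c_last)
  then have "c 0 \<cdot> f \<cdot> x = (\<delta> + 1) *s (c 0 \<cdot> f)"
    by (simp only: vs.scale_left_distrib)
  from eigenvector[OF x c0 c0_mult_f this nz] obtain j s where
    j: "c 0 \<cdot> f = s *s c (4 + 2 * j)" "s \<noteq> 0" "\<delta> + 1 = of_nat (Suc (4 + 2 * j))"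
      "4 + 2 * j < 2 * n - 2" by blast
  have "4 + 2 * j = 2 * (j + 2)" "j + 2 < n - 1" "2 \<le> j + 2" "\<delta> = of_nat (2 * (j + 2))"
    using j(3,4) by (simp_all add: algebra_simps)
  then show "\<exists>j \<beta>. c 0 \<cdot> f = \<beta> *s c (2 * j) \<and> \<beta> \<noteq> 0 \<and> 2 \<le> j \<and> j < n - 1 \<and> \<delta> = of_nat (2 * j)"
    using j(1,2) by metis
next
  have xC: "x \<in> carrier L" using x by (rule part_carrier)
  assume "f \<cdot> f \<noteq> 0"
  then obtain \<gamma> where \<gamma>: "f \<cdot> f = \<gamma> *s c (2 * n - 3)" "\<gamma> \<noteq> 0"
    using f_mult_f by (metis vs.scale_zero_left)
  have suc: "Suc (2 * n - 3) = 2 * (n - 1)" using n_ge_3 by simp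
  have "f \<cdot> f \<cdot> x = \<gamma> *s of_nat (2 * (n - 1)) *s c (2 * n - 3)"
    using xC by (simp add: \<gamma> mult_scale eigen_c[OF x c0] suc del: of_nat_Suc of_nat_mult)
  then have l: "f \<cdot> f \<cdot> x = of_nat (2 * (n - 1)) *s (f \<cdot> f)" by (simp add: \<gamma> mult.commute)
  have "f \<cdot> (f \<cdot> x) = f \<cdot> f \<cdot> x - f \<cdot> x \<cdot> f"
    using x by (intro leibniz_even_right) simp_all
  moreover have "f \<cdot> (f \<cdot> x) = \<delta> *s (f \<cdot> f)" "f \<cdot> x \<cdot> f = \<delta> *s (f \<cdot> f)"
    by (simp_all add: fx mult_bilinear mult_c_last c_last_mult_f)
  ultimately have "f \<cdot> f \<cdot> x = \<delta> *s (f \<cdot> f) + \<delta> *s (f \<cdot> f)" by (simp add: algebra_simps)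
  then have "f \<cdot> f \<cdot> x = (\<delta> + \<delta>) *s (f \<cdot> f)" by (simp only: vs.scale_left_distrib)
  then have "of_nat (2 * (n - 1)) *s (f \<cdot> f) = (\<delta> + \<delta>) *s (f \<cdot> f)" using l by simp
  then have "of_nat (2 * (n - 1)) = \<delta> + \<delta>" using \<open>f \<cdot> f \<noteq> 0\<close> by simp
  then have "2 * of_nat (n - 1) = 2 * \<delta>" by simp
  then show "\<delta> = of_nat (n - 1)" by simp
qed

lemma diagonal_c:
  assumes x: "x \<in> part L 0" "c 0 \<cdot> x - c 0 \<in> T 2"
  shows "\<exists>c'. leibniz_chain L N n c' f \<and> c' 0 \<cdot> x = c' 0"
proof -
  have xC: "x \<in> carrier L" using x(1) by (rule part_carrier)
  have "(1::complex) \<noteq> of_nat (2 + 2 * j + 1)" for j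
    by (simp only: of_nat_1_eq_iff)
  then obtain z where z: "z \<in> T 2" "z \<cdot> x - 1 *s z = - (c 0 \<cdot> x - c 0)"
    using solve_tail[OF x _ T_neg[OF x(2)], of 1] by blast
  have zC: "z \<in> carrier L" using z(1) by (rule T_carrier)
  from change_chain[OF z(1)] obtain c' where c': "leibniz_chain L N n c' f" "c' 0 = c 0 + z" by blast
  have "c' 0 \<cdot> x = c 0 \<cdot> x + z \<cdot> x" using xC zC by (simp add: c' mult_bilinear)
  also have "z \<cdot> x = z - (c 0 \<cdot> x - c 0)" using z(2) by (simp add: algebra_simps)
  finally have "c' 0 \<cdot> x = c' 0" by (simp add: c')
  then show ?thesis using c'(1) by blast
qed

text \<open>The image of \<open>f\<close> is \<open>\<delta> f\<close> plus a multiple of the last chain element, whose eigenvalue \<open>2n - 2\<close> differs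
  from \<open>\<delta>\<close>: by the lemma above \<open>\<delta>\<close> is at most \<open>2n - 4\<close>.\<close>

lemma diagonal_f:
  assumes x: "x \<in> part L 0" and c0: "c 0 \<cdot> x = c 0"
  shows "\<exists>f' \<delta>. leibniz_chain L N n c f' \<and> f' \<cdot> x = \<delta> *s f'"
proof -
  have xC: "x \<in> carrier L" using x by (rule part_carrier)
  have x1: "c 0 \<cdot> x - 1 *s c 0 \<in> T 2" using c0 T_zero_mem by simp
  obtain \<delta> b where fx: "f \<cdot> x = \<delta> *s f + b *s c (2 * n - 3)"
    by (rule mult_even_f[OF x x1])
  define r :: complex where "r = of_nat (Suc (2 * n - 3))"
  have "\<delta> \<noteq> r"
  proof (cases "c 0 \<cdot> f = 0")
    case True
    then have "\<delta> = of_nat (n - 1)" using eigenvalue_f(2)[OF x c0 fx] nonsplit by blast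
    moreover have "n - 1 \<noteq> Suc (2 * n - 3)" using n_ge_3 by simp
    ultimately show ?thesis unfolding r_def by (simp only: of_nat_eq_iff not_False_eq_True)
  next
    case False
    then obtain j where "\<delta> = of_nat (2 * j)" "j < n - 1" using eigenvalue_f(1)[OF x c0 fx] by blast
    moreover from this have "2 * j \<noteq> Suc (2 * n - 3)" by simp
    ultimately show ?thesis unfolding r_def by (simp only: of_nat_eq_iff not_False_eq_True)
  qed
  \<comment> \<open>The coefficient for which \<open>f + \<kappa> c\<^sub>2\<^sub>n\<^sub>-\<^sub>3\<close> is an eigenvector.\<close>
  define \<kappa> where "\<kappa> = b / (\<delta> - r)"
  have \<kappa>: "b + \<kappa> * r = \<delta> * \<kappa>"
  proof -
    have "b = \<kappa> * (\<delta> - r)" using \<open>\<delta> \<noteq> r\<close> by (simp add: \<kappa>_def)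
    then show ?thesis by (simp add: algebra_simps)
  qed
  let ?f = "1 *s f + \<kappa> *s c (2 * n - 3)"
  have "?f \<cdot> x = f \<cdot> x + (\<kappa> * r) *s c (2 * n - 3)"
    using xC by (simp add: mult_add mult_scale eigen_c[OF x c0] r_def del: of_nat_Suc)
  also have "\<dots> = \<delta> *s f + (b + \<kappa> * r) *s c (2 * n - 3)"
    by (simp add: fx vs.scale_left_distrib)
  also have "\<dots> = \<delta> *s ?f" by (simp add: \<kappa> vs.scale_right_distrib)
  finally have "?f \<cdot> x = \<delta> *s ?f" .
  then show ?thesis using change_f[of 1 \<kappa>] by (metis one_neq_zero)
qed

text \<open>The part of \<open>w\<close> outside \<open>T 3\<close> is a combination of \<open>f\<close> and \<open>c\<^sub>1\<close>. Their actions send \<open>c\<^sub>0\<close> to an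
  element of \<open>T 4\<close> and to \<open>2 c\<^sub>2\<close>, so \<open>c\<^sub>1\<close> cannot occur, and \<open>f\<close> acts nontrivially on \<open>c\<^sub>0\<close> or on
  itself.\<close>

lemma annihilating_even:
  assumes w: "w \<in> part L 0 \<inter> N" "c 0 \<cdot> w = 0" "f \<cdot> w = 0"
  shows "w \<in> T 3"
proof -
  obtain s v where v: "w = s *s f + v" "v \<in> T 1" using w(1) unfolding even_part by blast
  obtain t u where u: "v = t *s c 1 + u" "u \<in> T (1 + 2)" using v(2) by (rule T_cases)
  have C: "u \<in> carrier L" "v \<in> carrier L" using T_carrier u v by auto
  have "s *s (c 0 \<cdot> f) + (t * 2) *s c 2 = 0"
    using w(2) mult_T_ge_2[OF c_carrier[of 0] u(2)] C mult_c1[OF c_carrier[of 0]]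
    by (simp add: v(1) u(1) mult_bilinear c_Suc[symmetric] numeral_2_eq_2)
  then have "(t * 2) *s c 2 = - (s *s (c 0 \<cdot> f))" by (metis neg_eq_iff_add_eq_0)
  then have "(t * 2) *s c 2 \<in> T (2 + 2)" using T_neg[OF T_scale[OF c0_mult_f]] by simp
  then have "t * 2 = 0" using n_ge_3 by (intro c_independent[of 2]) simp_all
  then have t: "t = 0" by simp
  then have 1: "s *s (c 0 \<cdot> f) = 0" using \<open>s *s (c 0 \<cdot> f) + (t * 2) *s c 2 = 0\<close> by simp
  have "s *s (f \<cdot> f) = 0" using w(3) C f_mult_T[OF v(2)] by (simp add: v(1) mult_bilinear)
  then have "s = 0" using 1 nonsplit by auto
  then show ?thesis using t v(1) u by (simp add: numeral_3_eq_3)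
qed

text \<open>Adding \<open>e\<close> from the right annihilator to \<open>x\<close> changes \<open>[x, x]\<close> by \<open>[e, x]\<close>. Since \<open>[x, x]\<close> lies in
  \<open>T 3\<close>, where \<open>x\<close> acts invertibly, a suitable \<open>e\<close> exists.\<close>

lemma normalise_x:
  assumes x: "x \<in> part L 0" and c0: "c 0 \<cdot> x = c 0"
  shows "\<exists>x'. x' \<in> part L 0 \<and> x' \<cdot> x' = 0 \<and> (\<forall>v\<in>carrier L. v \<cdot> x' = v \<cdot> x)"
proof -
  have xC: "x \<in> carrier L" using x by (rule part_carrier)
  have x1: "c 0 \<cdot> x - c 0 \<in> T 2" using c0 T_zero_mem by simp
  have "v \<cdot> (x \<cdot> x) = 0" if "v \<in> carrier L" for v
    using leibniz_even_right[OF that xC x] by simp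
  then have "x \<cdot> x \<in> T 3"
    using mult_part[OF x x] mult_in_N[OF xC xC] by (intro annihilating_even) simp_all
  then have "- (x \<cdot> x) \<in> T 3" by (rule T_neg)
  moreover have "(0::complex) \<noteq> of_nat (3 + 2 * j + 1)" for j
    by (simp only: of_nat_0_eq_iff)
  ultimately obtain e where e: "e \<in> T 3" "e \<cdot> x - 0 *s e = - (x \<cdot> x)"
    using solve_tail[OF x x1, of 0 3] by blast
  have eC: "e \<in> carrier L" using e(1) by (rule T_carrier)
  have right: "v \<cdot> (x + e) = v \<cdot> x" if "v \<in> carrier L" for v
    using that xC eC mult_T_ge_2[OF that e(1)] by (simp add: mult_bilinear)
  have "e \<in> part L 0" using even_tail_part[of e 1] e(1) by (simp add: numeral_3_eq_3)
  then have "x + e \<in> part L 0" by (rule vs.subspace_add[OF subspace_part x])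
  moreover have "(x + e) \<cdot> (x + e) = 0"
    using right[of "x + e"] xC eC e(2) by (simp add: mult_bilinear)
  ultimately show ?thesis using right by blast
qed

text \<open>For all \<open>v\<close> the sum \<open>[x, v] + [v, x]\<close> annihilates from the right. Together with \<open>[x, x] = 0\<close>, which makes the
  left multiplication by \<open>x\<close> preserve eigenvectors of the right one, this leaves one undetermined
  coefficient in \<open>[x, c\<^sub>0]\<close> and one in \<open>[x, f]\<close>; they are found from \<open>[c\<^sub>0, [x, c\<^sub>0]]\<close> and
  \<open>[x, [f, c\<^sub>0]] = 0\<close>.\<close>

lemma left_action_of_x:
  assumes x: "x \<in> part L 0" and c0: "c 0 \<cdot> x = c 0" and fx: "f \<cdot> x = \<delta> *s f"
    and xx: "x \<cdot> x = 0"
  shows "x \<cdot> c 0 = - c 0"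
    and "c 0 \<cdot> f = 0 \<Longrightarrow> x \<cdot> f = - (\<delta> *s f)"
    and "c 0 \<cdot> f = \<beta> *s c (2 * j) \<Longrightarrow> \<beta> \<noteq> 0 \<Longrightarrow> 2 \<le> j \<Longrightarrow> j < n - 1 \<Longrightarrow>
      x \<cdot> f = - (\<delta> *s f) - \<beta> *s c (2 * j - 1)"
proof -
  have xC [simp]: "x \<in> carrier L" using x by (rule part_carrier)
  define u where "u = x \<cdot> c 0"
  have u: "u \<in> T 0" unfolding u_def using mult_part[OF x c0_part] odd_part by simp
  have "c 0 \<cdot> c 0 \<cdot> x = c 0 \<cdot> c 0 + c 0 \<cdot> c 0"
    using leibniz_even_right[OF c_carrier[of 0] c_carrier[of 0] x] by (simp add: c0 algebra_simps)
  then have c0u: "c 0 \<cdot> u = - c 1"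
    using leibniz_even_left[OF c_carrier[of 0] x c_carrier[of 0]] by (simp add: u_def c0 c_Suc)
  then have "u \<noteq> 0" using c_nonzero[of 1] n_ge_3 by (auto simp: mult_zero)
  have "u \<cdot> x = 1 *s u"
    using leibniz_even_right[OF xC c_carrier[of 0] x] by (simp add: u_def c0 xx mult_zero)
  from eigenvector[OF x c0 u this \<open>u \<noteq> 0\<close>] obtain i s where
    i: "u = s *s c (0 + 2 * i)" "(1::complex) = of_nat (Suc (0 + 2 * i))" by blast
  have "of_nat 1 = (of_nat (Suc (0 + 2 * i)) :: complex)" using i(2) by simp
  then have "i = 0" by (simp only: of_nat_eq_iff)
  then have u': "u = s *s c 0" using i(1) by simp
  then have "(s + 1) *s c 1 = 0"
    using c0u by (simp add: mult_scale c_Suc vs.scale_left_distrib)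
  then have "s + 1 = 0" using c_nonzero[of 1] n_ge_3 by simp
  then have "s = - 1" by (simp add: eq_neg_iff_add_eq_0)
  then have u': "u = - c 0" using u' by simp
  then show "x \<cdot> c 0 = - c 0" by (simp add: u_def)
  define w where "w = x \<cdot> f + \<delta> *s f"
  have xf: "x \<cdot> f = w - \<delta> *s f" by (simp add: w_def)
  have wC: "w \<in> carrier L" by (simp add: w_def)
  have wN: "w \<in> part L 0 \<inter> N"
    unfolding w_def
    using mult_part[OF x f_part] mult_in_N[OF xC f_carrier] f_part f_N
    by (simp add: vs.subspace_add[OF subspace_part] vs.subspace_scale[OF subspace_part]
        vs.subspace_add[OF subspace_ideal[OF ideal]] vs.subspace_scale[OF subspace_ideal[OF ideal]])
  have ann: "v \<cdot> w = 0" if "v \<in> carrier L" for v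
  proof -
    have "v \<cdot> (x \<cdot> f) = - (v \<cdot> (f \<cdot> x))"
      using leibniz_even_left[OF that x f_carrier] leibniz_even_right[OF that f_carrier x] by simp
    then show ?thesis using that by (simp add: w_def fx mult_bilinear)
  qed
  have w3: "w \<in> T 3" using wN ann by (intro annihilating_even) simp_all
  have "x \<cdot> f \<cdot> x = x \<cdot> (f \<cdot> x) + x \<cdot> x \<cdot> f"
    using leibniz_even_right[OF xC f_carrier x] by simp
  then have "x \<cdot> f \<cdot> x = \<delta> *s (x \<cdot> f)" by (simp add: fx xx mult_bilinear)
  then have wx: "w \<cdot> x = \<delta> *s w"
    by (simp add: w_def mult_bilinear fx vs.scale_right_distrib)
  have "x \<cdot> f \<cdot> c 0 = x \<cdot> (f \<cdot> c 0) + x \<cdot> c 0 \<cdot> f"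
    using leibniz_even_left[OF xC f_part c_carrier[of 0]] by simp
  then have "x \<cdot> f \<cdot> c 0 = - (c 0 \<cdot> f)"
    using u' by (simp add: u_def f_mult_c0 mult_bilinear)
  then have wc: "w \<cdot> c 0 = - (c 0 \<cdot> f)"
    by (simp add: w_def mult_bilinear f_mult_c0)
  have weigen: "\<exists>i s. w = s *s c (3 + 2 * i) \<and> s \<noteq> 0 \<and> \<delta> = of_nat (Suc (3 + 2 * i))
      \<and> 3 + 2 * i < 2 * n - 2" if "w \<noteq> 0"
    using eigenvector[OF x c0 w3 wx that] by metis
  show "x \<cdot> f = - (\<delta> *s f)" if 0: "c 0 \<cdot> f = 0"
  proof -
    have "w = 0"
    proof (rule ccontr)
      assume "w \<noteq> 0"
      then obtain i s where i: "w = s *s c (3 + 2 * i)" "s \<noteq> 0" "\<delta> = of_nat (Suc (3 + 2 * i))"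
        using weigen by blast
      have "f \<cdot> x = \<delta> *s f + 0 *s c (2 * n - 3)" using fx by simp
      then have "\<delta> = of_nat (n - 1)" using eigenvalue_f(2)[OF x c0] nonsplit 0 by blast
      then have n1: "n - 1 = Suc (3 + 2 * i)" using i(3) by (simp only: of_nat_eq_iff)
      have "w \<cdot> c 0 = s *s c (Suc (3 + 2 * i))"
        unfolding c_Suc by (simp only: i(1) mult_scale(1) c_carrier)
      then have "s *s c (Suc (3 + 2 * i)) = 0" using wc 0 by simp
      moreover have "Suc (3 + 2 * i) < 2 * n - 2" using n1 n_ge_3 by linarith
      ultimately show False using i(2) c_nonzero by simp
    qed
    then show ?thesis using xf by simp
  qed
  show "x \<cdot> f = - (\<delta> *s f) - \<beta> *s c (2 * j - 1)"
    if \<beta>: "c 0 \<cdot> f = \<beta> *s c (2 * j)" "\<beta> \<noteq> 0" and j: "2 \<le> j" "j < n - 1"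
  proof -
    have nz: "\<beta> *s c (2 * j) \<noteq> 0" using \<beta> c_nonzero[of "2 * j"] j by simp
    then have "w \<noteq> 0" using wc \<beta> by (auto simp: mult_zero)
    then obtain i s where i: "w = s *s c (3 + 2 * i)" "s \<noteq> 0" "\<delta> = of_nat (Suc (3 + 2 * i))"
      using weigen by blast
    have "f \<cdot> x = \<delta> *s f + 0 *s c (2 * n - 3)" using fx by simp
    then obtain j' \<beta>' where j': "c 0 \<cdot> f = \<beta>' *s c (2 * j')" "\<delta> = of_nat (2 * j')"
      using eigenvalue_f(1)[OF x c0] nz \<beta> by metis
    have "Suc (3 + 2 * i) = 2 * j'" using i(3) j'(2) by (simp only: of_nat_eq_iff)
    moreover have "w \<cdot> c 0 = s *s c (Suc (3 + 2 * i))"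
      unfolding c_Suc by (simp only: i(1) mult_scale(1) c_carrier)
    ultimately have sc: "s *s c (2 * j') = - (\<beta> *s c (2 * j))"
      using wc \<beta> by simp
    have "j' = j"
    proof (rule ccontr)
      assume "j' \<noteq> j"
      then consider "j < j'" | "j' < j" by linarith
      then show False
      proof cases
        case 1
        then have "2 * j' = (2 * j + 2) + 2 * (j' - j - 1)" by simp
        then have "c (2 * j') \<in> T (2 * j + 2)" using c_in_T by metis
        then have "\<beta> *s c (2 * j) \<in> T (2 * j + 2)" using j'(1) \<beta>(1) T_scale by metis
        moreover have "2 * j < 2 * n - 2" using j by linarith
        ultimately show False using c_independent \<beta>(2) by blast
      next
        case 2
        then have "2 * j = (2 * j' + 2) + 2 * (j - j' - 1)" by simp
        then have "c (2 * j) \<in> T (2 * j' + 2)" using c_in_T by metis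
        then have "s *s c (2 * j') \<in> T (2 * j' + 2)" unfolding sc by (intro T_neg T_scale)
        moreover have "2 * j' < 2 * n - 2" using j 2 by linarith
        ultimately show False using c_independent i(2) by blast
      qed
    qed
    then have "(s + \<beta>) *s c (2 * j) = 0" using sc by (simp add: vs.scale_left_distrib)
    then have "s + \<beta> = 0" using c_nonzero[of "2 * j"] j by simp
    then have "s = - \<beta>" by (simp add: eq_neg_iff_add_eq_0)
    moreover have "3 + 2 * i = 2 * j - 1" using \<open>Suc (3 + 2 * i) = 2 * j'\<close> \<open>j' = j\<close> by simp
    ultimately have "w = - (\<beta> *s c (2 * j - 1))" using i(1) by simp
    then show ?thesis using xf by simp
  qed
qed

definition adapted :: "'a \<Rightarrow> complex \<Rightarrow> bool" where
  "adapted x \<delta> \<longleftrightarrow> x \<in> part L 0 \<and> x \<notin> N \<and> (\<forall>v\<in>part L 0. \<exists>s. v - s *s x \<in> N) \<and>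
     c 0 \<cdot> x = c 0 \<and> f \<cdot> x = \<delta> *s f \<and> x \<cdot> x = 0"

end

lemma (in leibniz_chain) exists_adapted:
  assumes N: "is_nilradical L N" and "\<not> nilpotent L"
  shows "\<exists>c' f' x \<delta>. leibniz_chain L N n c' f' \<and> leibniz_chain.adapted L N c' f' x \<delta>"
proof -
  obtain y where y: "y \<in> part L 0" "c 0 \<cdot> y - c 0 \<in> T 2"
    by (rule exists_unit_action[OF assms])
  from diagonal_c[OF this] obtain c' where c': "leibniz_chain L N n c' f" "c' 0 \<cdot> y = c' 0" by blast
  from leibniz_chain.diagonal_f[OF c'(1) y(1) c'(2)] obtain f' \<delta>
    where f': "leibniz_chain L N n c' f'" "f' \<cdot> y = \<delta> *s f'" by blast
  interpret C: leibniz_chain L N n c' f' by (rule f'(1))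
  from C.normalise_x[OF y(1) c'(2)] obtain x
    where x: "x \<in> part L 0" "x \<cdot> x = 0" "\<forall>v\<in>carrier L. v \<cdot> x = v \<cdot> y" by blast
  have cx: "c' 0 \<cdot> x = c' 0" "f' \<cdot> x = \<delta> *s f'" using x(3) c'(2) f'(2) by simp_all
  have x1: "c' 0 \<cdot> x - c' 0 \<in> C.T 2" using cx C.T_zero_mem by simp
  have "C.adapted x \<delta>"
    unfolding C.adapted_def
    using x cx C.unit_action_not_in_N[OF x(1) x1] C.even_decomposition[OF N x(1) x1] by metis
  then show ?thesis using f'(1) by blast
qed

section \<open>Algebras given by multiplication tables\<close>

lemma isomorphic_sym:
  assumes "isomorphic A B"
    and add: "\<And>u v. u \<in> carrier A \<Longrightarrow> v \<in> carrier A \<Longrightarrow> u + v \<in> carrier A"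
    and scale: "\<And>s u. u \<in> carrier A \<Longrightarrow> smult A s u \<in> carrier A"
    and mult: "\<And>u v. u \<in> carrier A \<Longrightarrow> v \<in> carrier A \<Longrightarrow> bracket A u v \<in> carrier A"
    and part: "\<And>\<alpha>. part A \<alpha> \<subseteq> carrier A"
  shows "isomorphic B A"
proof -
  obtain h where h': "bij_betw h (carrier A) (carrier B)"
    "\<forall>u\<in>carrier A. \<forall>v\<in>carrier A. h (u + v) = h u + h v"
    "\<forall>c. \<forall>u\<in>carrier A. h (smult A c u) = smult B c (h u)"
    "\<forall>\<alpha>. h ` part A \<alpha> = part B \<alpha>"
    "\<forall>u\<in>carrier A. \<forall>v\<in>carrier A. h (bracket A u v) = bracket B (h u) (h v)"
    using assms(1) unfolding isomorphic_def by (elim exE conjE) (rule that)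
  note h = h'(1) bspec[OF bspec[OF h'(2)]] bspec[OF spec[OF h'(3)]] spec[OF h'(4)]
    bspec[OF bspec[OF h'(5)]]
  let ?k = "inv_into (carrier A) h"
  have inj: "inj_on h (carrier A)" and img: "h ` carrier A = carrier B"
    using h(1) by (auto simp: bij_betw_def)
  have k: "?k (h u) = u" if "u \<in> carrier A" for u using inj that by simp
  show ?thesis
    unfolding isomorphic_def
  proof (intro exI[of _ ?k] conjI ballI allI)
    show "bij_betw ?k (carrier B) (carrier A)" by (rule bij_betw_inv_into[OF h(1)])
    show "?k ` part B \<alpha> = part A \<alpha>" for \<alpha>
      unfolding h(4)[symmetric] image_image using k part[of \<alpha>] by (force simp: subset_iff)
  next
    fix u v assume "u \<in> carrier B" "v \<in> carrier B"
    then obtain a b where ab: "a \<in> carrier A" "b \<in> carrier A" "u = h a" "v = h b"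
      unfolding img[symmetric] by blast
    show "?k (u + v) = ?k u + ?k v"
      using k[OF add[OF ab(1,2)]] ab by (simp add: h(2) k)
    show "?k (bracket B u v) = bracket A (?k u) (?k v)"
      using k[OF mult[OF ab(1,2)]] ab by (simp add: h(5) k)
  next
    fix s u assume "u \<in> carrier B"
    then obtain a where a: "a \<in> carrier A" "u = h a" unfolding img[symmetric] by blast
    show "?k (smult B s u) = smult A s (?k u)"
      using k[OF scale[OF a(1), of s]] a by (simp add: h(3) k)
  qed
qed

lemma vscale_apply [simp]: "(s \<odot> v) g = s * v g"
  by (simp add: vscale_def)

lemma vector_space_vscale: "vector_space vscale"
  by unfold_locales (auto simp: vscale_def fun_eq_iff algebra_simps)

interpretation vec: vector_space vscale
  by (rule vector_space_vscale)

lemma table_algebra_simps [simp]: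
  "smult (table_algebra S m) = vscale"
  "part (table_algebra S m) \<alpha> = {v. \<forall>g. v g \<noteq> 0 \<longrightarrow> g \<in> S \<and> gen_degree g = \<alpha>}"
  "bracket (table_algebra S m) u v = (\<Sum>g\<in>S. \<Sum>h\<in>S. (u g * v h) \<odot> m g h)"
  by (simp_all add: table_algebra_def)

lemma carrier_table_algebra: "carrier (table_algebra S m) = {v. \<forall>g. v g \<noteq> 0 \<longrightarrow> g \<in> S}"
proof (intro set_eqI iffI)
  fix v assume v: "v \<in> {v::vec. \<forall>g. v g \<noteq> 0 \<longrightarrow> g \<in> S}"
  define u where "u \<alpha> = (\<lambda>g. if gen_degree g = \<alpha> then v g else 0)" for \<alpha>
  have "v = u 0 + u 1" using bit_cases by (fastforce simp: u_def fun_eq_iff)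
  moreover have "u \<alpha> \<in> part (table_algebra S m) \<alpha>" for \<alpha> using v by (simp add: u_def)
  ultimately show "v \<in> carrier (table_algebra S m)" unfolding carrier_def by blast
next
  fix v assume "v \<in> carrier (table_algebra S m)"
  then obtain p q :: vec where "v = p + q" "\<forall>g. p g \<noteq> 0 \<longrightarrow> g \<in> S" "\<forall>g. q g \<noteq> 0 \<longrightarrow> g \<in> S"
    unfolding carrier_def by auto
  moreover from this(1) have "p g \<noteq> 0 \<or> q g \<noteq> 0" if "v g \<noteq> 0" for g using that by auto
  ultimately show "v \<in> {v. \<forall>g. v g \<noteq> 0 \<longrightarrow> g \<in> S}" by blast
qed

lemma table_algebra_cong:
  assumes "\<And>g h. g \<in> S \<Longrightarrow> h \<in> S \<Longrightarrow> m g h = m' g h"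
  shows "table_algebra S m = table_algebra S m'"
proof -
  have "(\<lambda>u v. \<Sum>g\<in>S. \<Sum>h\<in>S. (u g * v h) \<odot> m g h) = (\<lambda>u v. \<Sum>g\<in>S. \<Sum>h\<in>S. (u g * v h) \<odot> m' g h)"
    by (intro ext sum.cong refl) (simp add: assms)
  then show ?thesis unfolding table_algebra_def by metis
qed

lemma sum_apply: "(\<Sum>g\<in>S. F g) k = (\<Sum>g\<in>S. (F g k :: complex))"
  by (induction S rule: infinite_finite_induct) auto

lemma table_algebra_closed:
  shows "u \<in> carrier (table_algebra S m) \<Longrightarrow> v \<in> carrier (table_algebra S m) \<Longrightarrow> u + v \<in> carrier (table_algebra S m)"
    and "u \<in> carrier (table_algebra S m) \<Longrightarrow> smult (table_algebra S m) s u \<in> carrier (table_algebra S m)"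
    and "part (table_algebra S m) \<alpha> \<subseteq> carrier (table_algebra S m)"
proof -
  have nz: "u g \<noteq> 0 \<or> v g \<noteq> 0" if "(u + v) g \<noteq> 0" for g and u v :: vec using that by auto
  show "u + v \<in> carrier (table_algebra S m)"
    if "u \<in> carrier (table_algebra S m)" "v \<in> carrier (table_algebra S m)"
    using that nz[of u v] unfolding carrier_table_algebra by blast
qed (simp_all add: carrier_table_algebra subset_iff)

lemma table_algebra_mult_closed:
  assumes "\<And>g h. g \<in> S \<Longrightarrow> h \<in> S \<Longrightarrow> m g h \<in> carrier (table_algebra S m)"
  shows "bracket (table_algebra S m) u v \<in> carrier (table_algebra S m)"
  unfolding carrier_table_algebra
proof (intro CollectI allI impI)
  fix k assume "bracket (table_algebra S m) u v k \<noteq> 0"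
  then have "(\<Sum>g\<in>S. \<Sum>h\<in>S. u g * v h * m g h k) \<noteq> 0" by (simp add: sum_apply)
  then obtain g where g: "g \<in> S" "(\<Sum>h\<in>S. u g * v h * m g h k) \<noteq> 0"
    by (rule sum.not_neutral_contains_not_neutral)
  from g(2) obtain h where h: "h \<in> S" "u g * v h * m g h k \<noteq> 0"
    by (rule sum.not_neutral_contains_not_neutral)
  then have "m g h k \<noteq> 0" by simp
  then show "k \<in> S" using assms[OF g(1) h(1)] unfolding carrier_table_algebra by blast
qed

context leibniz_superalg begin

lemma mult_sum_left:
  assumes "\<And>g. g \<in> S \<Longrightarrow> b g \<in> carrier L" "w \<in> carrier L"
  shows "(\<Sum>g\<in>S. a g *s b g) \<in> carrier L \<and> (\<Sum>g\<in>S. a g *s b g) \<cdot> w = (\<Sum>g\<in>S. a g *s (b g \<cdot> w))"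
  using assms by (induction S rule: infinite_finite_induct) (simp_all add: mult_zero mult_add mult_scale)

lemma mult_sum_right:
  assumes "\<And>g. g \<in> S \<Longrightarrow> b g \<in> carrier L" "w \<in> carrier L"
  shows "(\<Sum>g\<in>S. a g *s b g) \<in> carrier L \<and> w \<cdot> (\<Sum>g\<in>S. a g *s b g) = (\<Sum>g\<in>S. a g *s (w \<cdot> b g))"
  using assms by (induction S rule: infinite_finite_induct) (simp_all add: mult_zero mult_add mult_scale)

definition lin_comb :: "gen set \<Rightarrow> (gen \<Rightarrow> 'a) \<Rightarrow> vec \<Rightarrow> 'a" where
  "lin_comb S b v = (\<Sum>g\<in>S. v g *s b g)"

lemma lin_comb_linear:
  "lin_comb S b 0 = 0"
  "lin_comb S b (u + v) = lin_comb S b u + lin_comb S b v"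
  "lin_comb S b (s \<odot> v) = s *s lin_comb S b v"
  "lin_comb S b (- v) = - lin_comb S b v"
  "lin_comb S b (u - v) = lin_comb S b u - lin_comb S b v"
  by (simp_all add: lin_comb_def vs.scale_left_distrib vs.scale_left_diff_distrib sum.distrib
      vs.scale_sum_right sum_negf sum_subtractf)

lemma lin_comb_sum: "lin_comb S b (\<Sum>i\<in>I. F i) = (\<Sum>i\<in>I. lin_comb S b (F i))"
  by (induction I rule: infinite_finite_induct)
    (simp_all only: sum.infinite sum.empty sum.insert lin_comb_linear not_False_eq_True)

lemma lin_comb_unit:
  assumes "finite S" "g \<in> S"
  shows "lin_comb S b (unit_vec g) = b g"
proof -
  have "lin_comb S b (unit_vec g) = (\<Sum>h\<in>S. if h = g then b h else 0)"
    unfolding lin_comb_def unit_vec_def by (intro sum.cong) auto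
  also have "\<dots> = b g" using assms by simp
  finally show ?thesis .
qed

text \<open>An adapted basis gives the isomorphism: a coordinate function is sent to the linear combination it
  describes.\<close>

lemma isomorphic_table_algebra:
  assumes S: "finite S"
    and hom: "\<And>g. g \<in> S \<Longrightarrow> b g \<in> part L (gen_degree g)"
    and indep: "\<And>\<alpha> v. v \<in> part (table_algebra S m) \<alpha> \<Longrightarrow> lin_comb S b v = 0 \<Longrightarrow> v = 0"
    and span: "\<And>\<alpha>. part L \<alpha> \<subseteq> vs.span (b ` {g \<in> S. gen_degree g = \<alpha>})"
    and mult: "\<And>g h. g \<in> S \<Longrightarrow> h \<in> S \<Longrightarrow> b g \<cdot> b h = lin_comb S b (m g h)"
    and closed: "\<And>g h. g \<in> S \<Longrightarrow> h \<in> S \<Longrightarrow> m g h \<in> carrier (table_algebra S m)"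
  shows "isomorphic L (table_algebra S m)"
proof -
  let ?A = "table_algebra S m" and ?F = "lin_comb S b"
  note A = table_algebra_closed[where S = S and m = m] table_algebra_mult_closed[OF closed]
  have bC: "b g \<in> carrier L" if "g \<in> S" for g using part_carrier[OF hom[OF that]] .
  have hom_img: "?F v \<in> part L \<alpha>" if "v \<in> part ?A \<alpha>" for v \<alpha>
    unfolding lin_comb_def
  proof (rule vs.subspace_sum[OF subspace_part])
    fix g assume "g \<in> S"
    show "v g *s b g \<in> part L \<alpha>"
    proof (cases "v g = 0")
      case True
      then show ?thesis using vs.subspace_0[OF subspace_part] by simp
    next
      case False
      then have "gen_degree g = \<alpha>" using that by simp
      then show ?thesis using vs.subspace_scale[OF subspace_part] hom[OF \<open>g \<in> S\<close>] by simp
    qed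
  qed
  have part_img: "?F ` part ?A \<alpha> = part L \<alpha>" for \<alpha>
  proof
    show "?F ` part ?A \<alpha> \<subseteq> part L \<alpha>" using hom_img by blast
    have sub: "vs.subspace (?F ` part ?A \<alpha>)"
    proof (rule vs.subspaceI)
      show "0 \<in> ?F ` part ?A \<alpha>" by (rule image_eqI[of _ _ 0]) (simp_all add: lin_comb_linear)
    next
      fix x y assume "x \<in> ?F ` part ?A \<alpha>" "y \<in> ?F ` part ?A \<alpha>"
      then obtain u v where uv: "u \<in> part ?A \<alpha>" "v \<in> part ?A \<alpha>" "x = ?F u" "y = ?F v" by blast
      have "u + v \<in> part ?A \<alpha>" using uv(1,2) by (auto, (metis add_0)+)
      then show "x + y \<in> ?F ` part ?A \<alpha>" using uv lin_comb_linear(2) by (metis image_eqI)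
    next
      fix s x assume "x \<in> ?F ` part ?A \<alpha>"
      then obtain u where u: "u \<in> part ?A \<alpha>" "x = ?F u" by blast
      have "s \<odot> u \<in> part ?A \<alpha>" using u(1) by simp
      then show "s *s x \<in> ?F ` part ?A \<alpha>" using u(2) lin_comb_linear(3) by (metis image_eqI)
    qed
    have "b g \<in> ?F ` part ?A \<alpha>" if "g \<in> S" "gen_degree g = \<alpha>" for g
      using lin_comb_unit[OF S that(1)] that by (intro image_eqI[of _ _ "unit_vec g"])
        (auto simp: unit_vec_def)
    then have "vs.span (b ` {g \<in> S. gen_degree g = \<alpha>}) \<subseteq> ?F ` part ?A \<alpha>"
      by (intro vs.span_minimal sub) blast
    then show "part L \<alpha> \<subseteq> ?F ` part ?A \<alpha>" using span by blast
  qed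
  have inter: "part L 0 \<inter> part L 1 = {0}" using superalgebra by (simp add: superalgebra_def)
  have dec: "\<exists>v0 v1. v = v0 + v1 \<and> v0 \<in> part ?A 0 \<and> v1 \<in> part ?A 1" if "v \<in> carrier ?A" for v
    using that unfolding carrier_def by blast
  have zero: "v = 0" if v: "v \<in> carrier ?A" "?F v = 0" for v
  proof -
    obtain v0 v1 where d: "v = v0 + v1" "v0 \<in> part ?A 0" "v1 \<in> part ?A 1" using dec[OF v(1)] by blast
    have h: "?F v0 \<in> part L 0" "?F v1 \<in> part L 1" using hom_img d by blast+
    have "?F v0 + ?F v1 = 0" using v(2) by (simp add: d(1) lin_comb_linear)
    then have eq: "?F v0 = - ?F v1" by (simp add: eq_neg_iff_add_eq_0)
    then have "?F v0 \<in> part L 1" using vs.subspace_neg[OF subspace_part h(2)] by simp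
    then have "?F v0 = 0" using h(1) inter by blast
    then show ?thesis using eq indep[OF d(2)] indep[OF d(3)] d(1) by simp
  qed
  have inj: "inj_on ?F (carrier ?A)"
  proof (rule inj_onI)
    fix u v assume uv: "u \<in> carrier ?A" "v \<in> carrier ?A" "?F u = ?F v"
    have "u + (- 1) \<odot> v \<in> carrier ?A" using A(1)[OF uv(1) A(2)[OF uv(2), of "- 1"]] by simp
    moreover have "?F (u + (- 1) \<odot> v) = 0" by (simp only: lin_comb_linear uv(3)) simp
    ultimately have "u + (- 1) \<odot> v = 0" by (rule zero)
    then show "u = v" by (simp add: fun_eq_iff)
  qed
  have img: "?F ` carrier ?A = carrier L"
  proof
    show "?F ` carrier ?A \<subseteq> carrier L"
      unfolding lin_comb_def
      by (rule image_subsetI, rule vs.subspace_sum[OF subspace_carrier]) (simp add: bC)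
    show "carrier L \<subseteq> ?F ` carrier ?A"
    proof
      fix u assume "u \<in> carrier L"
      then obtain u0 u1 where u: "u = u0 + u1" "u0 \<in> part L 0" "u1 \<in> part L 1" by (rule carrier_cases)
      obtain v0 v1 where v: "u0 = ?F v0" "u1 = ?F v1" "v0 \<in> part ?A 0" "v1 \<in> part ?A 1"
        using u part_img by blast
      then have "u = ?F (v0 + v1)" using u by (simp add: lin_comb_linear)
      moreover have "v0 + v1 \<in> carrier ?A"
        using v(3,4) A(3) by (intro A(1)) blast+
      ultimately show "u \<in> ?F ` carrier ?A" by blast
    qed
  qed
  have FC: "?F v \<in> carrier L" for v
    unfolding lin_comb_def by (rule vs.subspace_sum[OF subspace_carrier]) (simp add: bC)
  have bracket: "?F (bracket ?A u v) = ?F u \<cdot> ?F v" for u v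
  proof -
    have "?F u \<cdot> ?F v = (\<Sum>g\<in>S. u g *s (b g \<cdot> ?F v))"
      unfolding lin_comb_def[of S b u]
      by (rule conjunct2[OF mult_sum_left[OF bC FC]])
    also have "\<dots> = (\<Sum>g\<in>S. u g *s (\<Sum>h\<in>S. v h *s (b g \<cdot> b h)))"
      unfolding lin_comb_def[of S b v]
      by (intro sum.cong refl arg_cong2[where f = scale] conjunct2[OF mult_sum_right[OF bC bC]])
    also have "\<dots> = (\<Sum>g\<in>S. \<Sum>h\<in>S. (u g * v h) *s ?F (m g h))"
      by (intro sum.cong refl) (simp add: mult vs.scale_sum_right)
    also have "\<dots> = ?F (bracket ?A u v)"
      by (simp add: lin_comb_sum lin_comb_linear)
    finally show ?thesis by simp
  qed
  have "isomorphic ?A L"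
    unfolding isomorphic_def
    using inj img part_img bracket by (intro exI[of _ ?F]) (simp add: bij_betw_def lin_comb_linear)
  then show ?thesis by (rule isomorphic_sym) (use A in blast)+
qed

end

section \<open>The adapted basis realises the tables\<close>

text \<open>One table for the three families: \<open>\<beta>\<close> is 1 for \<open>SG1\<close> and \<open>SG2\<close>, and 0 for \<open>SG3\<close>;
  \<open>\<delta>\<close> is the eigenvalue of \<open>e\<^sub>2\<close>. The bounds on the indices in the separate tables are
  replaced by the convention that \<open>e_vec\<close> and \<open>y_vec\<close> vanish out of range, which is correct for \<open>t \<ge> 4\<close>.\<close>

fun normal_table :: "nat \<Rightarrow> nat \<Rightarrow> complex \<Rightarrow> complex \<Rightarrow> complex \<Rightarrow> gen \<Rightarrow> gen \<Rightarrow> vec" where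
  "normal_table n t \<beta> \<gamma> \<delta> (E i) (E j) =
     (if j = 2 then
        if i = 1 then \<beta> \<odot> e_vec n t
        else if i = 2 then \<gamma> \<odot> e_vec n n
        else \<beta> \<odot> e_vec n (i + t - 2)
      else 0)"
| "normal_table n t \<beta> \<gamma> \<delta> (Y i) (E j) = (if j = 2 then \<beta> \<odot> y_vec n (i + t - 2) else 0)"
| "normal_table n t \<beta> \<gamma> \<delta> (E i) X = (if i = 2 then \<delta> \<odot> e_vec n 2 else 0)"
| "normal_table n t \<beta> \<gamma> \<delta> X (E j) =
     (if j = 2 then (- \<delta>) \<odot> e_vec n 2 + (- 2 * \<beta>) \<odot> e_vec n (t - 1) else 0)"
| "normal_table n t \<beta> \<gamma> \<delta> _ _ = 0"

definition normal_algebra :: "nat \<Rightarrow> nat \<Rightarrow> complex \<Rightarrow> complex \<Rightarrow> complex \<Rightarrow> vec superalg" where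
  "normal_algebra n t \<beta> \<gamma> \<delta> = table_algebra (insert X (nil_basis n))
     (\<lambda>g h. base_table n g h + x_table n g h + normal_table n t \<beta> \<gamma> \<delta> g h)"

lemma basis_cases:
  assumes "g \<in> insert X (nil_basis n)"
  obtains (E) i where "g = E i" "1 \<le> i" "i \<le> n" | (Y) i where "g = Y i" "1 \<le> i" "i \<le> n - 1"
    | (X) "g = X"
  using assms by (auto simp: nil_basis_def)

lemma SG1_normal:
  assumes "4 \<le> t" "t \<le> n"
  shows "SG n (SG1 t) = normal_algebra n t 1 0 (of_nat (2 * (t - 2)))"
  unfolding SG_def normal_algebra_def
proof (rule table_algebra_cong)
  fix g h assume g: "g \<in> insert X (nil_basis n)" and h: "h \<in> insert X (nil_basis n)"
  have "label_table n (SG1 t) g h = normal_table n t 1 0 (of_nat (2 * (t - 2))) g h"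
    using g h assms by (elim basis_cases) (auto simp: e_vec_def y_vec_def fun_eq_iff of_nat_diff)
  then show "base_table n g h + x_table n g h + label_table n (SG1 t) g h
      = base_table n g h + x_table n g h + normal_table n t 1 0 (of_nat (2 * (t - 2))) g h" by simp
qed

text \<open>For \<open>n = 3\<close> the two tables differ at \<open>[y\<^sub>1, e\<^sub>2]\<close>, hence the bound on \<open>n\<close>.\<close>

lemma SG2_normal:
  assumes "odd n" "n \<ge> 5"
  shows "SG n (SG2 \<gamma>) = normal_algebra n ((n + 3) div 2) 1 \<gamma> (of_nat (n - 1))"
  unfolding SG_def normal_algebra_def
proof (rule table_algebra_cong)
  fix g h assume g: "g \<in> insert X (nil_basis n)" and h: "h \<in> insert X (nil_basis n)"
  obtain k where k: "n = 2 * k + 1" "k \<ge> 2" using assms by (auto elim!: oddE)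
  have d: "(2 * k + 1 + 3) div 2 = k + 2" "(2 * k + 1 - 1) div 2 = k" "(2 * k + 1 + 1) div 2 = k + 1"
    by auto
  have "label_table n (SG2 \<gamma>) g h = normal_table n ((n + 3) div 2) 1 \<gamma> (of_nat (n - 1)) g h"
    using g h k(2) unfolding k(1)
    by (elim basis_cases) (auto simp: e_vec_def y_vec_def fun_eq_iff d)
  then show "base_table n g h + x_table n g h + label_table n (SG2 \<gamma>) g h
      = base_table n g h + x_table n g h + normal_table n ((n + 3) div 2) 1 \<gamma> (of_nat (n - 1)) g h"
    by simp
qed

lemma SG3_normal:
  assumes "n \<ge> 3"
  shows "SG n SG3 = normal_algebra n 4 0 1 (of_nat (n - 1))"
  unfolding SG_def normal_algebra_def
proof (rule table_algebra_cong)
  fix g h assume g: "g \<in> insert X (nil_basis n)" and h: "h \<in> insert X (nil_basis n)"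
  have "label_table n SG3 g h = normal_table n 4 0 1 (of_nat (n - 1)) g h"
    using g h assms by (elim basis_cases) (auto simp: e_vec_def y_vec_def fun_eq_iff of_nat_diff)
  then show "base_table n g h + x_table n g h + label_table n SG3 g h
      = base_table n g h + x_table n g h + normal_table n 4 0 1 (of_nat (n - 1)) g h" by simp
qed

context leibniz_chain begin

text \<open>The vectors \<open>e\<^sub>i\<close> and \<open>y\<^sub>i\<close> recovered from the chain. The powers of 2 undo the factors 1/2 in the
  products with \<open>y\<^sub>1\<close>, and out of range the values are 0 because the chain has ended.\<close>

definition ev :: "nat \<Rightarrow> 'a" where
  "ev i = (if i = 1 then c 1 else if i = 2 then f else 2 ^ (i - 2) *s c (2 * i - 3))"

definition yv :: "nat \<Rightarrow> 'a" where
  "yv i = 2 ^ (i - 1) *s c (2 * i - 2)"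

lemma ev_carrier [simp]: "ev i \<in> carrier L" and yv_carrier [simp]: "yv i \<in> carrier L"
  by (simp_all add: ev_def yv_def)

lemma ev_shift: "ev (i + 3) = 2 ^ (i + 1) *s c (2 * i + 3)"
  and yv_shift: "yv (Suc i) = 2 ^ i *s c (2 * i)"
  and ev_1: "ev 1 = c 1" and ev_2: "ev 2 = f"
  by (simp_all add: ev_def yv_def algebra_simps)

lemma ev_zero: "n < i \<Longrightarrow> ev i = 0" and yv_zero: "n - 1 < i \<Longrightarrow> yv i = 0"
  using n_ge_3 by (simp_all add: ev_def yv_def c_zero)

lemma ge3_cases:
  assumes "3 \<le> (i::nat)"
  obtains j where "i = j + 3"
  using assms by (metis add.commute le_Suc_ex)

lemma mult_ev_ge3: "u \<in> carrier L \<Longrightarrow> 3 \<le> i \<Longrightarrow> u \<cdot> ev i = 0"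
proof (elim ge3_cases)
  fix j assume u: "u \<in> carrier L" and i: "i = j + 3"
  have "u \<cdot> c (2 * j + 1 + 2) = 0" using u by (rule mult_c_ge_2)
  then show ?thesis using u unfolding i ev_shift by (simp add: mult_scale numeral_3_eq_3)
qed

lemma mult_yv_ge2: "u \<in> carrier L \<Longrightarrow> 2 \<le> i \<Longrightarrow> u \<cdot> yv i = 0"
proof -
  assume u: "u \<in> carrier L" and "2 \<le> i"
  then obtain j where i: "i = Suc (Suc j)" by (metis add_2_eq_Suc le_Suc_ex)
  have "u \<cdot> c (2 * j + 2) = 0" using u by (rule mult_c_ge_2)
  then show ?thesis using u unfolding i yv_shift by (simp add: mult_scale)
qed

lemma yv_mult_yv1: "1 \<le> i \<Longrightarrow> yv i \<cdot> yv 1 = (if i = 1 then ev 1 else ev (i + 1))"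
proof -
  assume "1 \<le> i"
  then consider "i = 1" | j where "i = Suc (Suc j)" by (cases i; cases "i - 1") auto
  then show ?thesis
  proof cases
    case 1
    then show ?thesis by (simp add: yv_def ev_def c_Suc)
  next
    case 2
    have "ev (i + 1) = ev (j + 3)" using 2 by (simp add: numeral_3_eq_3)
    also have "\<dots> = 2 ^ (j + 1) *s c (Suc (2 * (j + 1)))" unfolding ev_shift by (simp add: numeral_3_eq_3)
    also have "\<dots> = (2 ^ (j + 1) *s c (2 * (j + 1))) \<cdot> c 0"
      unfolding c_Suc by (simp only: mult_scale(1) c_carrier)
    also have "\<dots> = yv i \<cdot> yv 1"
      unfolding 2 yv_shift One_nat_def by simp
    finally show ?thesis using 2 by simp
  qed
qed

lemma ev_mult_yv1: "ev 1 \<cdot> yv 1 = (1/2) *s yv 2" "ev 2 \<cdot> yv 1 = 0"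
    "3 \<le> i \<Longrightarrow> ev i \<cdot> yv 1 = (1/2) *s yv i"
proof -
  have y1: "yv 1 = c 0" using yv_shift[of 0] by simp
  show "ev 1 \<cdot> yv 1 = (1/2) *s yv 2"
    using yv_shift[of 1] unfolding y1 ev_1 by (simp add: numeral_2_eq_2 c_Suc[symmetric])
  show "ev 2 \<cdot> yv 1 = 0" unfolding y1 ev_2 by (rule f_mult_c0)
  assume "3 \<le> i"
  then obtain j where i: "i = j + 3" by (rule ge3_cases)
  have "ev i \<cdot> c 0 = 2 ^ (j + 1) *s c (Suc (2 * j + 3))" unfolding i ev_shift c_Suc by (simp only: mult_scale(1) c_carrier)
  also have "\<dots> = (1/2) *s yv i"
    using yv_shift[of "j + 2"] i by (simp add: numeral_3_eq_3)
  finally show "ev i \<cdot> yv 1 = (1/2) *s yv i" unfolding y1 .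
qed

lemma mult_ev1: "u \<in> carrier L \<Longrightarrow> u \<cdot> ev 1 = 2 *s (u \<cdot> yv 1 \<cdot> yv 1)"
proof -
  assume "u \<in> carrier L"
  moreover have "yv 1 = c 0" using yv_shift[of 0] by simp
  ultimately show ?thesis using mult_c1 by (simp only: ev_1)
qed

lemma yv_mult_ev1: "1 \<le> i \<Longrightarrow> yv i \<cdot> ev 1 = yv (i + 1)"
proof -
  assume i: "1 \<le> i"
  show ?thesis
  proof (cases "i = 1")
    case True
    then show ?thesis
      unfolding mult_ev1[OF yv_carrier] yv_mult_yv1[OF i] by (simp add: ev_mult_yv1 del: One_nat_def)
  next
    case False
    then show ?thesis
      using i unfolding mult_ev1[OF yv_carrier] yv_mult_yv1[OF i]
      by (simp add: ev_mult_yv1 del: One_nat_def)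
  qed
qed

lemma ev_mult_ev1: "ev 1 \<cdot> ev 1 = ev 3" "ev 2 \<cdot> ev 1 = 0" "3 \<le> i \<Longrightarrow> ev i \<cdot> ev 1 = ev (i + 1)"
  unfolding mult_ev1[OF ev_carrier]
  by (simp_all add: ev_mult_yv1 yv_mult_yv1 mult_scale mult_zero del: One_nat_def)

lemma eigen_ev:
  assumes x: "x \<in> part L 0" and c0: "c 0 \<cdot> x = c 0"
  shows "1 \<le> i \<Longrightarrow> yv i \<cdot> x = (2 * of_nat i - 1) *s yv i" "ev 1 \<cdot> x = 2 *s ev 1"
    "3 \<le> i \<Longrightarrow> ev i \<cdot> x = (2 * (of_nat i - 1)) *s ev i"
proof -
  note e = eigen_c[OF x c0]
  have xC: "x \<in> carrier L" using x by (rule part_carrier)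
  show "yv i \<cdot> x = (2 * of_nat i - 1) *s yv i" if i1: "1 \<le> i"
  proof -
    obtain j where i: "i = Suc j" using i1 by (cases i) auto
    have "yv i \<cdot> x = of_nat (Suc (2 * j)) *s yv i"
      unfolding i yv_shift by (simp only: mult_scale(1) c_carrier xC e vs.scale_scale mult.commute)
    moreover have "of_nat (Suc (2 * j)) = 2 * of_nat i - (1::complex)" by (simp add: i)
    ultimately show ?thesis by simp
  qed
  show "ev 1 \<cdot> x = 2 *s ev 1" unfolding ev_1 using e[of 1] by simp
  assume "3 \<le> i"
  then obtain j where i: "i = j + 3" by (rule ge3_cases)
  have "ev i \<cdot> x = of_nat (Suc (2 * j + 3)) *s ev i"
    unfolding i ev_shift by (simp only: mult_scale(1) c_carrier xC e vs.scale_scale mult.commute)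
  moreover have "of_nat (Suc (2 * j + 3)) = 2 * (of_nat i - (1::complex))" by (simp add: i)
  ultimately show "ev i \<cdot> x = (2 * (of_nat i - 1)) *s ev i" by simp
qed

lemma mult_f_normal:
  assumes f: "c 0 \<cdot> f = (\<beta> * 2 ^ (t - 2)) *s c (2 * (t - 2))" and t: "4 \<le> t"
  shows "1 \<le> i \<Longrightarrow> yv i \<cdot> ev 2 = \<beta> *s yv (i + t - 2)" "ev 1 \<cdot> ev 2 = \<beta> *s ev t"
    "3 \<le> i \<Longrightarrow> ev i \<cdot> ev 2 = \<beta> *s ev (i + t - 2)"
proof -
  have cf: "c k \<cdot> f = (\<beta> * 2 ^ (t - 2)) *s c (2 * (t - 2) + k)" for k
  proof (induction k)
    case (Suc k)
    have "c (Suc k) \<cdot> f = (\<beta> * 2 ^ (t - 2)) *s c (Suc (2 * (t - 2) + k))"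
      unfolding c_Suc_mult_f Suc c_Suc[of "2 * (t - 2) + k"] by (simp only: mult_scale(1) c_carrier)
    then show ?case by simp
  qed (simp add: f)
  show "yv i \<cdot> ev 2 = \<beta> *s yv (i + t - 2)" if i1: "1 \<le> i"
  proof -
    obtain j where i: "i = Suc j" using i1 by (cases i) auto
    have "i + t - 2 = Suc (j + (t - 2))" using t by (simp add: i)
    then have "yv (i + t - 2) = 2 ^ (j + (t - 2)) *s c (2 * (t - 2) + 2 * j)"
      using yv_shift by (simp add: add_mult_distrib2 add.commute)
    then show ?thesis unfolding i yv_shift ev_2
      by (simp add: mult_scale(1) cf power_add mult.commute mult.left_commute)
  qed
  have "2 * (t - 2) + 1 = 2 * t - 3" using t by simp
  then show "ev 1 \<cdot> ev 2 = \<beta> *s ev t" unfolding ev_1 ev_2 cf using t by (simp add: ev_def)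
  assume "3 \<le> i"
  then obtain j where i: "i = j + 3" by (rule ge3_cases)
  have "i + t - 2 = (j + (t - 2)) + 3" using t by (simp add: i)
  then have "ev (i + t - 2) = 2 ^ (j + (t - 2) + 1) *s c (2 * (t - 2) + (2 * j + 3))"
    by (simp only: ev_shift) (simp add: add_mult_distrib2 add_ac)
  then show "ev i \<cdot> ev 2 = \<beta> *s ev (i + t - 2)"
    unfolding i ev_shift ev_2
    by (simp add: mult_scale(1) cf power_add mult.commute mult.left_commute)
qed

definition basis_vector :: "'a \<Rightarrow> gen \<Rightarrow> 'a" where
  "basis_vector x g = (case g of E i \<Rightarrow> ev i | Y i \<Rightarrow> yv i | X \<Rightarrow> x)"

lemma basis_vector_simps [simp]:
  "basis_vector x (E i) = ev i" "basis_vector x (Y i) = yv i" "basis_vector x X = x"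
  by (simp_all add: basis_vector_def)

lemma finite_basis: "finite (insert X (nil_basis n))"
  by (simp add: nil_basis_def)

lemma lin_comb_e_vec:
  "1 \<le> i \<Longrightarrow> lin_comb (insert X (nil_basis n)) (basis_vector x) (e_vec n i) = ev i"
proof (cases "i \<le> n")
  case True
  assume "1 \<le> i"
  then have "E i \<in> insert X (nil_basis n)" using True by (simp add: nil_basis_def)
  then show ?thesis using lin_comb_unit[OF finite_basis] True \<open>1 \<le> i\<close> by (simp add: e_vec_def)
qed (simp add: e_vec_def ev_zero lin_comb_linear)

lemma lin_comb_y_vec:
  "1 \<le> i \<Longrightarrow> lin_comb (insert X (nil_basis n)) (basis_vector x) (y_vec n i) = yv i"
proof (cases "i \<le> n - 1")
  case True
  assume "1 \<le> i"
  then have "Y i \<in> insert X (nil_basis n)" using True by (auto simp: nil_basis_def)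
  then show ?thesis using lin_comb_unit[OF finite_basis] True \<open>1 \<le> i\<close> by (simp add: y_vec_def)
qed (simp add: y_vec_def yv_zero lin_comb_linear)

lemma tail_independent:
  assumes "(\<Sum>i<M. a i *s c (k + 2 * i)) = 0" "i < M" "k + 2 * M < 2 * n"
  shows "a i = 0"
  using assms
proof (induction M arbitrary: k a i)
  case (Suc M)
  have "(\<Sum>i<M. a (Suc i) *s c (k + 2 + 2 * i)) \<in> T (k + 2)"
    by (intro vs.subspace_sum[OF subspace_T] T_scale c_in_T)
  moreover have eq: "a 0 *s c k + (\<Sum>i<M. a (Suc i) *s c (k + 2 + 2 * i)) = 0"
    using Suc.prems(1) by (simp add: sum.lessThan_Suc_shift algebra_simps del: sum.lessThan_Suc)
  ultimately have "a 0 *s c k \<in> T (k + 2)" using T_neg by (simp add: eq_neg_iff_add_eq_0[symmetric])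
  then have a0: "a 0 = 0" using Suc.prems(3) by (intro c_independent[of k]) simp_all
  then have rest: "(\<Sum>i<M. a (Suc i) *s c (k + 2 + 2 * i)) = 0" using eq by simp
  show ?case
  proof (cases i)
    case (Suc j)
    then show ?thesis using Suc.IH[of "\<lambda>i. a (Suc i)" "k + 2" j] rest Suc.prems by simp
  qed (simp add: a0)
qed simp


lemma sum_basis:
  "(\<Sum>g\<in>insert X (nil_basis n). F g) =
     F X + F (E 2) + (\<Sum>i<n - 1. F (if i = 0 then E 1 else E (i + 2))) + (\<Sum>i<n - 1. F (Y (Suc i)))"
  for F :: "gen \<Rightarrow> 'a"
proof -
  let ?e = "\<lambda>i. if i = 0 then E 1 else E (i + 2)"
  have e: "E ` {1..n} = insert (E 2) (?e ` {..<n - 1})"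
  proof
    show "E ` {1..n} \<subseteq> insert (E 2) (?e ` {..<n - 1})"
    proof (rule image_subsetI)
      fix i assume i: "i \<in> {1..n}"
      consider "i = 1" | "i = 2" | "3 \<le> i" using i by fastforce
      then show "E i \<in> insert (E 2) (?e ` {..<n - 1})"
      proof cases
        case 1
        then show ?thesis using n_ge_3 by (intro insertI2 image_eqI[of _ _ 0]) auto
      next
        case 3
        then show ?thesis using i by (intro insertI2 image_eqI[of _ _ "i - 2"]) auto
      qed simp
    qed
    show "insert (E 2) (?e ` {..<n - 1}) \<subseteq> E ` {1..n}" using n_ge_3 by auto
  qed
  have y: "Y ` {1..n - 1} = (\<lambda>i. Y (Suc i)) ` {..<n - 1}"
    by (simp only: image_Suc_lessThan[symmetric] image_image)
  define A where "A = ?e ` {..<n - 1}"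
  define B where "B = (\<lambda>i. Y (Suc i)) ` {..<n - 1}"
  have fin: "finite A" "finite B" by (simp_all add: A_def B_def)
  have disj: "X \<notin> insert (E 2) (A \<union> B)" "E 2 \<notin> A \<union> B" "A \<inter> B = {}"
    by (auto simp: A_def B_def)
  have "insert X (nil_basis n) = insert X (insert (E 2) (A \<union> B))"
    unfolding nil_basis_def e y A_def B_def by simp
  then have "(\<Sum>g\<in>insert X (nil_basis n). F g) = F X + (F (E 2) + (sum F A + sum F B))"
    using fin disj by (simp only: sum.insert finite_insert finite_Un sum.union_disjoint not_False_eq_True)
  moreover have "sum F A = (\<Sum>i<n - 1. F (?e i))"
    unfolding A_def by (rule sum.reindex_cong[OF _ refl refl]) (auto simp: inj_on_def)
  moreover have "sum F B = (\<Sum>i<n - 1. F (Y (Suc i)))"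
    unfolding B_def by (rule sum.reindex_cong[OF _ refl refl]) (auto simp: inj_on_def)
  ultimately show ?thesis by (simp only: add.assoc)
qed

text \<open>With the exceptional position of \<open>e\<^sub>1\<close> hidden in the index, the \<open>e\<^sub>i\<close> with \<open>i \<noteq> 2\<close> are treated in the
  same way as the \<open>y\<^sub>i\<close>.\<close>

lemma ev_family: "ev (if i = 0 then 1 else i + 2) = 2 ^ i *s c (1 + 2 * i)"
  by (simp add: ev_def)

lemma lin_comb_basis:
  "lin_comb (insert X (nil_basis n)) (basis_vector x) v =
     v X *s x + v (E 2) *s f
     + (\<Sum>i<n - 1. (v (E (if i = 0 then 1 else i + 2)) * 2 ^ i) *s c (1 + 2 * i))
     + (\<Sum>i<n - 1. (v (Y (Suc i)) * 2 ^ i) *s c (0 + 2 * i))"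
proof -
  have "(if i = 0 then E 1 else E (i + 2)) = E (if i = 0 then 1 else i + 2)" for i by simp
  then show ?thesis
    unfolding lin_comb_def sum_basis
    by (simp only: basis_vector_simps ev_family ev_2 yv_shift vs.scale_scale add_0)
qed

lemma basis_independent:
  assumes x: "x \<notin> N"
    and v: "v \<in> part (table_algebra (insert X (nil_basis n)) m) \<alpha>"
    and zero: "lin_comb (insert X (nil_basis n)) (basis_vector x) v = 0"
  shows "v = 0"
proof -
  have supp: "v g = 0" if "g \<notin> insert X (nil_basis n) \<or> gen_degree g \<noteq> \<alpha>" for g
    using v that by auto
  define p where "p = (\<Sum>i<n - 1. (v (E (if i = 0 then 1 else i + 2)) * 2 ^ i) *s c (1 + 2 * i))"
  define q where "q = (\<Sum>i<n - 1. (v (Y (Suc i)) * 2 ^ i) *s c (0 + 2 * i))"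
  have eq: "v X *s x + v (E 2) *s f + p + q = 0"
    using zero unfolding lin_comb_basis p_def q_def .
  have p: "p \<in> T 1" unfolding p_def by (intro vs.subspace_sum[OF subspace_T] T_scale c_in_T)
  have q: "q \<in> T 0" unfolding q_def by (intro vs.subspace_sum[OF subspace_T] T_scale c_in_T)
  note subN = subspace_ideal[OF ideal]
  have "v X = 0"
  proof (rule ccontr)
    assume "v X \<noteq> 0"
    have "v (E 2) *s f + p + q \<in> N"
      by (intro vs.subspace_add[OF subN] vs.subspace_scale[OF subN] f_N T_N[OF p] T_N[OF q])
    then have "(1 / v X) *s (- (v (E 2) *s f + p + q)) \<in> N"
      by (intro vs.subspace_scale[OF subN] vs.subspace_neg[OF subN])
    moreover have "v X *s x = - (v (E 2) *s f + p + q)"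
      using eq by (simp only: eq_neg_iff_add_eq_0 add.assoc)
    ultimately have "(1 / v X) *s v X *s x \<in> N" by (simp only:)
    then show False using x \<open>v X \<noteq> 0\<close> by simp
  qed
  have pq: "p = 0 \<and> q = 0 \<and> v (E 2) = 0"
  proof (cases "\<alpha> = 0")
    case True
    then have "q = 0" using supp unfolding q_def by (intro sum.neutral) simp
    have "v (E 2) = 0"
    proof (rule ccontr)
      assume nz: "v (E 2) \<noteq> 0"
      have "v (E 2) *s f = - p" using eq \<open>v X = 0\<close> \<open>q = 0\<close> by (simp add: eq_neg_iff_add_eq_0)
      then have "(1 / v (E 2)) *s v (E 2) *s f \<in> T 1"
        by (simp only:) (intro T_scale T_neg p)
      then show False using f_not_in_tail nz by simp
    qed
    then show ?thesis using eq \<open>v X = 0\<close> \<open>q = 0\<close> by simp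
  next
    case False
    then have "p = 0" "v (E 2) = 0" using supp unfolding p_def by (auto intro!: sum.neutral)
    then show ?thesis using eq \<open>v X = 0\<close> by simp
  qed
  have vE: "v (E (if i = 0 then 1 else i + 2)) = 0" if "i < n - 1" for i
    using tail_independent[of "\<lambda>i. v (E (if i = 0 then 1 else i + 2)) * 2 ^ i" 1 "n - 1" i] that pq n_ge_3
    unfolding p_def by simp
  have vY: "v (Y (Suc i)) = 0" if "i < n - 1" for i
    using tail_independent[of "\<lambda>i. v (Y (Suc i)) * 2 ^ i" 0 "n - 1" i] that pq n_ge_3
    unfolding q_def by simp
  have "v g = 0" if "g \<in> insert X (nil_basis n)" for g
    using that
  proof (cases rule: basis_cases)
    case (E i)
    consider "i = 1" | "i = 2" | "3 \<le> i" using E by linarith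
    then show ?thesis
    proof cases
      case 1
      then show ?thesis using vE[of 0] E(1) n_ge_3 by simp
    next
      case 3
      then have "i - 2 < n - 1" "i = (if i - 2 = 0 then 1 else i - 2 + 2)" using E by auto
      then show ?thesis using vE[of "i - 2"] E(1) by metis
    qed (use pq E in simp)
  next
    case (Y i)
    then show ?thesis using vY[of "i - 1"] by simp
  qed (use \<open>v X = 0\<close> in simp)
  then show ?thesis using supp by (auto simp: fun_eq_iff)
qed

lemma basis_spans:
  assumes x: "adapted x \<delta>"
  shows "part L \<alpha> \<subseteq> vs.span (basis_vector x ` {g \<in> insert X (nil_basis n). gen_degree g = \<alpha>})"
    (is "_ \<subseteq> ?W \<alpha>")
proof -
  have base: "basis_vector x g \<in> ?W (gen_degree g)" if "g \<in> insert X (nil_basis n)" for g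
    using that by (intro vs.span_base) auto
  have odd: "T 0 \<subseteq> ?W 1"
    unfolding T_def
  proof (rule vs.span_minimal[OF _ vs.subspace_span], safe)
    fix j
    show "c (0 + 2 * j) \<in> ?W 1"
    proof (cases "j < n - 1")
      case True
      then have "yv (Suc j) \<in> ?W 1" using base[of "Y (Suc j)"] by (simp add: nil_basis_def)
      then have "(1 / 2 ^ j) *s yv (Suc j) \<in> ?W 1" by (rule vs.span_scale)
      then show ?thesis by (simp add: yv_shift)
    next
      case False
      then show ?thesis using vs.span_zero by (simp add: c_zero)
    qed
  qed
  have even: "T 1 \<subseteq> ?W 0"
    unfolding T_def
  proof (rule vs.span_minimal[OF _ vs.subspace_span], safe)
    fix j
    show "c (1 + 2 * j) \<in> ?W 0"
    proof (cases "j < n - 1")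
      case True
      then have "ev (if j = 0 then 1 else j + 2) \<in> ?W 0"
        using base[of "E (if j = 0 then 1 else j + 2)"] by (auto simp: nil_basis_def)
      then have "(1 / 2 ^ j) *s ev (if j = 0 then 1 else j + 2) \<in> ?W 0" by (rule vs.span_scale)
      then show ?thesis unfolding ev_family by simp
    next
      case False
      then show ?thesis using vs.span_zero by (simp add: c_zero)
    qed
  qed
  have f: "f \<in> ?W 0" using base[of "E 2"] n_ge_3 by (simp add: nil_basis_def ev_2)
  have X: "x \<in> ?W 0" using base[of X] by simp
  have "v \<in> ?W 0" if v: "v \<in> part L 0" for v
  proof -
    have xp: "x \<in> part L 0" using x by (simp add: adapted_def)
    obtain s where s: "v - s *s x \<in> N" using x v unfolding adapted_def by blast
    have "v - s *s x \<in> part L 0 \<inter> N"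
      using s vs.subspace_diff[OF subspace_part v vs.subspace_scale[OF subspace_part xp]] by blast
    then obtain r w where w: "v - s *s x = r *s f + w" "w \<in> T 1" unfolding even_part by blast
    have "r *s f + w + s *s x \<in> ?W 0"
      using even w(2) by (intro vs.span_add vs.span_scale f X) blast
    then show ?thesis using w(1) by (metis diff_add_cancel)
  qed
  then show ?thesis using odd odd_part bit_cases[of \<alpha>] by auto
qed


lemma ev_part: "1 \<le> i \<Longrightarrow> ev i \<in> part L 0" and yv_part: "1 \<le> i \<Longrightarrow> yv i \<in> part L 1"
proof -
  show "ev i \<in> part L 0" if i1: "1 \<le> i"
  proof (cases "i = 2")
    case True
    then show ?thesis using f_part by (simp add: ev_2)
  next
    case False
    obtain j where "i = (if j = 0 then 1 else j + 2)"
    proof (cases "i = 1")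
      case True
      then show ?thesis using that[of 0] by simp
    next
      case False
      then show ?thesis using that[of "i - 2"] i1 \<open>i \<noteq> 2\<close> by simp
    qed
    then have i: "ev i = 2 ^ j *s c (1 + 2 * j)" using ev_family by simp
    have "c (1 + 2 * j) \<in> part L 0" using even_tail_part[OF c_in_T_self[of "2 * j + 1"]] by simp
    then show ?thesis unfolding i by (rule vs.subspace_scale[OF subspace_part])
  qed
  show "yv i \<in> part L 1" if i1: "1 \<le> i"
  proof -
    obtain j where i: "i = Suc j" using i1 by (cases i) auto
    show ?thesis
      unfolding i yv_shift
      by (rule vs.subspace_scale[OF subspace_part odd_tail_part[OF c_in_T_self]])
  qed
qed

lemma table_of_basis:
  assumes x: "adapted x \<delta>" and xc: "x \<cdot> c 0 = - c 0"
    and cf: "c 0 \<cdot> f = (\<beta> * 2 ^ (t - 2)) *s c (2 * (t - 2))"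
    and ff: "f \<cdot> f = (\<gamma> * 2 ^ (n - 2)) *s c (2 * n - 3)"
    and xf: "x \<cdot> f = - (\<delta> *s f) - (\<beta> * 2 ^ (t - 2)) *s c (2 * (t - 2) - 1)"
    and t: "4 \<le> t"
    and g: "g \<in> insert X (nil_basis n)" and h: "h \<in> insert X (nil_basis n)"
  shows "basis_vector x g \<cdot> basis_vector x h = lin_comb (insert X (nil_basis n)) (basis_vector x)
      (base_table n g h + x_table n g h + normal_table n t \<beta> \<gamma> \<delta> g h)"
    (is "_ = ?F _")
proof -
  have xp: "x \<in> part L 0" "c 0 \<cdot> x = c 0" "f \<cdot> x = \<delta> *s f" "x \<cdot> x = 0"
    using x by (simp_all add: adapted_def)
  have xC: "x \<in> carrier L" using xp(1) by (rule part_carrier)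
  have y1: "yv 1 = c 0" using yv_shift[of 0] by simp
  note lc = lin_comb_linear lin_comb_e_vec lin_comb_y_vec
  have right1: "u \<cdot> ev 1 = 2 *s (u \<cdot> yv 1 \<cdot> yv 1)" if "u \<in> carrier L" for u
    using mult_ev1 that .
  have xy: "x \<cdot> yv 1 = - yv 1" unfolding y1 by (rule xc)
  have xe: "x \<cdot> ev 1 = (- 2) *s ev 1"
    using yv_mult_yv1[of 1] unfolding right1[OF xC] xy by (simp add: mult_minus xy del: One_nat_def)
  have "ev (t - 1) = 2 ^ (t - 3) *s c (2 * (t - 2) - 1)"
  proof -
    have "t - 1 - 2 = t - 3" "2 * (t - 1) - 3 = 2 * (t - 2) - 1" "t - 1 \<noteq> 1" "t - 1 \<noteq> 2"
      using t by linarith+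
    then show ?thesis by (simp only: ev_def if_False)
  qed
  moreover have "(2::complex) ^ (t - 2) = 2 * 2 ^ (t - 3)"
  proof -
    have "t - 2 = Suc (t - 3)" using t by simp
    then show ?thesis by simp
  qed
  ultimately have xf': "x \<cdot> ev 2 = (- \<delta>) *s ev 2 + (- 2 * \<beta>) *s ev (t - 1)"
    using xf by (simp add: ev_2 mult.commute mult.left_commute)
  have "ev n = 2 ^ (n - 2) *s c (2 * n - 3)" using n_ge_3 by (simp add: ev_def)
  then have ff': "ev 2 \<cdot> ev 2 = \<gamma> *s ev n" using ff by (simp add: ev_2)
  note f_normal = mult_f_normal[OF cf t]
  note eigen = eigen_ev[OF xp(1,2)]
  have fx: "ev 2 \<cdot> x = \<delta> *s ev 2" unfolding ev_2 by (rule xp(3))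
  show ?thesis
    using g
  proof (cases rule: basis_cases)
    case (E i)
    consider "i = 1" | "i = 2" | "3 \<le> i" using E by linarith
    note i_cases = this
    show ?thesis
      using h
    proof (cases rule: basis_cases)
      case h: (E j)
      consider "j = 1" | "j = 2" | "3 \<le> j" using h by linarith
      then show ?thesis
      proof cases
        case 1
        show ?thesis
          using i_cases
          by cases (use E h 1 ev_zero[of "i + 1"] in \<open>auto simp: lc ev_mult_ev1 simp del: One_nat_def\<close>)
      next
        case 2
        show ?thesis
          using i_cases
          by cases (use E h 2 t n_ge_3 in \<open>auto simp: lc f_normal ff' simp del: One_nat_def\<close>)
      next
        case 3
        then show ?thesis using E h by (simp add: lc mult_ev_ge3)
      qed
    next
      case h: (Y j)
      consider "j = 1" | "2 \<le> j" using h by linarith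
      then show ?thesis
      proof cases
        case 1
        show ?thesis
          using i_cases
          by cases (use E h 1 yv_zero[of i] in \<open>auto simp: lc ev_mult_yv1 simp del: One_nat_def\<close>)
      next
        case 2
        then show ?thesis using E h by (simp add: lc mult_yv_ge2)
      qed
    next
      case h: X
      show ?thesis
        using i_cases
        by cases (use E h in \<open>auto simp: lc eigen fx simp del: One_nat_def\<close>)
    qed
  next
    case (Y i)
    show ?thesis
      using h
    proof (cases rule: basis_cases)
      case h: (E j)
      consider "j = 1" | "j = 2" | "3 \<le> j" using h by linarith
      then show ?thesis
      proof cases
        case 1
        show ?thesis
          using Y h 1 yv_zero[of "i + 1"] by (auto simp: lc yv_mult_ev1 simp del: One_nat_def)
      next
        case 2
        show ?thesis
          using Y h 2 t by (auto simp: lc f_normal simp del: One_nat_def)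
      next
        case 3
        then show ?thesis using Y h by (simp add: lc mult_ev_ge3)
      qed
    next
      case h: (Y j)
      consider "j = 1" | "2 \<le> j" using h by linarith
      then show ?thesis
      proof cases
        case 1
        then show ?thesis using Y h by (auto simp: lc yv_mult_yv1 simp del: One_nat_def)
      next
        case 2
        then show ?thesis using Y h by (simp add: lc mult_yv_ge2)
      qed
    next
      case h: X
      then show ?thesis using Y by (simp add: lc eigen)
    qed
  next
    case X
    show ?thesis
      using h
    proof (cases rule: basis_cases)
      case h: (E j)
      consider "j = 1" | "j = 2" | "3 \<le> j" using h by linarith
      then show ?thesis
      proof cases
        case 1
        then show ?thesis using X h by (simp add: lc xe del: One_nat_def)
      next
        case 2
        then show ?thesis using X h t by (simp add: lc xf' del: One_nat_def)
      next
        case 3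
        then show ?thesis using X h xC by (simp add: lc mult_ev_ge3)
      qed
    next
      case h: (Y j)
      consider "j = 1" | "2 \<le> j" using h by linarith
      then show ?thesis
      proof cases
        case 1
        then show ?thesis using X h by (simp add: lc xy del: One_nat_def)
      next
        case 2
        then show ?thesis using X h xC by (simp add: lc mult_yv_ge2)
      qed
    next
      case h: X
      then show ?thesis using X xp(4) by (simp add: lc)
    qed
  qed
qed

end

lemma normal_table_closed:
  "base_table n g h + x_table n g h + normal_table n t \<beta> \<gamma> \<delta> g h
    \<in> carrier (table_algebra (insert X (nil_basis n)) m)"
proof -
  define C where "C = carrier (table_algebra (insert X (nil_basis n)) m)"
  have C: "v \<in> C \<longleftrightarrow> (\<forall>g. v g \<noteq> 0 \<longrightarrow> g \<in> insert X (nil_basis n))" for v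
    unfolding C_def carrier_table_algebra by simp
  have e: "e_vec n i \<in> C" "y_vec n i \<in> C" for i
    unfolding C by (auto simp: e_vec_def y_vec_def unit_vec_def nil_basis_def)
  have add: "u + v \<in> C" if "u \<in> C" "v \<in> C" for u v
    using that unfolding C_def by (rule table_algebra_closed(1))
  have scale: "s \<odot> u \<in> C" if "u \<in> C" for s u using that unfolding C by simp
  have zero: "0 \<in> C" unfolding C by simp
  have neg: "- u \<in> C" if "u \<in> C" for u using that unfolding C by simp
  have diff: "u - v \<in> C" if "u \<in> C" "v \<in> C" for u v
    using add[OF that(1) neg[OF that(2)]] by simp
  have "base_table n g h \<in> C"
    by (cases g; cases h) (simp_all add: e zero scale add)
  moreover have "x_table n g h \<in> C"
    by (cases g; cases h) (simp_all add: e zero scale neg add diff)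
  moreover have "normal_table n t \<beta> \<gamma> \<delta> g h \<in> C"
    by (cases g; cases h) (simp_all add: e zero scale neg add diff)
  ultimately show ?thesis unfolding C_def[symmetric] by (intro add)
qed

lemma (in leibniz_chain) isomorphic_normal_algebra:
  assumes "adapted x \<delta>" "x \<cdot> c 0 = - c 0"
    "c 0 \<cdot> f = (\<beta> * 2 ^ (t - 2)) *s c (2 * (t - 2))"
    "f \<cdot> f = (\<gamma> * 2 ^ (n - 2)) *s c (2 * n - 3)"
    "x \<cdot> f = - (\<delta> *s f) - (\<beta> * 2 ^ (t - 2)) *s c (2 * (t - 2) - 1)"
    "4 \<le> t"
  shows "isomorphic L (normal_algebra n t \<beta> \<gamma> \<delta>)"
  unfolding normal_algebra_def
proof (rule isomorphic_table_algebra[where b = "basis_vector x"])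
  have x: "x \<in> part L 0" "x \<notin> N" using assms(1) by (simp_all add: adapted_def)
  show "finite (insert X (nil_basis n))" by (rule finite_basis)
  show "basis_vector x g \<in> part L (gen_degree g)" if "g \<in> insert X (nil_basis n)" for g
    using that by (cases rule: basis_cases) (simp_all add: ev_part yv_part x)
  show "v = 0" if "v \<in> part (table_algebra (insert X (nil_basis n))
      (\<lambda>g h. base_table n g h + x_table n g h + normal_table n t \<beta> \<gamma> \<delta> g h)) \<alpha>"
    "lin_comb (insert X (nil_basis n)) (basis_vector x) v = 0" for \<alpha> v
    using basis_independent[OF x(2) that] .
  show "part L \<alpha> \<subseteq> vs.span (basis_vector x ` {g \<in> insert X (nil_basis n). gen_degree g = \<alpha>})" for \<alpha>
    by (rule basis_spans[OF assms(1)])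
qed (fact table_of_basis[OF assms], rule normal_table_closed)

section \<open>The classification\<close>

lemma table_bracket_unit:
  assumes "finite S" "g \<in> S" "h \<in> S"
  shows "bracket (table_algebra S m) (unit_vec g) (unit_vec h) = m g h"
proof
  fix k
  have "bracket (table_algebra S m) (unit_vec g) (unit_vec h) k
      = (\<Sum>g'\<in>S. \<Sum>h'\<in>S. if h' = h then (if g' = g then m g h k else 0) else 0)"
    by (simp add: sum_apply unit_vec_def) (intro sum.cong refl, auto)
  also have "\<dots> = m g h k" using assms by (simp add: sum.delta)
  finally show "bracket (table_algebra S m) (unit_vec g) (unit_vec h) k = m g h k" .
qed

lemma table_bracket_scale:
  "bracket (table_algebra S m) (s \<odot> u) v = s \<odot> bracket (table_algebra S m) u v"
  "bracket (table_algebra S m) u (s \<odot> v) = s \<odot> bracket (table_algebra S m) u v"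
  by (simp_all add: fun_eq_iff sum_apply sum_distrib_left algebra_simps)

lemma e_vec_unit: "1 \<le> i \<Longrightarrow> i \<le> n \<Longrightarrow> e_vec n i = unit_vec (E i)"
  and y_vec_unit: "1 \<le> i \<Longrightarrow> i \<le> n - 1 \<Longrightarrow> y_vec n i = unit_vec (Y i)"
  by (simp_all add: e_vec_def y_vec_def)

definition G_chain :: "nat \<Rightarrow> nat \<Rightarrow> vec" where
  "G_chain n k = (1 / 2 ^ (k div 2)) \<odot>
     (if even k then y_vec n (k div 2 + 1) else e_vec n (if k = 1 then 1 else k div 2 + 2))"

lemma G_chain_even: "G_chain n (2 * j) = (1 / 2 ^ j) \<odot> y_vec n (j + 1)"
  by (simp add: G_chain_def)

lemma G_chain_odd: "G_chain n (2 * j + 1) = (1 / 2 ^ j) \<odot> e_vec n (if j = 0 then 1 else j + 2)"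
  by (simp add: G_chain_def)

lemma span_units:
  assumes "finite A" "\<And>g. v g \<noteq> 0 \<Longrightarrow> g \<in> A"
  shows "v \<in> vec.span (unit_vec ` A)"
proof -
  have "v = (\<Sum>g\<in>A. v g \<odot> unit_vec g)"
  proof
    fix k
    have "(\<Sum>g\<in>A. v g \<odot> unit_vec g) k = (\<Sum>g\<in>A. if g = k then v k else 0)"
      unfolding sum_apply by (intro sum.cong refl) (auto simp: unit_vec_def)
    also have "\<dots> = v k" using assms by (auto simp: sum.delta)
    finally show "v k = (\<Sum>g\<in>A. v g \<odot> unit_vec g) k" by simp
  qed
  also have "\<dots> \<in> vec.span (unit_vec ` A)"
    by (intro vec.span_sum vec.span_scale vec.span_base) blast
  finally show ?thesis .
qed

lemma subspace_supported: "vec.subspace {v. \<forall>g. v g \<noteq> 0 \<longrightarrow> g \<in> A}"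
proof (rule vec.subspaceI)
  fix u v :: vec
  assume *: "u \<in> {v. \<forall>g. v g \<noteq> 0 \<longrightarrow> g \<in> A}" "v \<in> {v. \<forall>g. v g \<noteq> 0 \<longrightarrow> g \<in> A}"
  have nz: "u g \<noteq> 0 \<or> v g \<noteq> 0" if "(u + v) g \<noteq> 0" for g using that by auto
  show "u + v \<in> {v. \<forall>g. v g \<noteq> 0 \<longrightarrow> g \<in> A}" using * nz by blast
qed auto

lemma span_units_eq:
  assumes "finite A"
  shows "vec.span (unit_vec ` A) = {v. \<forall>g. v g \<noteq> 0 \<longrightarrow> g \<in> A}"
proof
  show "vec.span (unit_vec ` A) \<subseteq> {v. \<forall>g. v g \<noteq> 0 \<longrightarrow> g \<in> A}"
    by (rule vec.span_minimal[OF _ subspace_supported]) (auto simp: unit_vec_def split: if_splits)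
  show "{v. \<forall>g. v g \<noteq> 0 \<longrightarrow> g \<in> A} \<subseteq> vec.span (unit_vec ` A)"
    using span_units[OF assms] by blast
qed

lemma G_simps [simp]:
  "smult (G n \<beta> \<gamma>) = vscale"
  "part (G n \<beta> \<gamma>) \<alpha> = {v. \<forall>g. v g \<noteq> 0 \<longrightarrow> g \<in> nil_basis n \<and> gen_degree g = \<alpha>}"
  by (simp_all add: G_def)

lemma G_chain_tail_odd:
  "chain_tail (G n \<beta> \<gamma>) (G_chain n) 0 = {v. \<forall>g. v g \<noteq> 0 \<longrightarrow> g \<in> Y ` {1..n - 1}}"
proof -
  have "vec.span {G_chain n (0 + 2 * j) |j. True} = vec.span (unit_vec ` Y ` {1..n - 1})"
  proof (intro equalityI vec.span_minimal vec.subspace_span)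
    show "{G_chain n (0 + 2 * j) |j. True} \<subseteq> vec.span (unit_vec ` Y ` {1..n - 1})"
    proof clarify
      fix j
      show "G_chain n (0 + 2 * j) \<in> vec.span (unit_vec ` Y ` {1..n - 1})"
        unfolding add_0 G_chain_even y_vec_def
        by (rule vec.span_scale) (auto intro: vec.span_base vec.span_zero)
    qed
    show "unit_vec ` Y ` {1..n - 1} \<subseteq> vec.span {G_chain n (0 + 2 * j) |j. True}"
    proof clarify
      fix i assume i: "i \<in> {1..n - 1}"
      then have "unit_vec (Y i) = 2 ^ (i - 1) \<odot> G_chain n (0 + 2 * (i - 1))"
        unfolding add_0 G_chain_even by (auto simp: y_vec_def fun_eq_iff)
      then show "unit_vec (Y i) \<in> vec.span {G_chain n (0 + 2 * j) |j. True}"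
        by (simp only:) (intro vec.span_scale vec.span_base, blast)
    qed
  qed
  then show ?thesis unfolding chain_tail_def G_simps(1) by (simp add: span_units_eq)
qed

lemma G_chain_tail_even:
  "chain_tail (G n \<beta> \<gamma>) (G_chain n) 1 = {v. \<forall>g. v g \<noteq> 0 \<longrightarrow> g \<in> E ` ({1..n} - {2})}"
proof -
  have "vec.span {G_chain n (1 + 2 * j) |j. True} = vec.span (unit_vec ` E ` ({1..n} - {2}))"
  proof (intro equalityI vec.span_minimal vec.subspace_span)
    show "{G_chain n (1 + 2 * j) |j. True} \<subseteq> vec.span (unit_vec ` E ` ({1..n} - {2}))"
    proof clarify
      fix j
      show "G_chain n (1 + 2 * j) \<in> vec.span (unit_vec ` E ` ({1..n} - {2}))"
        unfolding add.commute[of 1] G_chain_odd e_vec_def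
        by (rule vec.span_scale) (auto intro: vec.span_base vec.span_zero)
    qed
    show "unit_vec ` E ` ({1..n} - {2}) \<subseteq> vec.span {G_chain n (1 + 2 * j) |j. True}"
    proof
      fix v assume "v \<in> unit_vec ` E ` ({1..n} - {2})"
      then obtain i where i: "i \<in> {1..n}" "i \<noteq> 2" and v: "v = unit_vec (E i)" by blast
      define j where "j = (if i = 1 then 0 else i - 2)"
      have "i = (if j = 0 then 1 else j + 2)" using i by (auto simp: j_def)
      then have "e_vec n (if j = 0 then 1 else j + 2) = unit_vec (E i)" using i e_vec_unit by simp
      then have "unit_vec (E i) = 2 ^ j \<odot> G_chain n (1 + 2 * j)"
        unfolding add.commute[of 1] G_chain_odd by (simp add: fun_eq_iff)
      then show "v \<in> vec.span {G_chain n (1 + 2 * j) |j. True}"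
        unfolding v by (simp only:) (intro vec.span_scale vec.span_base, blast)
    qed
  qed
  then show ?thesis unfolding chain_tail_def G_simps(1) by (simp add: span_units_eq)
qed

text \<open>The element \<open>[c\<^sub>0, e\<^sub>2]\<close> is the combination of the \<open>y\<^sub>k\<^sub>-\<^sub>1\<close> with coefficients \<open>\<beta>\<^sub>k\<close>, \<open>k \<ge> 4\<close>, and \<open>y\<^sub>k\<^sub>-\<^sub>1\<close> is
  proportional to \<open>c\<^sub>2\<^sub>k\<^sub>-\<^sub>4\<close>; this places it in the tail from 4 on.\<close>

lemma chain_basis_G:
  assumes n: "n \<ge> 3" and ns: "non_split n \<beta> \<gamma>"
  shows "chain_basis (G n \<beta> \<gamma>) n (G_chain n) (unit_vec (E 2))"
proof -
  let ?A = "G n \<beta> \<gamma>" and ?c = "G_chain n" and ?f = "unit_vec (E 2)"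
  let ?m = "\<lambda>g h. base_table n g h + G_table n \<beta> \<gamma> g h"
  have fin: "finite (nil_basis n)" by (simp add: nil_basis_def)
  have unit: "bracket ?A (unit_vec g) (unit_vec h) = ?m g h" if "g \<in> nil_basis n" "h \<in> nil_basis n" for g h
    unfolding G_def by (rule table_bracket_unit[OF fin that])
  have scale: "bracket ?A (s \<odot> u) v = s \<odot> bracket ?A u v" for s u v
    unfolding G_def by (rule table_bracket_scale)
  have Y1: "Y 1 \<in> nil_basis n" and E2: "E 2 \<in> nil_basis n" using n by (auto simp: nil_basis_def)
  have c0: "?c 0 = unit_vec (Y 1)"
  proof -
    have "1 \<le> n - 1" using n by linarith
    then have "y_vec n 1 = unit_vec (Y 1)" using y_vec_unit[of 1 n] by blast
    then show ?thesis using G_chain_even[of n 0] by (simp add: vscale_def)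
  qed
  have zero: "bracket ?A 0 v = 0" for v using scale[of 0 0 v] by (simp only: vec.scale_zero_left)
  have yy: "bracket ?A (y_vec n (j + 1)) (unit_vec (Y 1)) = e_vec n (if j = 0 then 1 else j + 2)" for j
  proof (cases "j + 1 \<le> n - 1")
    case True
    then have "Y (j + 1) \<in> nil_basis n" by (simp add: nil_basis_def)
    then show ?thesis using True unit[OF _ Y1] by (simp add: y_vec_def)
  next
    case False
    then have "0 < j" "\<not> j + 2 \<le> n" using n by auto
    then show ?thesis using False by (simp add: y_vec_def e_vec_def zero)
  qed
  have ey: "bracket ?A (e_vec n (if j = 0 then 1 else j + 2)) (unit_vec (Y 1)) = (1/2) \<odot> y_vec n (j + 2)" for j
  proof (cases "j + 2 \<le> n")
    case True
    then have "E (if j = 0 then 1 else j + 2) \<in> nil_basis n" by (auto simp: nil_basis_def)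
    then show ?thesis using True unit[OF _ Y1] n by (auto simp: e_vec_def y_vec_def vscale_def numeral_2_eq_2)
  next
    case False
    then show ?thesis using n by (auto simp: y_vec_def e_vec_def zero vscale_def)
  qed
  have rec: "?c (Suc k) = bracket ?A (?c k) (?c 0)" for k
  proof (cases "even k")
    case True
    then obtain j where k: "k = 2 * j" by blast
    show ?thesis unfolding c0 k G_chain_even scale yy using G_chain_odd[of n j] by simp
  next
    case False
    then obtain j where k: "k = 2 * j + 1" by (rule oddE)
    have "?c (2 * (j + 1)) = bracket ?A (?c (2 * j + 1)) (unit_vec (Y 1))"
      unfolding G_chain_odd G_chain_even scale ey by (simp add: vscale_def mult.commute)
    then show ?thesis unfolding c0 k by simp
  qed
  have last: "?c (2 * n - 3) = (1 / 2 ^ (n - 2)) \<odot> unit_vec (E n)"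
  proof -
    have eq: "2 * n - 3 = 2 * (n - 2) + 1" "n - 2 \<noteq> 0" "n - 2 + 2 = n" using n by auto
    have "e_vec n n = unit_vec (E n)" using n by (intro e_vec_unit) auto
    then show ?thesis unfolding eq(1) G_chain_odd by (simp only: eq(2,3) if_False)
  qed
  have beyond: "?c (2 * n - 2) = 0"
  proof -
    have eq: "2 * n - 2 = 2 * (n - 1)" "\<not> n - 1 + 1 \<le> n - 1" using n by linarith+
    show ?thesis unfolding eq(1) G_chain_even y_vec_def by (simp only: eq(2) simp_thms if_False vec.scale_zero_right)
  qed
  have c0f: "bracket ?A (?c 0) ?f = (\<Sum>k = 4..n. \<beta> k \<odot> y_vec n (k - 1))"
    unfolding c0 unit[OF Y1 E2] using n by auto
  have ff: "bracket ?A ?f ?f = \<gamma> \<odot> unit_vec (E n)"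
    unfolding unit[OF E2 E2] using n by (simp add: e_vec_def)
  have in_tail: "y_vec n (k - 1) \<in> chain_tail ?A ?c 4" if "k \<in> {4..n}" for k
  proof -
    have k: "k - 2 + 1 = k - 1" "2 * (k - 2) = 4 + 2 * (k - 4)" using that by auto
    have "y_vec n (k - 1) = 2 ^ (k - 2) \<odot> ?c (2 * (k - 2))"
      unfolding G_chain_even k(1) by (simp add: vscale_def)
    also have "\<dots> \<in> chain_tail ?A ?c 4"
      unfolding k(2) chain_tail_def G_simps(1) by (intro vec.span_scale vec.span_base) blast
    finally show ?thesis .
  qed
  have "bracket ?A (?c 0) ?f \<noteq> 0 \<or> bracket ?A ?f ?f \<noteq> 0"
  proof (cases "\<gamma> = 0")
    case True
    then obtain k where k: "k \<in> {4..n}" "\<beta> k \<noteq> 0" using ns by (auto simp: non_split_def)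
    have "bracket ?A (?c 0) ?f (Y (k - 1)) = (\<Sum>i = 4..n. if i = k then \<beta> k else 0)"
      unfolding c0f sum_apply using k(1)
      by (intro sum.cong refl) (auto simp: y_vec_def unit_vec_def)
    also have "\<dots> = \<beta> k" using k(1) by simp
    finally show ?thesis using k(2) by auto
  next
    case False
    then have "bracket ?A ?f ?f (E n) \<noteq> 0" unfolding ff by (simp add: unit_vec_def)
    then show ?thesis by auto
  qed
  moreover have "part ?A 0 = {smult ?A s ?f + v |s v. v \<in> chain_tail ?A ?c 1}"
  proof (intro equalityI subsetI)
    fix v assume v: "v \<in> part ?A 0"
    have "v = v (E 2) \<odot> ?f + (v - v (E 2) \<odot> ?f)" by simp
    moreover have "v - v (E 2) \<odot> ?f \<in> chain_tail ?A ?c 1"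
      using v unfolding G_chain_tail_even by (auto simp: nil_basis_def unit_vec_def split: if_splits)
    ultimately show "v \<in> {smult ?A s ?f + v |s v. v \<in> chain_tail ?A ?c 1}"
      unfolding G_simps(1) by blast
  next
    fix v assume "v \<in> {smult ?A s ?f + v |s v. v \<in> chain_tail ?A ?c 1}"
    then obtain s w where w: "v = s \<odot> ?f + w" "\<forall>g. w g \<noteq> 0 \<longrightarrow> g \<in> E ` ({1..n} - {2})"
      unfolding G_chain_tail_even by auto
    show "v \<in> part ?A 0"
      unfolding G_simps(2)
    proof (intro CollectI allI impI)
      fix g assume "v g \<noteq> 0"
      then have "g = E 2 \<or> w g \<noteq> 0" by (auto simp: w(1) unit_vec_def split: if_splits)
      then show "g \<in> nil_basis n \<and> gen_degree g = 0" using w(2) E2 by (auto simp: nil_basis_def)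
    qed
  qed
  moreover have "?f \<notin> chain_tail ?A ?c 1" unfolding G_chain_tail_even by (auto simp: unit_vec_def)
  moreover have "part ?A 1 = chain_tail ?A ?c 0"
    unfolding G_chain_tail_odd by (auto simp: nil_basis_def)
  moreover have "?c (2 * n - 3) \<noteq> 0"
  proof
    assume "?c (2 * n - 3) = 0"
    then have "?c (2 * n - 3) (E n) = 0" by simp
    then show False unfolding last by (simp add: unit_vec_def)
  qed
  moreover have "bracket ?A ?f (?c 0) = 0"
    unfolding c0 unit[OF E2 Y1] by simp
  moreover have "bracket ?A (?c 0) ?f \<in> chain_tail ?A ?c 4"
    unfolding c0f using in_tail unfolding chain_tail_def G_simps(1)
    by (intro vec.span_sum vec.span_scale)
  moreover have "\<exists>\<gamma>'. bracket ?A ?f ?f = smult ?A \<gamma>' (?c (2 * n - 3))"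
    by (rule exI[of _ "\<gamma> * 2 ^ (n - 2)"]) (simp add: ff last vscale_def)
  ultimately show ?thesis unfolding chain_basis_def using rec beyond by blast
qed

lemma chain_basis_transfer:
  fixes A :: "'a::ab_group_add superalg" and B :: "'b::ab_group_add superalg"
  assumes A: "vector_space (smult A)" "\<And>\<alpha>. module.subspace (smult A) (part A \<alpha>)"
    and B: "vector_space (smult B)"
    and iso: "isomorphic A B" and chain: "chain_basis A n c f"
  shows "\<exists>c' f'. chain_basis B n c' f'"
proof -
  interpret A: vector_space "smult A" by (rule A(1))
  interpret B: vector_space "smult B" by (rule B)
  obtain h where h': "bij_betw h (carrier A) (carrier B)"
    "\<forall>u\<in>carrier A. \<forall>v\<in>carrier A. h (u + v) = h u + h v"
    "\<forall>c. \<forall>u\<in>carrier A. h (smult A c u) = smult B c (h u)"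
    "\<forall>\<alpha>. h ` part A \<alpha> = part B \<alpha>"
    "\<forall>u\<in>carrier A. \<forall>v\<in>carrier A. h (bracket A u v) = bracket B (h u) (h v)"
    using iso unfolding isomorphic_def by (elim exE conjE) (rule that)
  note h = h'(1) bspec[OF bspec[OF h'(2)]] bspec[OF spec[OF h'(3)]] spec[OF h'(4)]
    bspec[OF bspec[OF h'(5)]]
  have subC: "A.subspace (carrier A)"
    unfolding carrier_def using A.subspace_sums[OF A(2) A(2), of 0 1] by simp
  have partC: "u \<in> carrier A" if "u \<in> part A \<alpha>" for u \<alpha>
  proof -
    have "u = u + 0" "u = 0 + u" by auto
    then show ?thesis
      using that bit_cases[of \<alpha>] A.subspace_0[OF A(2)] unfolding carrier_def by blast
  qed
  note ch = chain[unfolded chain_basis_def]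
  have tails: "chain_tail A c 0 = part A 1" "chain_tail A c 1 \<subseteq> part A 0"
  proof -
    show "chain_tail A c 0 = part A 1" using ch by (elim conjE) (rule sym)
    show "chain_tail A c 1 \<subseteq> part A 0"
    proof
      fix v assume "v \<in> chain_tail A c 1"
      moreover have "v = smult A 0 f + v" by simp
      ultimately have "v \<in> {smult A s f + v |s v. v \<in> chain_tail A c 1}" by blast
      then show "v \<in> part A 0" using ch by (elim conjE) (simp only:)
    qed
  qed
  have cC: "c k \<in> carrier A" for k
  proof (cases "even k")
    case True
    then obtain j where "k = 0 + 2 * j" by auto
    then have "c k \<in> chain_tail A c 0" unfolding chain_tail_def by (intro A.span_base) blast
    then show ?thesis using tails(1) partC by blast
  next
    case False
    then obtain j where "k = 2 * j + 1" by (rule oddE)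
    then have "k = 1 + 2 * j" by simp
    then have "c k \<in> chain_tail A c 1" unfolding chain_tail_def by (intro A.span_base) blast
    then show ?thesis using tails(2) partC by blast
  qed
  have tailC: "chain_tail A c k \<subseteq> carrier A" for k
    unfolding chain_tail_def using cC by (intro A.span_minimal subC) auto
  have fpart: "f \<in> part A 0"
  proof -
    have "f = smult A 1 f + 0" by simp
    moreover have "0 \<in> chain_tail A c 1" unfolding chain_tail_def by (rule A.span_zero)
    ultimately have "f \<in> {smult A s f + v |s v. v \<in> chain_tail A c 1}" by blast
    then show ?thesis using ch by (elim conjE) (simp only:)
  qed
  then have fC: "f \<in> carrier A" by (rule partC)
  have h0: "h 0 = 0" using h(3)[of 0 0] A.subspace_0[OF subC] by simp
  have inj: "h u = 0 \<Longrightarrow> u \<in> carrier A \<Longrightarrow> u = 0" for u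
    using h(1) h0 A.subspace_0[OF subC] unfolding bij_betw_def inj_on_def by metis
  have tail_img: "h ` chain_tail A c k = chain_tail B (h \<circ> c) k" for k
  proof
    have "chain_tail A c k \<subseteq> {v \<in> carrier A. h v \<in> chain_tail B (h \<circ> c) k}"
      unfolding chain_tail_def
    proof (rule A.span_minimal)
      show "{c (k + 2 * j) |j. True} \<subseteq>
        {v \<in> carrier A. h v \<in> B.span {(h \<circ> c) (k + 2 * j) |j. True}}"
        using cC by (auto intro!: B.span_base)
      show "A.subspace {v \<in> carrier A. h v \<in> B.span {(h \<circ> c) (k + 2 * j) |j. True}}"
        using A.subspace_0[OF subC] A.subspace_add[OF subC] A.subspace_scale[OF subC]
        by (intro A.subspaceI) (simp_all add: h0 h B.span_zero B.span_add B.span_scale)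
    qed
    then show "h ` chain_tail A c k \<subseteq> chain_tail B (h \<circ> c) k" by blast
    show "chain_tail B (h \<circ> c) k \<subseteq> h ` chain_tail A c k"
      unfolding chain_tail_def[of B]
    proof (rule B.span_minimal)
      show "{(h \<circ> c) (k + 2 * j) |j. True} \<subseteq> h ` chain_tail A c k"
        unfolding chain_tail_def by (auto intro!: imageI A.span_base)
      show "B.subspace (h ` chain_tail A c k)"
      proof (rule B.subspaceI)
        show "0 \<in> h ` chain_tail A c k"
          by (rule image_eqI[where x = 0]) (simp_all add: h0 chain_tail_def A.span_zero)
      next
        fix x y assume "x \<in> h ` chain_tail A c k" "y \<in> h ` chain_tail A c k"
        then obtain u v where uv: "u \<in> chain_tail A c k" "v \<in> chain_tail A c k" "x = h u" "y = h v"
          by blast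
        have "x + y = h (u + v)" using uv tailC by (simp add: h(2) subset_iff)
        moreover have "u + v \<in> chain_tail A c k"
          using uv(1,2) unfolding chain_tail_def by (rule A.span_add)
        ultimately show "x + y \<in> h ` chain_tail A c k" by blast
      next
        fix s x assume "x \<in> h ` chain_tail A c k"
        then obtain u where u: "u \<in> chain_tail A c k" "x = h u" by blast
        have "smult B s x = h (smult A s u)" using u tailC by (simp add: h(3) subset_iff)
        moreover have "smult A s u \<in> chain_tail A c k"
          using u(1) unfolding chain_tail_def by (rule A.span_scale)
        ultimately show "smult B s x \<in> h ` chain_tail A c k" by blast
      qed
    qed
  qed
  have c0f: "bracket A (c 0) f \<in> carrier A" using ch tailC by blast
  obtain \<gamma> where \<gamma>: "bracket A f f = smult A \<gamma> (c (2 * n - 3))" using ch by blast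
  have ffC: "bracket A f f \<in> carrier A" unfolding \<gamma> by (rule A.subspace_scale[OF subC cC])
  have "chain_basis B n (h \<circ> c) (h f)"
    unfolding chain_basis_def
  proof (intro conjI)
    show "\<forall>k. (h \<circ> c) (Suc k) = bracket B ((h \<circ> c) k) ((h \<circ> c) 0)"
    proof
      fix k
      have "c (Suc k) = bracket A (c k) (c 0)" using ch by (elim conjE) (rule spec)
      then show "(h \<circ> c) (Suc k) = bracket B ((h \<circ> c) k) ((h \<circ> c) 0)"
        using h(5)[OF cC cC] by simp
    qed
    have "c (2 * n - 3) \<noteq> 0" "c (2 * n - 2) = 0" using ch by blast+
    then show "(h \<circ> c) (2 * n - 3) \<noteq> 0" "(h \<circ> c) (2 * n - 2) = 0"
      using inj[OF _ cC] h0 by auto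
    show "part B 1 = chain_tail B (h \<circ> c) 0"
      using h(4)[of 1] tails(1) tail_img[of 0] by simp
    have "part A 0 = {smult A s f + v |s v. v \<in> chain_tail A c 1}"
      using ch by (elim conjE)
    then have "part B 0 = h ` {smult A s f + v |s v. v \<in> chain_tail A c 1}" using h(4)[of 0] by simp
    also have "\<dots> = {smult B s (h f) + v |s v. v \<in> h ` chain_tail A c 1}"
    proof -
      have "h (smult A s f + v) = smult B s (h f) + h v" if "v \<in> chain_tail A c 1" for s v
        using h(2)[OF A.subspace_scale[OF subC fC]] that tailC h(3)[OF fC] by (auto simp: subset_iff)
      then show ?thesis by (auto simp: image_iff) metis+
    qed
    finally show "part B 0 = {smult B s (h f) + v |s v. v \<in> chain_tail B (h \<circ> c) 1}"
      unfolding tail_img .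
    have "f \<notin> chain_tail A c 1" using ch by (elim conjE)
    then show "h f \<notin> chain_tail B (h \<circ> c) 1"
      unfolding tail_img[symmetric] using h(1) fC tailC[of 1] unfolding bij_betw_def
      by (metis inj_on_image_mem_iff)
    have "bracket A f (c 0) = 0" using ch by (elim conjE)
    then show "bracket B (h f) ((h \<circ> c) 0) = 0" using h(5)[OF fC cC, of 0] h0 by simp
    have "bracket A (c 0) f \<in> chain_tail A c 4" using ch by (elim conjE)
    then show "bracket B ((h \<circ> c) 0) (h f) \<in> chain_tail B (h \<circ> c) 4"
      unfolding tail_img[symmetric] using h(5)[OF cC fC] by (metis comp_apply imageI)
    show "\<exists>\<gamma>. bracket B (h f) (h f) = smult B \<gamma> ((h \<circ> c) (2 * n - 3))"
      using h(5)[OF fC fC] h(3)[OF cC] \<gamma> by (metis comp_apply)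
    have "bracket A (c 0) f \<noteq> 0 \<or> bracket A f f \<noteq> 0" using ch by (elim conjE)
    then show "bracket B ((h \<circ> c) 0) (h f) \<noteq> 0 \<or> bracket B (h f) (h f) \<noteq> 0"
      using h(5)[OF cC fC] h(5)[OF fC fC] inj[OF _ c0f] inj[OF _ ffC] by (metis comp_apply)
  qed
  then show ?thesis by blast
qed

lemma (in leibniz_superalg) exists_isomorphic_SG:
  assumes n: "n \<ge> 3" and nn: "\<not> nilpotent L" and N: "is_nilradical L N"
    and ns: "non_split n \<beta> \<gamma>" and iso: "isomorphic (restrict_to L N) (G n \<beta> \<gamma>)"
  shows "\<exists>l\<in>labels n. isomorphic L (SG n l)"
proof -
  note idN = nilradicalD(1)[OF N]
  let ?R = "restrict_to L N"
  have R: "smult ?R = smult L" "bracket ?R = bracket L" "carrier ?R = N"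
    by (simp_all add: restrict_to_def carrier_restrict[OF idN, unfolded restrict_to_def])
  have "isomorphic (G n \<beta> \<gamma>) ?R"
  proof (rule isomorphic_sym[OF iso])
    show "u + v \<in> carrier ?R" if "u \<in> carrier ?R" "v \<in> carrier ?R" for u v
      using that unfolding R by (rule vs.subspace_add[OF subspace_ideal[OF idN]])
    show "smult ?R s u \<in> carrier ?R" if "u \<in> carrier ?R" for s u
      using that unfolding R by (rule vs.subspace_scale[OF subspace_ideal[OF idN]])
    show "bracket ?R u v \<in> carrier ?R" if "u \<in> carrier ?R" "v \<in> carrier ?R" for u v
      using that subsetD[OF ideal_subset[OF idN] that(2)[unfolded R]] unfolding R
      by (intro ideal_mult(1)[OF idN])
    show "part ?R \<alpha> \<subseteq> carrier ?R" for \<alpha>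
      unfolding R by (simp add: restrict_to_def)
  qed
  moreover have "vec.subspace (part (G n \<beta> \<gamma>) \<alpha>)" for \<alpha>
    using subspace_supported[of "{g \<in> nil_basis n. gen_degree g = \<alpha>}"] by simp
  ultimately obtain c f where chain: "chain_basis ?R n c f"
    using chain_basis_transfer[of "G n \<beta> \<gamma>" ?R n, OF _ _ _ _ chain_basis_G[OF n ns]]
    by (auto simp: vector_space_vscale R(1) vs.vector_space_axioms)
  interpret C: leibniz_chain L N n c f
    using n idN nilradicalD(3)[OF N] odd_in_nilradical[OF N] chain
    by unfold_locales auto
  obtain c f x \<delta> where "leibniz_chain L N n c f" and ad: "leibniz_chain.adapted L N c f x \<delta>"
    using C.exists_adapted[OF N nn] by blast
  then interpret D: leibniz_chain L N n c f by blast
  have xp: "x \<in> part L 0" "c 0 \<cdot> x = c 0" "f \<cdot> x = \<delta> *s f" "x \<cdot> x = 0"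
    using ad by (simp_all add: D.adapted_def)
  have xC: "x \<in> carrier L" using xp(1) by (rule part_carrier)
  have fx0: "f \<cdot> x = \<delta> *s f + 0 *s c (2 * n - 3)" using xp(3) by simp
  obtain \<gamma>0 where \<gamma>0: "f \<cdot> f = \<gamma>0 *s c (2 * n - 3)" using D.f_mult_f by blast
  have rescale: "leibniz_chain L N n c (a *s f)" "leibniz_chain.adapted L N c (a *s f) x \<delta>"
    if "a \<noteq> 0" for a
  proof -
    show *: "leibniz_chain L N n c (a *s f)" using D.change_f[OF that, of 0] by simp
    show "leibniz_chain.adapted L N c (a *s f) x \<delta>"
      using ad xC unfolding D.adapted_def leibniz_chain.adapted_def[OF *]
      by (simp add: mult_scale mult.commute)
  qed
  show ?thesis
  proof (cases "c 0 \<cdot> f = 0")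
    case True
    then have ff: "f \<cdot> f \<noteq> 0" using D.nonsplit by simp
    then have "\<gamma>0 \<noteq> 0" using \<gamma>0 by auto
    \<comment> \<open>Rescaling \<open>f\<close> by \<open>a\<close> turns \<open>[f, f]\<close> into \<open>2\<^sup>n\<^sup>-\<^sup>2 c\<^sub>2\<^sub>n\<^sub>-\<^sub>3\<close>, which is \<open>e\<^sub>n\<close>.\<close>
    define a where "a = csqrt (2 ^ (n - 2) / \<gamma>0)"
    have a2: "a * a * \<gamma>0 = 2 ^ (n - 2)"
      using \<open>\<gamma>0 \<noteq> 0\<close> by (simp add: a_def power2_eq_square[symmetric])
    then have "a \<noteq> 0" by auto
    note r = rescale[OF this]
    interpret F: leibniz_chain L N n c "a *s f" by (rule r(1))
    have fx: "(a *s f) \<cdot> x = \<delta> *s a *s f" using r(2) by (simp add: F.adapted_def)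
    have cf: "c 0 \<cdot> (a *s f) = 0" using True by (simp add: mult_scale)
    have \<delta>: "\<delta> = of_nat (n - 1)" by (rule D.eigenvalue_f(2)[OF xp(1,2) fx0 ff])
    have "isomorphic L (normal_algebra n 4 0 1 \<delta>)"
    proof (rule F.isomorphic_normal_algebra[OF r(2)])
      show "x \<cdot> c 0 = - c 0" by (rule F.left_action_of_x(1)[OF xp(1,2) fx xp(4)])
      show "c 0 \<cdot> (a *s f) = (0 * 2 ^ (4 - 2)) *s c (2 * (4 - 2))" using cf by simp
      show "(a *s f) \<cdot> (a *s f) = (1 * 2 ^ (n - 2)) *s c (2 * n - 3)"
        using a2 by (simp add: mult_scale \<gamma>0 mult.assoc)
      show "x \<cdot> (a *s f) = - (\<delta> *s a *s f) - (0 * 2 ^ (4 - 2)) *s c (2 * (4 - 2) - 1)"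
        using F.left_action_of_x(2)[OF xp(1,2) fx xp(4) cf] by simp
    qed simp
    then have "isomorphic L (SG n SG3)" unfolding \<delta> SG3_normal[OF n] .
    then show ?thesis by (intro bexI[of _ SG3]) (auto simp: labels_def)
  next
    case False
    obtain j \<beta>0 where j: "c 0 \<cdot> f = \<beta>0 *s c (2 * j)" "\<beta>0 \<noteq> 0" "2 \<le> j" "j < n - 1" "\<delta> = of_nat (2 * j)"
      using D.eigenvalue_f(1)[OF xp(1,2) fx0 False] by blast
    \<comment> \<open>Rescaling \<open>f\<close> by \<open>a\<close> turns \<open>[c\<^sub>0, f]\<close> into \<open>2\<^sup>j c\<^sub>2\<^sub>j\<close>, which is \<open>y\<^sub>j\<^sub>+\<^sub>1\<close>, so \<open>t = j + 2\<close>.\<close>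
    define a where "a = 2 ^ j / \<beta>0"
    have a: "a \<noteq> 0" "a * \<beta>0 = 2 ^ j" using j(2) by (simp_all add: a_def)
    note r = rescale[OF a(1)]
    interpret F: leibniz_chain L N n c "a *s f" by (rule r(1))
    have fx: "(a *s f) \<cdot> x = \<delta> *s a *s f" using r(2) by (simp add: F.adapted_def)
    have cf: "c 0 \<cdot> (a *s f) = 2 ^ j *s c (2 * j)" using a(2) by (simp add: mult_scale j(1))
    define \<gamma>1 where "\<gamma>1 = a * a * \<gamma>0 / 2 ^ (n - 2)"
    have iso1: "isomorphic L (normal_algebra n (j + 2) 1 \<gamma>1 \<delta>)"
    proof (rule F.isomorphic_normal_algebra[OF r(2)])
      show "x \<cdot> c 0 = - c 0" by (rule F.left_action_of_x(1)[OF xp(1,2) fx xp(4)])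
      show "c 0 \<cdot> (a *s f) = (1 * 2 ^ (j + 2 - 2)) *s c (2 * (j + 2 - 2))" using cf by simp
      show "(a *s f) \<cdot> (a *s f) = (\<gamma>1 * 2 ^ (n - 2)) *s c (2 * n - 3)"
        by (simp add: mult_scale \<gamma>0 \<gamma>1_def mult.assoc)
      show "x \<cdot> (a *s f) = - (\<delta> *s a *s f) - (1 * 2 ^ (j + 2 - 2)) *s c (2 * (j + 2 - 2) - 1)"
        using F.left_action_of_x(3)[OF xp(1,2) fx xp(4) cf _ j(3,4)] by simp
    qed (use j(3) in simp)
    show ?thesis
    proof (cases "f \<cdot> f = 0")
      case True
      then have "\<gamma>0 = 0" using \<gamma>0 D.c_last by simp
      then have "\<gamma>1 = 0" by (simp add: \<gamma>1_def)
      have "4 \<le> j + 2" "j + 2 \<le> n" using j(3,4) by auto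
      then have "isomorphic L (SG n (SG1 (j + 2)))"
        using iso1 SG1_normal[of "j + 2" n] \<open>\<gamma>1 = 0\<close> j(5) by simp
      then show ?thesis
        using \<open>4 \<le> j + 2\<close> \<open>j + 2 \<le> n\<close> by (intro bexI[of _ "SG1 (j + 2)"]) (auto simp: labels_def)
    next
      case False
      then have "\<delta> = of_nat (n - 1)" by (rule D.eigenvalue_f(2)[OF xp(1,2) fx0])
      then have nj: "n - 1 = 2 * j" using j(5) by (simp only: of_nat_eq_iff)
      then have n': "n = 2 * j + 1" using n by simp
      have "\<gamma>0 \<noteq> 0" using False \<gamma>0 by auto
      then have "\<gamma>1 \<noteq> 0" using a(1) by (simp add: \<gamma>1_def)
      have odd: "odd n" "n \<ge> 5" "(n + 3) div 2 = j + 2" using n' j(3) by auto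
      then have "isomorphic L (SG n (SG2 \<gamma>1))"
        using iso1 SG2_normal[of n \<gamma>1] \<open>\<delta> = of_nat (n - 1)\<close> by simp
      then show ?thesis
        using odd(1) \<open>\<gamma>1 \<noteq> 0\<close> by (intro bexI[of _ "SG2 \<gamma>1"]) (auto simp: labels_def)
    qed
  qed
qed

section \<open>The listed algebras are pairwise non-isomorphic\<close>

definition SG_product :: "nat \<Rightarrow> label \<Rightarrow> gen \<Rightarrow> gen \<Rightarrow> vec" where
  "SG_product n l g h = base_table n g h + x_table n g h + label_table n l g h"

lemma SG_eq: "SG n l = table_algebra (insert X (nil_basis n)) (SG_product n l)"
  unfolding SG_def SG_product_def ..

lemma SG_simps [simp]:
  "smult (SG n l) = vscale"
  "part (SG n l) \<alpha> = {v. \<forall>g. v g \<noteq> 0 \<longrightarrow> g \<in> insert X (nil_basis n) \<and> gen_degree g = \<alpha>}"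
  "carrier (SG n l) = {v. \<forall>g. v g \<noteq> 0 \<longrightarrow> g \<in> insert X (nil_basis n)}"
  by (simp_all only: SG_eq table_algebra_simps carrier_table_algebra)

text \<open>The numbers \<open>t\<close>, \<open>\<beta>\<close>, \<open>\<gamma>\<close> with \<open>[e\<^sub>1, e\<^sub>2] = \<beta> e\<^sub>t\<close> and \<open>[e\<^sub>2, e\<^sub>2] = \<gamma> e\<^sub>n\<close>. For \<open>SG3\<close>, where
  \<open>\<beta> = 0\<close>, \<open>t\<close> gets the default value 3, which satisfies the bounds of the other cases.\<close>

fun label_t :: "nat \<Rightarrow> label \<Rightarrow> nat" where
  "label_t n (SG1 t) = t" | "label_t n (SG2 \<gamma>) = (n + 3) div 2" | "label_t n SG3 = 3"

fun label_\<beta> :: "label \<Rightarrow> complex" where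
  "label_\<beta> (SG1 t) = 1" | "label_\<beta> (SG2 \<gamma>) = 1" | "label_\<beta> SG3 = 0"

fun label_\<gamma> :: "label \<Rightarrow> complex" where
  "label_\<gamma> (SG1 t) = 0" | "label_\<gamma> (SG2 \<gamma>) = \<gamma>" | "label_\<gamma> SG3 = 1"

lemma label_t_bounds:
  assumes "n \<ge> 3" "l \<in> labels n"
  shows "3 \<le> label_t n l" "label_t n l \<le> n"
  using assms by (cases l; auto simp: labels_def)+

lemma product_Y1: "SG_product n l g (Y 1) = base_table n g (Y 1) + x_table n g (Y 1)"
  unfolding SG_product_def by (cases l; cases g) simp_all

lemma product_Y_ge_2: "j \<noteq> 1 \<Longrightarrow> SG_product n l g (Y j) = 0"
  unfolding SG_product_def by (cases l; cases g) simp_all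

lemma product_E_ge_3: "3 \<le> j \<Longrightarrow> SG_product n l g (E j) = 0"
  unfolding SG_product_def by (cases l; cases g) simp_all

lemma product_E2:
  assumes n: "n \<ge> 3" and l: "l \<in> labels n"
  shows "SG_product n l (E 1) (E 2) = label_\<beta> l \<odot> e_vec n (label_t n l)"
    and "3 \<le> i \<Longrightarrow> SG_product n l (E i) (E 2) = label_\<beta> l \<odot> e_vec n (i + label_t n l - 2)"
    and "SG_product n l (E 2) (E 2) = label_\<gamma> l \<odot> e_vec n n"
proof -
  show "SG_product n l (E 1) (E 2) = label_\<beta> l \<odot> e_vec n (label_t n l)"
    unfolding SG_product_def by (cases l) simp_all
  show "SG_product n l (E 2) (E 2) = label_\<gamma> l \<odot> e_vec n n"
    unfolding SG_product_def by (cases l) simp_all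
  assume i: "3 \<le> i"
  show "SG_product n l (E i) (E 2) = label_\<beta> l \<odot> e_vec n (i + label_t n l - 2)"
  proof (cases l)
    case (SG1 t)
    then have "4 \<le> t" using l by (auto simp: labels_def)
    then show ?thesis using SG1 i unfolding SG_product_def by (auto simp: e_vec_def)
  next
    case (SG2 \<gamma>)
    then have "odd n" using l by (auto simp: labels_def)
    then obtain k where k: "n = 2 * k + 1" by (rule oddE)
    have d: "(2 * k + 1 + 3) div 2 = k + 2" "(2 * k + 1 - 1) div 2 = k" by auto
    show ?thesis using SG2 i n unfolding SG_product_def k by (auto simp: e_vec_def d)
  next
    case SG3
    then show ?thesis using i unfolding SG_product_def by simp
  qed
qed

lemma SG_mult_apply:
  "bracket (SG n l) u v k = (\<Sum>g\<in>insert X (nil_basis n). \<Sum>h\<in>insert X (nil_basis n). u g * v h * SG_product n l g h k)"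
  by (simp only: SG_eq table_algebra_simps) (simp add: sum_apply)

lemma finite_SG_basis: "finite (insert X (nil_basis n))"
  by (simp add: nil_basis_def)

lemma SG_mult_odd:
  assumes n: "n \<ge> 3" and v: "v \<in> part (SG n l) 1"
  shows "bracket (SG n l) u v k
    = v (Y 1) * (\<Sum>g\<in>insert X (nil_basis n). u g * SG_product n l g (Y 1) k)"
proof -
  have Y1: "Y 1 \<in> insert X (nil_basis n)" using n by (auto simp: nil_basis_def)
  have "(\<Sum>h\<in>insert X (nil_basis n). u g * v h * SG_product n l g h k)
      = u g * v (Y 1) * SG_product n l g (Y 1) k" for g
  proof -
    have "v h * SG_product n l g h k = 0" if "h \<noteq> Y 1" for h
    proof (cases h)
      case (Y j)
      then have "SG_product n l g h = 0" using that product_Y_ge_2[of j] by simp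
      then show ?thesis by simp
    qed (use v in \<open>auto simp: SG_simps\<close>)
    then have "(\<Sum>h\<in>insert X (nil_basis n). u g * v h * SG_product n l g h k)
      = (\<Sum>h\<in>insert X (nil_basis n). if h = Y 1 then u g * v (Y 1) * SG_product n l g (Y 1) k else 0)"
      by (intro sum.cong refl) (simp add: mult.assoc)
    also have "\<dots> = u g * v (Y 1) * SG_product n l g (Y 1) k"
      using Y1 finite_SG_basis by (simp only: sum.delta if_True)
    finally show ?thesis .
  qed
  then show ?thesis unfolding SG_mult_apply by (simp add: sum_distrib_left algebra_simps)
qed

lemma sum_single:
  assumes "finite S" "a \<in> S" "\<And>g. g \<in> S \<Longrightarrow> F g = (if g = a then r else 0)"
  shows "(\<Sum>g\<in>S. u g * F g) = u a * (r::complex)"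
proof -
  have "(\<Sum>g\<in>S. u g * F g) = (\<Sum>g\<in>S. if g = a then u a * r else 0)"
    by (intro sum.cong refl) (simp add: assms(3))
  then show ?thesis using assms by simp
qed

text \<open>Only \<open>y\<^sub>1\<close> among the odd basis vectors acts nontrivially from the right, and each of these coordinates
  receives a contribution from a single basis vector. All of this is read off the tables, so
  it includes \<open>SG2\<close> with \<open>n = 3\<close>, for which the Leibniz identity fails.\<close>

lemma SG_mult_odd_coords:
  assumes n: "n \<ge> 3" and v: "v \<in> part (SG n l) 1"
  shows "bracket (SG n l) u v (Y 1) = - u X * v (Y 1)"
    and "bracket (SG n l) u v (Y 2) = u (E 1) * v (Y 1) / 2"
    and "3 \<le> i \<Longrightarrow> i \<le> n - 1 \<Longrightarrow> bracket (SG n l) u v (Y i) = u (E i) * v (Y 1) / 2"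
    and "bracket (SG n l) u v (E 1) = u (Y 1) * v (Y 1)"
    and "2 \<le> j \<Longrightarrow> j \<le> n - 1 \<Longrightarrow> bracket (SG n l) u v (E (j + 1)) = u (Y j) * v (Y 1)"
    and "bracket (SG n l) u v (E 2) = 0"
    and "bracket (SG n l) u v X = 0"
proof -
  let ?S = "insert X (nil_basis n)"
  note entry = product_Y1 e_vec_def y_vec_def unit_vec_def
  have mem: "E i \<in> ?S" if "1 \<le> i" "i \<le> n" for i using that by (simp add: nil_basis_def)
  have memY: "Y i \<in> ?S" if "1 \<le> i" "i \<le> n - 1" for i using that by (auto simp: nil_basis_def)
  have single: "bracket (SG n l) u v k = u a * r * v (Y 1)"
    if "a \<in> ?S" "\<And>g. g \<in> ?S \<Longrightarrow> SG_product n l g (Y 1) k = (if g = a then r else 0)" for a k r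
    unfolding SG_mult_odd[OF n v] using sum_single[OF finite_SG_basis that] by simp
  have none: "bracket (SG n l) u v k = 0"
    if "\<And>g. g \<in> ?S \<Longrightarrow> SG_product n l g (Y 1) k = 0" for k
    unfolding SG_mult_odd[OF n v] using that by (simp add: sum.neutral)
  show "bracket (SG n l) u v (Y 1) = - u X * v (Y 1)"
  proof -
    have "bracket (SG n l) u v (Y 1) = u (X) * (- 1) * v (Y 1)"
    proof (rule single)
      show "X \<in> ?S" using mem[of 1] n by auto
      fix g assume "g \<in> ?S"
      then show "SG_product n l g (Y 1) (Y 1) = (if g = X then - 1 else 0)"
        using n by (cases rule: basis_cases) (auto simp: entry simp del: One_nat_def)
    qed
    then show ?thesis by simp
  qed
  show "bracket (SG n l) u v (Y 2) = u (E 1) * v (Y 1) / 2"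
  proof -
    have "bracket (SG n l) u v (Y 2) = u (E 1) * (1 / 2) * v (Y 1)"
    proof (rule single)
      show "E 1 \<in> ?S" using mem[of 1] n by auto
      fix g assume "g \<in> ?S"
      then show "SG_product n l g (Y 1) (Y 2) = (if g = E 1 then 1 / 2 else 0)"
        using n by (cases rule: basis_cases) (auto simp: entry simp del: One_nat_def)
    qed
    then show ?thesis by simp
  qed
  show "bracket (SG n l) u v (Y i) = u (E i) * v (Y 1) / 2" if "3 \<le> i" "i \<le> n - 1"
  proof -
    have "bracket (SG n l) u v (Y i) = u (E i) * (1 / 2) * v (Y 1)"
    proof (rule single)
      show "E i \<in> ?S" using mem[of i] that n by auto
      fix g assume "g \<in> ?S"
      then show "SG_product n l g (Y 1) (Y i) = (if g = E i then 1 / 2 else 0)"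
        using that n by (cases rule: basis_cases) (auto simp: entry simp del: One_nat_def)
    qed
    then show ?thesis by simp
  qed
  show "bracket (SG n l) u v (E 1) = u (Y 1) * v (Y 1)"
  proof -
    have "bracket (SG n l) u v (E 1) = u (Y 1) * (1) * v (Y 1)"
    proof (rule single)
      show "Y 1 \<in> ?S" using memY[of 1] n by auto
      fix g assume "g \<in> ?S"
      then show "SG_product n l g (Y 1) (E 1) = (if g = Y 1 then 1 else 0)"
        using n by (cases rule: basis_cases) (auto simp: entry simp del: One_nat_def)
    qed
    then show ?thesis by simp
  qed
  show "bracket (SG n l) u v (E (j + 1)) = u (Y j) * v (Y 1)" if "2 \<le> j" "j \<le> n - 1"
  proof -
    have "bracket (SG n l) u v (E (j + 1)) = u (Y j) * (1) * v (Y 1)"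
    proof (rule single)
      show "Y j \<in> ?S" using memY[of j] that n by auto
      fix g assume "g \<in> ?S"
      then show "SG_product n l g (Y 1) (E (j + 1)) = (if g = Y j then 1 else 0)"
        using that n by (cases rule: basis_cases) (auto simp: entry simp del: One_nat_def)
    qed
    then show ?thesis by simp
  qed
  show "bracket (SG n l) u v (E 2) = 0" "bracket (SG n l) u v X = 0"
  proof -
    have "SG_product n l g (Y 1) (E 2) = 0" "SG_product n l g (Y 1) X = 0" if "g \<in> ?S" for g
      using that by (cases rule: basis_cases; auto simp: entry simp del: One_nat_def)+
    then show "bracket (SG n l) u v (E 2) = 0" "bracket (SG n l) u v X = 0"
      using none by blast+
  qed
qed

lemma SG_mult_e2:
  assumes n: "n \<ge> 3"
    and w: "\<And>h. h \<noteq> E 2 \<Longrightarrow> h \<noteq> E n \<Longrightarrow> w h = 0"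
  shows "bracket (SG n l) u w k
    = w (E 2) * (\<Sum>g\<in>insert X (nil_basis n). u g * SG_product n l g (E 2) k)"
proof -
  have E2: "E 2 \<in> insert X (nil_basis n)" using n by (auto simp: nil_basis_def)
  have "(\<Sum>h\<in>insert X (nil_basis n). u g * w h * SG_product n l g h k)
      = u g * w (E 2) * SG_product n l g (E 2) k" for g
  proof -
    have "w h * SG_product n l g h k = 0" if "h \<noteq> E 2" for h
    proof (cases "h = E n")
      case True
      then have "SG_product n l g h = 0" using n product_E_ge_3 by simp
      then show ?thesis by simp
    qed (simp add: w that)
    then have "(\<Sum>h\<in>insert X (nil_basis n). u g * w h * SG_product n l g h k)
      = (\<Sum>h\<in>insert X (nil_basis n). if h = E 2 then u g * w (E 2) * SG_product n l g (E 2) k else 0)"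
      by (intro sum.cong refl) (simp add: mult.assoc)
    also have "\<dots> = u g * w (E 2) * SG_product n l g (E 2) k"
      using E2 finite_SG_basis by (simp only: sum.delta if_True)
    finally show ?thesis .
  qed
  then show ?thesis unfolding SG_mult_apply by (simp add: sum_distrib_left algebra_simps)
qed

text \<open>In \<open>[u, e\<^sub>2]\<close> the component \<open>e\<^sub>1\<close> of \<open>u\<close> contributes to the coordinate \<open>t\<close>, and the components \<open>e\<^sub>j\<close>
  with \<open>j \<ge> 3\<close> only contribute beyond it.\<close>

lemma SG_mult_e2_coords:
  assumes n: "n \<ge> 3" and l: "l \<in> labels n"
    and w: "\<And>h. h \<noteq> E 2 \<Longrightarrow> h \<noteq> E n \<Longrightarrow> w h = 0"
    and u: "u \<in> part (SG n l) 0" "u X = 0" "u (E 2) = 0" and i: "1 \<le> i" "i \<le> label_t n l \<or> label_\<beta> l = 0"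
  shows "bracket (SG n l) u w (E i) = (if i = label_t n l then w (E 2) * u (E 1) * label_\<beta> l else 0)"
proof -
  let ?S = "insert X (nil_basis n)" and ?r = "if i = label_t n l then label_\<beta> l else 0"
  have "(\<Sum>g\<in>?S. u g * SG_product n l g (E 2) (E i)) = (\<Sum>g\<in>?S. u g * (if g = E 1 then ?r else 0))"
  proof (intro sum.cong refl)
    fix g assume g: "g \<in> ?S"
    show "u g * SG_product n l g (E 2) (E i) = u g * (if g = E 1 then ?r else 0)"
      using g
    proof (cases rule: basis_cases)
      case (E j)
      consider "j = 1" | "j = 2" | "3 \<le> j" using E by linarith
      then show ?thesis
      proof cases
        case 1
        then show ?thesis
          using E i label_t_bounds[OF n l] product_E2(1)[OF n l] by (auto simp: e_vec_def unit_vec_def)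
      next
        case 3
        then show ?thesis
          using E(1) i product_E2(2)[OF n l 3] by (auto simp: e_vec_def unit_vec_def)
      qed (use E u in simp)
    next
      case (Y j)
      then have "u g = 0" using u(1) by auto
      then show ?thesis by simp
    qed (use u in simp)
  qed
  also have "\<dots> = u (E 1) * ?r"
    using n by (intro sum_single[OF finite_SG_basis]) (auto simp: nil_basis_def)
  finally have sum: "(\<Sum>g\<in>?S. u g * SG_product n l g (E 2) (E i)) = u (E 1) * ?r" .
  have "bracket (SG n l) u w (E i) = w (E 2) * (\<Sum>g\<in>?S. u g * SG_product n l g (E 2) (E i))"
    by (rule SG_mult_e2[OF n]) (rule w)
  then show ?thesis unfolding sum by simp
qed

lemma SG_mult_e2_e2:
  assumes n: "n \<ge> 3" and l: "l \<in> labels n"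
    and w: "\<And>h. h \<noteq> E 2 \<Longrightarrow> h \<noteq> E n \<Longrightarrow> w h = 0"
  shows "bracket (SG n l) w w (E n) = w (E 2) * w (E 2) * label_\<gamma> l"
proof -
  let ?S = "insert X (nil_basis n)"
  have "(\<Sum>g\<in>?S. w g * SG_product n l g (E 2) (E n)) = (\<Sum>g\<in>?S. w g * (if g = E 2 then label_\<gamma> l else 0))"
  proof (intro sum.cong refl)
    fix g assume g: "g \<in> ?S"
    consider "g = E 2" | "g = E n" "g \<noteq> E 2" | "w g = 0" "g \<noteq> E 2" using w by blast
    then show "w g * SG_product n l g (E 2) (E n) = w g * (if g = E 2 then label_\<gamma> l else 0)"
    proof cases
      case 1
      then show ?thesis using n product_E2(3)[OF n l] by (simp add: e_vec_def unit_vec_def)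
    next
      case 2
      then show ?thesis
        using n product_E2(2)[OF n l, of n] label_t_bounds[OF n l] by (auto simp: e_vec_def unit_vec_def)
    qed simp
  qed
  also have "\<dots> = w (E 2) * label_\<gamma> l"
    using n by (intro sum_single[OF finite_SG_basis]) (auto simp: nil_basis_def)
  finally have sum: "(\<Sum>g\<in>?S. w g * SG_product n l g (E 2) (E n)) = w (E 2) * label_\<gamma> l" .
  have "bracket (SG n l) w w (E n) = w (E 2) * (\<Sum>g\<in>?S. w g * SG_product n l g (E 2) (E n))"
    by (rule SG_mult_e2[OF n]) (rule w)
  then show ?thesis unfolding sum by simp
qed

text \<open>The image of \<open>y\<^sub>1\<close> acts from the right as \<open>a\<close> times \<open>y\<^sub>1\<close>, so the images of the chain built from
  \<open>y\<^sub>1\<close> have the expected leading terms (\<open>E_all\<close>, \<open>Y_all\<close>), and \<open>a \<noteq> 0\<close> since \<open>e\<^sub>1 = [y\<^sub>1, y\<^sub>1]\<close> is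
  not sent to 0. The image \<open>w\<close> of \<open>e\<^sub>2\<close> is killed by that action, which leaves \<open>w = b e\<^sub>2 + s e\<^sub>n\<close>;
  if \<open>b\<close> were 0, it would be proportional to the image of \<open>e\<^sub>n\<close>. The images of \<open>[e\<^sub>1, e\<^sub>2]\<close> and
  \<open>[e\<^sub>2, e\<^sub>2]\<close> now give the equations between the parameters.\<close>

lemma SG_isomorphic_parameters:
  assumes n: "n \<ge> 3" and l: "l \<in> labels n" and l': "l' \<in> labels n"
    and iso: "isomorphic (SG n l) (SG n l')"
  shows "\<exists>a b. a \<noteq> 0 \<and> b \<noteq> 0 \<and> b * b * label_\<gamma> l' = a ^ (2 * n - 2) * label_\<gamma> l \<and>
    label_\<beta> l = label_\<beta> l' \<and>
    (label_\<beta> l = 1 \<longrightarrow> label_t n l = label_t n l' \<and> b * a ^ 2 = a ^ (2 * label_t n l - 2))"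
proof -
  let ?S = "insert X (nil_basis n)" and ?A = "SG n l" and ?B = "SG n l'"
  obtain h where h': "bij_betw h (carrier ?A) (carrier ?B)"
    "\<forall>u\<in>carrier ?A. \<forall>v\<in>carrier ?A. h (u + v) = h u + h v"
    "\<forall>c. \<forall>u\<in>carrier ?A. h (smult ?A c u) = smult ?B c (h u)"
    "\<forall>\<alpha>. h ` part ?A \<alpha> = part ?B \<alpha>"
    "\<forall>u\<in>carrier ?A. \<forall>v\<in>carrier ?A. h (bracket ?A u v) = bracket ?B (h u) (h v)"
    using iso unfolding isomorphic_def by (elim exE conjE) (rule that)
  have unitC: "unit_vec g \<in> carrier ?A" if "g \<in> ?S" for g
    using that by (auto simp: unit_vec_def split: if_splits)
  have scale: "h (s \<odot> u) = s \<odot> h u" if "u \<in> carrier ?A" for s u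
    using h'(3) that unfolding SG_simps(1) by blast
  have zeroC: "0 \<in> carrier ?A" by simp
  have h0: "h 0 = 0" using scale[OF zeroC, of 0] by simp
  have inj: "u = v" if "u \<in> carrier ?A" "v \<in> carrier ?A" "h u = h v" for u v
    using h'(1) that unfolding bij_betw_def inj_on_def by blast
  have mult: "bracket ?B (h (unit_vec g)) (h (unit_vec k)) = h (SG_product n l g k)"
    if "g \<in> ?S" "k \<in> ?S" for g k
  proof -
    have "bracket ?A (unit_vec g) (unit_vec k) = SG_product n l g k"
      unfolding SG_eq by (rule table_bracket_unit[OF finite_SG_basis that])
    then show ?thesis using h'(5) unitC[OF that(1)] unitC[OF that(2)] by metis
  qed
  have S: "E i \<in> ?S \<longleftrightarrow> 1 \<le> i \<and> i \<le> n" "Y j \<in> ?S \<longleftrightarrow> 1 \<le> j \<and> j \<le> n - 1" for i j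
    by (auto simp: nil_basis_def)
  define e where "e i = h (unit_vec (E i))" for i
  define y where "y j = h (unit_vec (Y j))" for j
  have ypart: "y j \<in> part ?B 1" if "1 \<le> j" "j \<le> n - 1" for j
  proof -
    have "unit_vec (Y j) \<in> part ?A 1" using S that by (auto simp: unit_vec_def split: if_splits)
    then show ?thesis using h'(4) unfolding y_def by blast
  qed
  have epart: "e i \<in> part ?B 0" if "1 \<le> i" "i \<le> n" for i
  proof -
    have "unit_vec (E i) \<in> part ?A 0" using S that by (auto simp: unit_vec_def split: if_splits)
    then show ?thesis using h'(4) unfolding e_def by blast
  qed
  have y1: "y 1 \<in> part ?B 1" by (rule ypart) (use n in linarith)+
  define a where "a = y 1 (Y 1)"
  note coords = SG_mult_odd_coords[OF n y1, folded a_def]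
  have prod_y1: "bracket ?B (y j) (y 1) = e (if j = 1 then 1 else j + 1)" if "1 \<le> j" "j \<le> n - 1" for j
  proof -
    have "SG_product n l (Y j) (Y 1) = unit_vec (E (if j = 1 then 1 else j + 1))"
      using that n by (auto simp: product_Y1 e_vec_def simp del: One_nat_def)
    then show ?thesis using mult[of "Y j" "Y 1"] S that n unfolding e_def y_def by simp
  qed
  have half: "bracket ?B (e (if j = 2 then 1 else j)) (y 1) = (1/2) \<odot> y j" if "2 \<le> j" "j \<le> n - 1" for j
  proof -
    have "SG_product n l (E (if j = 2 then 1 else j)) (Y 1) = (1/2) \<odot> unit_vec (Y j)"
      using that n by (auto simp: product_Y1 y_vec_def simp del: One_nat_def)
    then show ?thesis
      using mult[of "E (if j = 2 then 1 else j)" "Y 1"] S that n scale[OF unitC[of "Y j"]]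
      unfolding e_def y_def by auto
  qed
  have y_from_e: "y j k = 2 * bracket ?B (e (if j = 2 then 1 else j)) (y 1) k"
    if "2 \<le> j" "j \<le> n - 1" for j k
    unfolding half[OF that] by simp
  have e1: "e 1 = bracket ?B (y 1) (y 1)" using prod_y1[of 1] n by simp
  have e1c: "e 1 (E 1) = a ^ 2" "e 1 X = 0" "e 1 (E 2) = 0"
    unfolding e1 coords by (simp_all add: a_def power2_eq_square)
  have y2c: "y 2 (Y 1) = 0" "y 2 (Y 2) = a ^ 3"
  proof -
    have y2: "y 2 k = 2 * bracket ?B (e 1) (y 1) k" for k
      using y_from_e[of 2 k] n by (simp del: One_nat_def)
    show "y 2 (Y 1) = 0" "y 2 (Y 2) = a ^ 3"
      unfolding y2 coords e1c by (simp_all add: power3_eq_cube power2_eq_square)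
  qed
  have E_Suc: "e (j + 1) X = 0 \<and> (\<forall>i. 1 \<le> i \<longrightarrow> i < j + 1 \<longrightarrow> e (j + 1) (E i) = 0)
      \<and> e (j + 1) (E (j + 1)) = a ^ (2 * j)"
    if j: "2 \<le> j" "j \<le> n - 1" and yj: "\<forall>i. 1 \<le> i \<longrightarrow> i < j \<longrightarrow> y j (Y i) = 0" "y j (Y j) = a ^ (2 * j - 1)" for j
  proof -
    have e: "e (j + 1) = bracket ?B (y j) (y 1)" using prod_y1[of j] j by simp
    have "e (j + 1) (E i) = 0" if i: "1 \<le> i" "i < j + 1" for i
    proof -
      consider "i = 1" | "i = 2" | "3 \<le> i" using i by linarith
      then show ?thesis
      proof cases
        case 3
        then show ?thesis using coords(5)[of "i - 1" "y j"] yj(1) i j unfolding e by simp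
      qed (use yj(1) j in \<open>simp_all only: e coords\<close>, auto)
    qed
    moreover have "e (j + 1) (E (j + 1)) = a ^ (2 * j)"
    proof -
      have "2 * j = Suc (2 * j - 1)" using j by simp
      then have "a ^ (2 * j) = a ^ (2 * j - 1) * a" by (metis power_Suc2)
      then show ?thesis unfolding e coords(5)[OF j] yj(2) by simp
    qed
    ultimately show ?thesis unfolding e coords by blast
  qed
  have Y_all: "(\<forall>i. 1 \<le> i \<longrightarrow> i < j \<longrightarrow> y j (Y i) = 0) \<and> y j (Y j) = a ^ (2 * j - 1)"
    if "2 \<le> j" "j \<le> n - 1" for j
    using that
  proof (induction j rule: dec_induct)
    case base
    have "y 2 (Y i) = 0" if "1 \<le> i" "i < 2" for i
    proof -
      have "i = 1" using that by simp
      then show ?thesis using y2c(1) by blast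
    qed
    moreover have "y 2 (Y 2) = a ^ (2 * 2 - 1)" using y2c(2) by simp
    ultimately show ?case by blast
  next
    case (step j)
    then have IH: "\<forall>i. 1 \<le> i \<longrightarrow> i < j \<longrightarrow> y j (Y i) = 0" "y j (Y j) = a ^ (2 * j - 1)"
      and j: "2 \<le> j" "j \<le> n - 1" "Suc j \<le> n - 1" by auto
    note E = E_Suc[OF j(1,2) IH]
    have y: "y (Suc j) k = 2 * bracket ?B (e (j + 1)) (y 1) k" for k
      using y_from_e[of "Suc j"] j by simp
    have "y (Suc j) (Y i) = 0" if i: "1 \<le> i" "i < Suc j" for i
    proof -
      consider "i = 1" | "i = 2" | "3 \<le> i" using i by linarith
      then show ?thesis
      proof cases
        case 1
        then show ?thesis unfolding y 1 coords using E by simp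
      next
        case 2
        then show ?thesis unfolding y 2 coords using E j by simp
      next
        case 3
        then have "i \<le> n - 1" using i j by simp
        then show ?thesis unfolding y coords(3)[OF 3 \<open>i \<le> n - 1\<close>] using E i by simp
      qed
    qed
    moreover have "y (Suc j) (Y (Suc j)) = a ^ (2 * Suc j - 1)"
    proof -
      have "2 * Suc j - 1 = Suc (2 * j)" by simp
      moreover have "3 \<le> Suc j" using j by simp
      ultimately show ?thesis unfolding y coords(3)[OF \<open>3 \<le> Suc j\<close> j(3)] using E by simp
    qed
    ultimately show ?case by blast
  qed
  have E_all: "(\<forall>i. 1 \<le> i \<longrightarrow> i < k \<longrightarrow> e k (E i) = 0) \<and> e k (E k) = a ^ (2 * k - 2) \<and> e k X = 0"
    if k: "3 \<le> k" "k \<le> n" for k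
  proof -
    have j: "2 \<le> k - 1" "k - 1 \<le> n - 1" "k - 1 + 1 = k" "2 * (k - 1) = 2 * k - 2" using k by auto
    show ?thesis
      using E_Suc[OF j(1,2)] Y_all[OF j(1,2)] unfolding j(3,4) by blast
  qed
  have a0: "a \<noteq> 0"
  proof
    assume "a = 0"
    then have "e 1 k = 0" for k unfolding e1 SG_mult_odd[OF n y1] by (simp add: a_def)
    then have "h (unit_vec (E 1)) = h 0" using h0 by (simp add: e_def fun_eq_iff)
    then have "unit_vec (E 1) = 0" using inj[OF unitC zeroC] S n by simp
    then have "unit_vec (E 1) (E 1) = (0 :: vec) (E 1)" by (rule arg_cong)
    then show False by (simp add: unit_vec_def)
  qed
  define w where "w = e 2"
  have wp: "w \<in> part ?B 0" unfolding w_def by (rule epart) (use n in linarith)+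
  have "SG_product n l (E 2) (Y 1) = 0" by (simp add: product_Y1 del: One_nat_def)
  then have wy: "bracket ?B w (y 1) = 0"
    using mult[of "E 2" "Y 1"] S n h0 unfolding w_def e_def y_def by simp
  have wX: "w X = 0" using coords(1)[of w] a0 unfolding wy by simp
  have w1: "w (E 1) = 0" using coords(2)[of w] a0 unfolding wy by simp
  have wi: "w (E i) = 0" if "3 \<le> i" "i \<le> n - 1" for i using coords(3)[OF that, of w] a0 unfolding wy by simp
  have w: "w k = 0" if "k \<noteq> E 2" "k \<noteq> E n" for k
  proof (cases k)
    case (E i)
    show ?thesis
    proof (cases "1 \<le> i \<and> i \<le> n")
      case True
      have "i \<noteq> 2" "i \<noteq> n" using that E by auto
      then consider "i = 1" | "3 \<le> i" "i \<le> n - 1" using True by linarith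
      then show ?thesis using w1 wi E by cases auto
    next
      case False
      then have "E i \<notin> ?S" using S by blast
      then show ?thesis using wp E unfolding SG_simps by blast
    qed
  next
    case (Y j)
    then show ?thesis using wp by auto
  qed (simp add: wX)
  define b where "b = w (E 2)"
  have b0: "b \<noteq> 0"
  proof
    assume b: "b = 0"
    have ep: "e n \<in> part ?B 0" by (rule epart) (use n in linarith)+
    have en: "e n k = 0" if "k \<noteq> E n" for k
    proof (cases k)
      case (E i)
      show ?thesis
      proof (cases "1 \<le> i \<and> i \<le> n")
        case True
        then show ?thesis using E_all[OF n order_refl] that E by auto
      next
        case False
        then have "E i \<notin> ?S" using S by blast
        then show ?thesis using ep E unfolding SG_simps by blast
      qed
    next
      case (Y j)
      then show ?thesis using ep by auto
    qed (use E_all[OF n order_refl] in simp)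
    have enn: "e n (E n) \<noteq> 0" using E_all[OF n order_refl] a0 by simp
    have "w = (w (E n) / e n (E n)) \<odot> e n"
    proof
      fix k
      show "w k = ((w (E n) / e n (E n)) \<odot> e n) k"
        using w[of k] en[of k] b enn by (cases "k = E n"; cases "k = E 2") (auto simp: b_def)
    qed
    also have "\<dots> = h ((w (E n) / e n (E n)) \<odot> unit_vec (E n))"
      using scale[OF unitC] S n by (simp add: e_def)
    finally have "h (unit_vec (E 2)) = h ((w (E n) / e n (E n)) \<odot> unit_vec (E n))"
      unfolding w_def e_def .
    moreover have "(w (E n) / e n (E n)) \<odot> unit_vec (E n) \<in> carrier ?A"
      using S n by (auto simp: unit_vec_def split: if_splits)
    ultimately have "unit_vec (E 2) = (w (E n) / e n (E n)) \<odot> unit_vec (E n)"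
      using inj[OF unitC] S n by simp
    then have "unit_vec (E 2) (E 2) = ((w (E n) / e n (E n)) \<odot> unit_vec (E n)) (E 2)" by simp
    then show False using n by (simp add: unit_vec_def)
  qed
  let ?t = "label_t n l" and ?t' = "label_t n l'"
  note t = label_t_bounds[OF n l] and t' = label_t_bounds[OF n l']
  have "bracket ?B w w = label_\<gamma> l \<odot> e n"
    using mult[of "E 2" "E 2"] S n scale[OF unitC[of "E n"]] product_E2(3)[OF n l] e_vec_unit[of n n]
    unfolding w_def e_def by simp
  moreover have "bracket ?B w w (E n) = b * b * label_\<gamma> l'"
    unfolding b_def by (rule SG_mult_e2_e2[OF n l']) (rule w)
  ultimately have "b * b * label_\<gamma> l' = label_\<gamma> l * e n (E n)" by simp
  then have gam: "b * b * label_\<gamma> l' = a ^ (2 * n - 2) * label_\<gamma> l"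
    using E_all[OF n order_refl] by simp
  have e1w: "bracket ?B (e 1) w = label_\<beta> l \<odot> e ?t"
    using mult[of "E 1" "E 2"] S n t scale[OF unitC[of "E ?t"]] product_E2(1)[OF n l] e_vec_unit[of ?t n]
    unfolding w_def e_def by simp
  have e1p: "e 1 \<in> part ?B 0" by (rule epart) (use n in linarith)+
  have left: "label_\<beta> l * e ?t (E i) = (if i = ?t' then b * a ^ 2 * label_\<beta> l' else 0)"
    if "1 \<le> i" "i \<le> ?t' \<or> label_\<beta> l' = 0" for i
  proof -
    have "bracket ?B (e 1) w (E i) = (if i = ?t' then w (E 2) * e 1 (E 1) * label_\<beta> l' else 0)"
      by (rule SG_mult_e2_coords[OF n l' _ e1p e1c(2,3) that]) (rule w)
    then show ?thesis unfolding e1w e1c(1) b_def by simp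
  qed
  have right: "e ?t (E i) = 0" if "1 \<le> i" "i < ?t" for i using E_all[OF t] that by blast
  have right_t: "e ?t (E ?t) = a ^ (2 * ?t - 2)" using E_all[OF t] by blast
  have cases: "label_\<beta> k = 0 \<or> label_\<beta> k = 1" for k by (cases k) auto
  have "label_\<beta> l = label_\<beta> l' \<and>
    (label_\<beta> l = 1 \<longrightarrow> ?t = ?t' \<and> b * a ^ 2 = a ^ (2 * ?t - 2))"
  proof (cases "label_\<beta> l' = 0")
    case True
    then have "label_\<beta> l * e ?t (E ?t) = 0" using left[of ?t] t by (auto split: if_splits)
    then have "label_\<beta> l = 0" using right_t a0 by simp
    then show ?thesis using True by simp
  next
    case False
    then have l'1: "label_\<beta> l' = 1" using cases by blast
    have "label_\<beta> l * e ?t (E ?t') = b * a ^ 2" using left[of ?t'] t' l'1 by simp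
    then have ne: "label_\<beta> l \<noteq> 0" "e ?t (E ?t') \<noteq> 0" using a0 b0 by auto
    then have l1: "label_\<beta> l = 1" using cases by blast
    have "\<not> ?t' < ?t" using ne(2) right t' by auto
    moreover have "\<not> ?t < ?t'" using left[of ?t] l1 t right_t a0 by auto
    ultimately have "?t = ?t'" by simp
    then show ?thesis using l1 l'1 left[of ?t'] t' right_t by simp
  qed
  then show ?thesis using a0 b0 gam by blast
qed


text \<open>The coefficient \<open>\<beta>\<close> separates \<open>SG3\<close> from the other two families, and \<open>\<gamma> = 0\<close> separates \<open>SG1\<close> from \<open>SG2\<close>.
  Within \<open>SG1\<close> the parameter \<open>t\<close> is preserved. Within \<open>SG2\<close> all members share the same \<open>t\<close>, and the
  relation \<open>b = a\<^sup>2\<^sup>t\<^sup>-\<^sup>4 = a\<^sup>n\<^sup>-\<^sup>1\<close> makes the two sides of the equation for \<open>\<gamma>\<close> scale by the same factor.\<close>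

theorem theorem4p15:
  fixes n :: nat
  assumes "n \<ge> 3"
  shows
    "(\<forall>L :: 'a::ab_group_add superalg.
        leibniz_superalgebra L \<and> solvable L \<and> \<not> nilpotent L \<and>
        (\<exists>N \<beta> \<gamma>. is_nilradical L N \<and> non_split n \<beta> \<gamma> \<and> isomorphic (restrict_to L N) (G n \<beta> \<gamma>))
        \<longrightarrow> (\<exists>l\<in>labels n. isomorphic L (SG n l))) \<and>
     (\<forall>l\<in>labels n. \<forall>l'\<in>labels n. l \<noteq> l' \<longrightarrow> \<not> isomorphic (SG n l) (SG n l'))"
proof (intro conjI allI impI ballI notI)
  fix L :: "'a superalg"
  assume L: "leibniz_superalgebra L \<and> solvable L \<and> \<not> nilpotent L \<and>
    (\<exists>N \<beta> \<gamma>. is_nilradical L N \<and> non_split n \<beta> \<gamma> \<and> isomorphic (restrict_to L N) (G n \<beta> \<gamma>))"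
  interpret leibniz_superalg L by unfold_locales (use L in blast)
  show "\<exists>l\<in>labels n. isomorphic L (SG n l)"
    using L exists_isomorphic_SG[OF assms] by blast
next
  fix l l' assume l: "l \<in> labels n" "l' \<in> labels n" "l \<noteq> l'" and iso: "isomorphic (SG n l) (SG n l')"
  obtain a b where ab: "a \<noteq> 0" "b \<noteq> 0" "b * b * label_\<gamma> l' = a ^ (2 * n - 2) * label_\<gamma> l"
    "label_\<beta> l = label_\<beta> l'"
    "label_\<beta> l = 1 \<longrightarrow> label_t n l = label_t n l' \<and> b * a ^ 2 = a ^ (2 * label_t n l - 2)"
    using SG_isomorphic_parameters[OF assms l(1,2) iso] by blast
  show False
  proof (cases l)
    case (SG1 t)
    then show False using ab l by (cases l') (auto simp: labels_def)
  next
    case (SG2 \<gamma>)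
    then obtain \<gamma>' where l': "l' = SG2 \<gamma>'" using ab l by (cases l') (auto simp: labels_def)
    have "odd n" using l(1) SG2 by (auto simp: labels_def)
    then obtain k where k: "n = 2 * k + 1" by (rule oddE)
    have "(n + 3) div 2 = k + 2" using k by simp
    then have "b * a ^ 2 = a ^ (2 * k + 2)" using ab(5) SG2 by simp
    then have "b * a ^ 2 = a ^ (2 * k) * a ^ 2" by (simp only: power_add)
    then have "b = a ^ (2 * k)" using ab(1) by simp
    then have "b * b = a ^ (2 * n - 2)" by (simp add: k power_add[symmetric])
    then have "\<gamma>' = \<gamma>" using ab(1,3) SG2 l' by simp
    then show False using l(3) SG2 l' by simp
  next
    case SG3
    then show False using ab l by (cases l') (auto simp: labels_def)
  qed
qed

end
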